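(* Assume the Elliott–Halberstam conjecture: for every fixed $0<\vartheta<1$ and every fixed $A>1$ there is a constant $C=C(\vartheta,A)$ such that for all $x\ge2$, $$\sum_{r<x^\vartheta}\ \sup_{a\in(\mathbb Z/r\mathbb Z)^\times}\Big|\sum_{n\le x:\ n\equiv a\ (\mathrm{mod}\ r)}\Lambda(n)-\frac{x}{\phi(r)}\Big|\le C\,x\log^{-A}x .$$ Then for every fixed integer $d\ge1$ and fixed $\varepsilon>0$ there is a constant $C_{d,\varepsilon}$ such that for every prime $p$ for which $p-1$ is a product of at most $d$ primes (counted with multiplicity), the least primitive root modulo $p$ is at most $C_{d,\varepsilon}\,p^{\varepsilon}$.
   Context: $\Lambda$ is the von Mangoldt function, $\phi$ is Euler's totient function, and $(\mathbb Z/r\mathbb Z)^\times$ denotes the primitive residue classes modulo $r$. A primitive root modulo $p$ is a natural number whose residue generates the multiplicative group $(\mathbb Z/p\mathbb Z)^\times$. *)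

theory Defs
  imports Complex_Main "HOL-Number_Theory.Number_Theory"
begin

definition psi_ap :: "real \<Rightarrow> nat \<Rightarrow> nat \<Rightarrow> real" where
  "psi_ap x r a = (\<Sum>n\<in>{n. 1 \<le> n \<and> real n \<le> x \<and> [n = a] (mod r)}. mangoldt n)"

definition elliott_halberstam :: bool where
  "elliott_halberstam \<longleftrightarrow>
     (\<forall>\<theta> A :: real. 0 < \<theta> \<and> \<theta> < 1 \<and> A > 1 \<longrightarrow>
        (\<exists>C :: real. \<forall>x :: real. x \<ge> 2 \<longrightarrow>
           (\<Sum>r\<in>{r :: nat. 0 < r \<and> real r < x powr \<theta>}.
              Max {\<bar>psi_ap x r a - x / real (totient r)\<bar> | a. a < r \<and> coprime a r})
           \<le> C * x * ln x powr (- A)))"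

definition least_primroot :: "nat \<Rightarrow> nat" where
  "least_primroot p = (LEAST g. residue_primroot p g)"

end

theory Submission
  imports Defs "HOL-Complex_Analysis.Complex_Analysis" "HOL-Real_Asymp.Real_Asymp"
begin

text \<open>
  Suppose a nonprincipal character \<open>\<xi>\<close> modulo \<open>p\<close> equals 1 at all \<open>n \<le> p\<^sup>\<epsilon>\<close>.  Then \<open>\<xi> = 1 * g\<close> with \<open>g\<close>
  supported on integers without prime factors up to \<open>p\<^sup>\<epsilon>\<close>, and \<open>g\<close> is bounded on the range
  \<open>r \<le> p\<^sup>5\<close>.  By periodicity \<open>\<Sum>\<Lambda>(n)\<xi>(n)\<close> is a sum of \<open>\<xi>\<close> over the shifted primes \<open>n + p\<close>, so for
  \<open>p\<^sup>2 \<le> x \<le> p\<^sup>4\<close> the Elliott--Halberstam conjecture evaluates it as \<open>x \<Sum> g(r)/r + o(x)\<close>.  The same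
  formula holds for the sum of \<open>\<xi>\<close> over all integers up to \<open>x\<close>, which is \<open>O(p)\<close>; hence
  \<open>\<Sum>\<^bsub>n \<le> x\<^esub> \<Lambda>(n)\<xi>(n) = o(x)\<close>.

  Let \<open>A(w)\<close> be the Dirichlet series of \<open>\<xi>\<close>, truncated at \<open>p\<^sup>4\<close>, as a function of \<open>w\<close> with
  \<open>s = 1 + (\<kappa> + w)/log p\<close>.  The two cancellations make the truncated series of \<open>\<Lambda>\<xi>\<close> nearly equal
  to \<open>- A'/A\<close>, so \<open>A\<close> is nearly the exponential of an entire function whose real part is bounded
  above by a linear function of \<open>|w|\<close>.  By Borel--Caratheodory this function is nearly linear, so
  \<open>\<Sum>\<Lambda>(n)\<xi>(n)/n\<^sup>s v\<^sup>j\<close>, \<open>v = log n/log p\<close>, is \<open>o(log p)\<close> for each \<open>j \<ge> 1\<close>.  Testing against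
  \<open>v (1 - v/4)\<^sup>K\<close>, which concentrates on the range \<open>n \<le> p\<^sup>\<epsilon>\<close> where \<open>\<xi> = 1\<close>, is a contradiction.

  Thus for each prime \<open>l\<close> dividing \<open>p - 1\<close> there is an \<open>l\<close>-th power nonresidue up to \<open>p\<^sup>\<epsilon>\<close>.  A product
  of powers of these, with exponents bounded in terms of \<open>d\<close>, is a primitive root.
\<close>

text \<open>The main term \<open>x \<Sum> g(r)/r\<close> is never evaluated: it is eliminated by
  comparing two weights that share it. The obstacle is that every level of distribution falls short
  of \<open>x\<close>. The larger divisors are removed by Turan's second moment over the primes in
  \<open>(w, z]\<close>, which needs \<open>w\<close> to be a much smaller power of \<open>p\<close>
  than \<open>z\<close>; this decides how close to 1 the exponent in the conjecture must be.

  The range from \<open>p^2\<close> to \<open>p^4\<close> serves both cancellations: a character sum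
  \<open>O(p)\<close> is negligible beyond \<open>p^2\<close>, and \<open>d m > p^4\<close> forces
  \<open>d\<close> or \<open>m\<close> up to at least \<open>p^2\<close>.

  No zero-free region enters. The damping \<open>\<kappa> = 3/\<epsilon>\<close> lets the terms with
  \<open>\<xi> = 1\<close> dominate \<open>A(0)\<close>, which is thus bounded below in terms of
  \<epsilon> alone. On a disc of radius \<open>R\<close> the logarithm of \<open>A\<close> is
  \<open>O(R)\<close>, so by Cauchy its derivative of order \<open>j + 1\<close> at 0 is
  \<open>O(R^(-j))\<close>. This is small only for \<open>j \<ge> 1\<close>: the slope is not
  controlled, hence the factor \<open>v\<close> in the test function.\<close>

section \<open>Rough numbers and their divisors\<close>

abbreviation (input) bigomega :: "nat \<Rightarrow> nat" where
  "bigomega n \<equiv> size (prime_factorization n)"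

definition rough :: "real \<Rightarrow> nat \<Rightarrow> bool" where
  "rough z n \<longleftrightarrow> n > 0 \<and> (\<forall>q. prime q \<and> q dvd n \<longrightarrow> z < real q)"

lemma rough_1 [simp]: "rough z (Suc 0)"
  by (auto simp: rough_def)

lemma rough_pos: "rough z n \<Longrightarrow> n > 0"
  by (simp add: rough_def)

lemma rough_mono: "rough z n \<Longrightarrow> w \<le> z \<Longrightarrow> rough w n"
  unfolding rough_def using order_le_less_trans by blast

lemma rough_part:
  assumes "m > 0"
  obtains a b where "m = a * b" "rough z a" "\<And>q. prime q \<Longrightarrow> q dvd b \<Longrightarrow> real q \<le> z"
  using assms
proof (induction m arbitrary: thesis rule: less_induct)
  case (less m)
  show ?case
  proof (cases "rough z m")
    case True
    show ?thesis by (rule less.prems(1)[of m 1]) (use True in auto)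
  next
    case False
    then obtain q where q: "prime q" "q dvd m" "real q \<le> z"
      using less.prems(2) by (auto simp: rough_def not_less)
    then obtain m' where m': "m = q * m'" by auto
    have "m' < m" "m' > 0" using m' less.prems(2) prime_gt_1_nat[OF q(1)] by auto
    from less.IH[OF this(1) _ this(2)] obtain a b where ab: "m' = a * b" "rough z a"
      "\<And>q. prime q \<Longrightarrow> q dvd b \<Longrightarrow> real q \<le> z" by metis
    show ?thesis
    proof (rule less.prems(1)[of a "q * b"])
      fix r assume r: "prime r" "r dvd q * b"
      then have "r = q \<or> r dvd b" using q(1) by (metis prime_dvd_mult_nat primes_dvd_imp_eq)
      then show "real r \<le> z" using q(3) ab(3)[OF r(1)] by blast
    qed (use ab(1,2) m' in \<open>simp_all add: mult_ac\<close>)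
  qed
qed

lemma rough_coprime:
  assumes "rough z d" "\<And>q. prime q \<Longrightarrow> q dvd b \<Longrightarrow> real q \<le> z"
  shows "coprime d b"
proof (rule ccontr)
  assume "\<not> coprime d b"
  then have "gcd d b \<noteq> 1" by (metis coprime_iff_gcd_eq_1)
  then obtain q where "prime q" "q dvd gcd d b" using prime_factor_nat by blast
  then have q: "prime q" "q dvd d" "q dvd b" by auto
  have "z < real q" using assms(1) q unfolding rough_def by blast
  then show False using assms(2)[OF q(1,3)] by simp
qed

lemma rough_dvd_rough_part:
  assumes "m = a * b" "\<And>q. prime q \<Longrightarrow> q dvd b \<Longrightarrow> real q \<le> z" "rough z d" "d dvd m"
  shows "d dvd a"
  using rough_coprime[OF assms(3,2)] assms(1,4) by (simp add: coprime_dvd_mult_left_iff)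

lemma card_divisors_le: "n > 0 \<Longrightarrow> card {d. d dvd n} \<le> 2 ^ bigomega n"
proof (induction n rule: less_induct)
  case (less n)
  show ?case
  proof (cases "n = 1")
    case True
    then have "{d. d dvd n} = {1}" by auto
    then show ?thesis by simp
  next
    case False
    then obtain q where q: "prime q" "q dvd n" using prime_factor_nat by blast
    then obtain m where m: "n = q * m" by auto
    have mn: "m < n" "m > 0" using m less.prems prime_gt_1_nat[OF q(1)] by auto
    have sub: "{d. d dvd n} \<subseteq> {d. d dvd m} \<union> (\<lambda>d. q * d) ` {d. d dvd m}"
    proof
      fix d assume "d \<in> {d. d dvd n}"
      then have d: "d dvd q * m" using m by simp
      show "d \<in> {d. d dvd m} \<union> (\<lambda>d. q * d) ` {d. d dvd m}"
      proof (cases "q dvd d")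
        case True
        then obtain e where "d = q * e" by auto
        then show ?thesis using d q(1) by (auto simp: prime_gt_0_nat)
      next
        case False
        then have "coprime d q" using q(1) prime_imp_coprime_nat coprime_commute by blast
        then show ?thesis using d by (simp add: coprime_dvd_mult_right_iff)
      qed
    qed
    have fin: "finite {d. d dvd m}" using mn by simp
    have "card {d. d dvd n} \<le> card ({d. d dvd m} \<union> (\<lambda>d. q * d) ` {d. d dvd m})"
      by (rule card_mono) (use sub fin in auto)
    also have "\<dots> \<le> card {d. d dvd m} + card ((\<lambda>d. q * d) ` {d. d dvd m})" by (rule card_Un_le)
    also have "\<dots> \<le> card {d. d dvd m} + card {d. d dvd m}" using card_image_le[OF fin] by simp
    also have "\<dots> \<le> 2 ^ bigomega n"
      using less.IH[OF mn] m mn q by (simp add: prime_factorization_mult prime_factorization_prime)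
    finally show ?thesis .
  qed
qed

lemma bigomega_strict_mono:
  assumes "d dvd n" "d < n" "n > 0"
  shows "bigomega d < bigomega n"
proof -
  obtain e where e: "n = d * e" using assms(1) by auto
  have "e \<noteq> 1" "e \<noteq> 0" "d \<noteq> 0" using assms e by auto
  then have "prime_factorization e \<noteq> {#}"
    by (simp add: prime_factorization_empty_iff)
  then have "bigomega e > 0" by (metis size_empty gr0I size_eq_0_iff_empty)
  then show ?thesis using e \<open>e \<noteq> 0\<close> \<open>d \<noteq> 0\<close> by (simp add: prime_factorization_mult)
qed

lemma rough_power_le:
  assumes "rough z n" "z \<ge> 1"
  shows "z ^ bigomega n \<le> real n"
proof -
  have "z ^ size M \<le> real (prod_mset M)" if "\<forall>q\<in>#M. z < real q" for M :: "nat multiset"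
    using that
  proof (induction M)
    case (add q M)
    have "z * z ^ size M \<le> real q * real (prod_mset M)"
      using add assms(2) by (intro mult_mono) auto
    then show ?case by simp
  qed simp
  from this[of "prime_factorization n"] assms(1) show ?thesis
    unfolding rough_def by (auto simp: prod_mset_prime_factorization_nat)
qed

text \<open>The source of uniformity in \<open>p\<close>: when \<open>z\<close> is a fixed power of
  \<open>p\<close>, the exponent \<open>k\<close> does not depend on \<open>p\<close>, and divisor
  counts and values of the transform become \<open>O(1)\<close>.\<close>

lemma rough_bigomega_le:
  assumes "rough z n" "z > 1" "real n \<le> z ^ k"
  shows "bigomega n \<le> k"
  using rough_power_le[OF assms(1)] assms(2,3)
  by (meson less_imp_le order_trans power_le_imp_le_exp)

text \<open>A rough divisor is coprime to the smooth cofactor \<open>b\<close>, so it divides the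
  rough part \<open>a\<close>, which has at most \<open>k\<close> prime factors.\<close>

lemma card_rough_divisors_le:
  assumes "m > 0" "z > 1" "real m \<le> z ^ k"
  shows "card {d. d dvd m \<and> rough z d} \<le> 2 ^ k"
proof -
  obtain a b where ab: "m = a * b" "rough z a" "\<And>q. prime q \<Longrightarrow> q dvd b \<Longrightarrow> real q \<le> z"
    using rough_part[OF assms(1), where z=z] by metis
  have a: "a > 0" "a \<le> m" using ab assms(1) by auto
  have "{d. d dvd m \<and> rough z d} \<subseteq> {d. d dvd a}"
    using rough_dvd_rough_part[OF ab(1,3)] by blast
  then have "card {d. d dvd m \<and> rough z d} \<le> card {d. d dvd a}"
    using a by (intro card_mono) auto
  also have "\<dots> \<le> 2 ^ bigomega a" by (rule card_divisors_le[OF a(1)])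
  also have "\<dots> \<le> 2 ^ k"
    using rough_bigomega_le[OF ab(2) assms(2), of k] a(2) assms(3) by (auto intro!: power_increasing)
  finally show ?thesis .
qed

section \<open>The Moebius transform supported on rough numbers\<close>

text \<open>If \<open>f\<close> is completely multiplicative and equal to 1 at the primes up to \<open>z\<close>, this is the
  Moebius transform of \<open>f\<close>: then \<open>f = 1 * g\<close> with \<open>g\<close> supported on \<open>z\<close>-rough numbers.\<close>

function rough_transform :: "(nat \<Rightarrow> complex) \<Rightarrow> real \<Rightarrow> nat \<Rightarrow> complex" where
  "rough_transform f z r =
     (if rough z r then f r - (\<Sum>d\<in>{d. d dvd r \<and> d < r}. rough_transform f z d) else 0)"
  by auto
termination by (relation "Wellfounded.measure (\<lambda>(f,z,r). r)") auto

declare rough_transform.simps [simp del]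

lemma rough_transform_eq_0: "\<not> rough z r \<Longrightarrow> rough_transform f z r = 0"
  by (simp add: rough_transform.simps)

lemma completely_mult_eq_1:
  fixes f :: "nat \<Rightarrow> complex"
  assumes "\<And>m n. f (m * n) = f m * f n" "f 1 = 1" "n > 0" "\<And>q. prime q \<Longrightarrow> q dvd n \<Longrightarrow> f q = 1"
  shows "f n = 1"
  using assms(3,4)
proof (induction n rule: less_induct)
  case (less n)
  show ?case
  proof (cases "n = 1")
    case False
    then obtain q where q: "prime q" "q dvd n" using prime_factor_nat by blast
    then obtain m where m: "n = q * m" by auto
    have "m < n" "m > 0" using m less.prems prime_gt_1_nat[OF q(1)] by auto
    then have "f m = 1" using less m by auto
    then show ?thesis using less.prems(2)[OF q] m assms(1) by simp
  qed (use assms(2) in simp)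
qed

text \<open>Only divisors of the rough part \<open>a\<close> carry a nonzero value, and there the
  recursion, solved for \<open>f a\<close>, is the claim. The cofactor \<open>b\<close> consists of
  primes at which \<open>f\<close> is 1.\<close>

lemma sum_rough_transform:
  assumes f: "\<And>m n. f (m * n) = f m * f n" "f 1 = 1"
    and one: "\<And>q. prime q \<Longrightarrow> real q \<le> z \<Longrightarrow> f q = 1" and "m > 0"
  shows "(\<Sum>d | d dvd m. rough_transform f z d) = f m"
proof -
  obtain a b where ab: "m = a * b" "rough z a" "\<And>q. prime q \<Longrightarrow> q dvd b \<Longrightarrow> real q \<le> z"
    using rough_part[OF assms(4), where z=z] by metis
  have pos: "a > 0" "b > 0" using ab assms(4) by auto
  have "(\<Sum>d | d dvd m. rough_transform f z d) = (\<Sum>d | d dvd a. rough_transform f z d)"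
    using assms(4) ab rough_dvd_rough_part[OF ab(1,3)]
    by (intro sum.mono_neutral_right) (auto intro!: rough_transform_eq_0)
  also have "{d. d dvd a} = insert a {d. d dvd a \<and> d < a}"
    using pos by (auto dest: dvd_imp_le)
  also have "(\<Sum>d\<in>insert a {d. d dvd a \<and> d < a}. rough_transform f z d) = f a"
    using ab(2) by (subst sum.insert) (auto simp: rough_transform.simps[of f z a])
  also have "f b = 1"
    by (rule completely_mult_eq_1) (use f pos ab(3) one in auto)
  then have "f a = f m" using ab(1) f by simp
  finally show ?thesis .
qed

text \<open>With \<open>k \<ge> 1\<close> prime factors there are at most \<open>2 ^ k - 1\<close>
  proper divisors, each with at most \<open>k - 1\<close> prime factors, and
  \<open>k + (k - 1)\<^sup>2 \<le> k\<^sup>2\<close>. The bound is crude, but enough when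
  \<open>bigomega r\<close> is bounded.\<close>

lemma norm_rough_transform_le:
  assumes "\<And>n. norm (f n) \<le> 1"
  shows "norm (rough_transform f z r) \<le> 2 ^ (bigomega r)\<^sup>2"
proof (induction r rule: less_induct)
  case (less r)
  show ?case
  proof (cases "rough z r")
    case True
    let ?k = "bigomega r" and ?D = "{d. d dvd r \<and> d < r}"
    have r: "r > 0" using True by (rule rough_pos)
    have fin: "finite {d. d dvd r}" using r by simp
    have D: "{d. d dvd r} = insert r ?D" using r by (auto dest: dvd_imp_le)
    have cD: "card ?D + 1 \<le> 2 ^ ?k"
      using card_divisors_le[OF r] fin unfolding D by simp
    have *: "norm (rough_transform f z r) \<le> 1 + (\<Sum>d\<in>?D. norm (rough_transform f z d))"
      using True assms[of r] norm_triangle_ineq4[of "f r" "(\<Sum>d\<in>?D. rough_transform f z d)"]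
        norm_sum[of "rough_transform f z" ?D] by (simp add: rough_transform.simps[of f z r])
    show ?thesis
    proof (cases "?k = 0")
      case True
      then have "?D = {}" using bigomega_strict_mono[of _ r] r by auto
      then show ?thesis using * True by (simp only: sum.empty) simp
    next
      case False
      then have sq: "?k\<^sup>2 \<ge> ?k + (?k - 1)\<^sup>2"
        by (cases ?k) (auto simp: power2_eq_square)
      have "norm (rough_transform f z d) \<le> 2 ^ (?k - 1)\<^sup>2" if "d \<in> ?D" for d
      proof -
        have "bigomega d \<le> ?k - 1" using bigomega_strict_mono[of d r] that r by auto
        then have "(2::real) ^ (bigomega d)\<^sup>2 \<le> 2 ^ (?k - 1)\<^sup>2"
          by (intro power_increasing power_mono) auto
        moreover have "norm (rough_transform f z d) \<le> 2 ^ (bigomega d)\<^sup>2"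
          using less[of d] that by simp
        ultimately show ?thesis by (rule order_trans[rotated])
      qed
      then have "(\<Sum>d\<in>?D. norm (rough_transform f z d)) \<le> real (card ?D) * 2 ^ (?k - 1)\<^sup>2"
        using sum_bounded_above[of ?D "\<lambda>d. norm (rough_transform f z d)"] by auto
      then have "norm (rough_transform f z r) \<le> 1 * 2 ^ (?k - 1)\<^sup>2 + real (card ?D) * 2 ^ (?k - 1)\<^sup>2"
        using * two_realpow_ge_one[of "(?k-1)\<^sup>2"] by linarith
      also have "\<dots> = (real (card ?D + 1)) * 2 ^ (?k - 1)\<^sup>2" by (simp add: algebra_simps)
      also have "\<dots> \<le> real (2 ^ ?k) * 2 ^ (?k - 1)\<^sup>2"
        using cD by (intro mult_right_mono) (simp_all only: of_nat_le_iff, simp)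
      also have "\<dots> = 2 ^ (?k + (?k - 1)\<^sup>2)" by (simp add: power_add)
      also have "\<dots> \<le> 2 ^ ?k\<^sup>2" using sq by (intro power_increasing) auto
      finally show ?thesis .
    qed
  qed (simp add: rough_transform_eq_0)
qed

section \<open>Second moments and sums over rough divisors\<close>

text \<open>Turan's variance argument. The number \<open>om m\<close> of primes of \<open>Q\<close>
  dividing \<open>m\<close> has mean and variance about \<open>S\<close>, while an \<open>m\<close>
  free of such primes deviates by \<open>S\<close>. Hence these \<open>m\<close> weigh at most about
  \<open>x * S / S\<^sup>2\<close>.\<close>

lemma second_moment_bound:
  fixes a :: "nat \<Rightarrow> real" and M Q :: "nat set" and x \<delta> :: real
  defines "A \<equiv> \<lambda>r. \<Sum>m\<in>{m\<in>M. r dvd m}. a m"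
    and "S \<equiv> \<Sum>q\<in>Q. 1 / real q"
  assumes fin: "finite M" "finite Q" and Q: "\<And>q. q \<in> Q \<Longrightarrow> prime q"
    and a: "\<And>m. m \<in> M \<Longrightarrow> a m \<ge> 0" and S: "S \<ge> 1" and x: "x \<ge> 0" "\<delta> \<ge> 0"
    and e1: "\<bar>A 1 - x\<bar> \<le> \<delta> * x"
    and e2: "(\<Sum>q\<in>Q. \<bar>A q - x / q\<bar>) \<le> \<delta> * x"
    and e3: "(\<Sum>q\<in>Q. \<Sum>s\<in>Q-{q}. \<bar>A (q * s) - x / (q * s)\<bar>) \<le> 2 * \<delta> * x"
  shows "(\<Sum>m\<in>{m\<in>M. \<forall>q\<in>Q. \<not> q dvd m}. a m) \<le> x / S + 6 * \<delta> * x"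
proof -
  define om where "om m = (\<Sum>q\<in>Q. of_bool (q dvd m) :: real)" for m
  define T where "T = (\<Sum>m\<in>{m\<in>M. \<forall>q\<in>Q. \<not> q dvd m}. a m)"
  have A_eq: "A r = (\<Sum>m\<in>M. a m * of_bool (r dvd m))" for r
    unfolding A_def using fin by (intro sum.mono_neutral_cong_left) auto
  have m1: "(\<Sum>m\<in>M. a m * om m) = (\<Sum>q\<in>Q. A q)"
    unfolding om_def A_eq sum_distrib_left by (rule sum.swap)
  have prod: "of_bool (q dvd m) * of_bool (s dvd m) = (of_bool (q * s dvd m) :: real)"
    if "q \<in> Q" "s \<in> Q - {q}" for q s m
  proof -
    have "coprime q s" using that Q by (auto intro: primes_coprime)
    then have "q * s dvd m \<longleftrightarrow> q dvd m \<and> s dvd m"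
      by (meson divides_mult dvd_mult_left dvd_mult_right)
    then show ?thesis by auto
  qed
  have "(\<Sum>m\<in>M. a m * (om m)\<^sup>2) =
      (\<Sum>m\<in>M. \<Sum>q\<in>Q. \<Sum>s\<in>Q. a m * (of_bool (q dvd m) * of_bool (s dvd m)))"
    by (simp only: om_def power2_eq_square sum_product) (simp only: sum_distrib_left)
  also have "\<dots> = (\<Sum>q\<in>Q. \<Sum>s\<in>Q. \<Sum>m\<in>M. a m * (of_bool (q dvd m) * of_bool (s dvd m)))"
    by (subst sum.swap, rule sum.cong[OF refl], subst sum.swap, rule refl)
  also have "\<dots> = (\<Sum>q\<in>Q. A q + (\<Sum>s\<in>Q-{q}. A (q * s)))"
  proof (rule sum.cong[OF refl])
    fix q assume q: "q \<in> Q"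
    have "(\<Sum>s\<in>Q. \<Sum>m\<in>M. a m * (of_bool (q dvd m) * of_bool (s dvd m))) =
      (\<Sum>m\<in>M. a m * (of_bool (q dvd m) * of_bool (q dvd m))) +
      (\<Sum>s\<in>Q-{q}. \<Sum>m\<in>M. a m * (of_bool (q dvd m) * of_bool (s dvd m)))"
      using fin q by (simp add: sum.remove)
    also have "(\<Sum>s\<in>Q-{q}. \<Sum>m\<in>M. a m * (of_bool (q dvd m) * of_bool (s dvd m))) =
      (\<Sum>s\<in>Q-{q}. A (q * s))"
      unfolding A_eq by (intro sum.cong refl) (simp only: prod[OF q])
    also have "(\<Sum>m\<in>M. a m * (of_bool (q dvd m) * of_bool (q dvd m))) = A q"
      unfolding A_eq by (intro sum.cong refl) simp
    finally show "(\<Sum>s\<in>Q. \<Sum>m\<in>M. a m * (of_bool (q dvd m) * of_bool (s dvd m))) =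
      A q + (\<Sum>s\<in>Q-{q}. A (q * s))" .
  qed
  finally have m2: "(\<Sum>m\<in>M. a m * (om m)\<^sup>2) = (\<Sum>q\<in>Q. A q) + (\<Sum>q\<in>Q. \<Sum>s\<in>Q-{q}. A (q * s))"
    by (simp add: sum.distrib)
  have xS: "(\<Sum>q\<in>Q. x / q) = x * S" unfolding S_def sum_distrib_left by simp
  have "\<bar>(\<Sum>q\<in>Q. A q) - x * S\<bar> \<le> \<delta> * x"
    using order_trans[OF sum_abs e2] by (simp add: sum_subtractf xS)
  note b1 = this
  have b2: "(\<Sum>q\<in>Q. \<Sum>s\<in>Q-{q}. A (q * s)) \<le> x * S\<^sup>2 + 2 * \<delta> * x"
  proof -
    have "(\<Sum>q\<in>Q. \<Sum>s\<in>Q-{q}. A (q * s)) \<le>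
        (\<Sum>q\<in>Q. \<Sum>s\<in>Q-{q}. x / (q * s) + \<bar>A (q * s) - x / (q * s)\<bar>)"
      by (intro sum_mono) linarith
    also have "\<dots> = (\<Sum>q\<in>Q. \<Sum>s\<in>Q-{q}. x / (q * s)) +
        (\<Sum>q\<in>Q. \<Sum>s\<in>Q-{q}. \<bar>A (q * s) - x / (q * s)\<bar>)"
      by (simp add: sum.distrib)
    \<comment> \<open>Restoring the diagonal \<open>s = q\<close> only enlarges the sum and turns it
      into a square.\<close>
    also have "(\<Sum>q\<in>Q. \<Sum>s\<in>Q-{q}. x / (q * s)) \<le> (\<Sum>q\<in>Q. \<Sum>s\<in>Q. x / (q * s))"
      using fin x by (intro sum_mono sum_mono2) auto
    also have "\<dots> = x * S\<^sup>2"
      by (simp only: S_def power2_eq_square sum_product) (simp add: sum_distrib_left)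
    finally show ?thesis using e3 by linarith
  qed
  have "S\<^sup>2 * T = (\<Sum>m\<in>{m\<in>M. \<forall>q\<in>Q. \<not> q dvd m}. a m * (om m - S)\<^sup>2)"
    unfolding T_def sum_distrib_left by (intro sum.cong) (auto simp: om_def)
  also have "\<dots> \<le> (\<Sum>m\<in>M. a m * (om m - S)\<^sup>2)"
    using fin a by (intro sum_mono2) auto
  also have "\<dots> = (\<Sum>m\<in>M. a m * (om m)\<^sup>2) - 2 * S * (\<Sum>m\<in>M. a m * om m) + S\<^sup>2 * (\<Sum>m\<in>M. a m)"
    unfolding sum_distrib_left sum_subtractf[symmetric] sum.distrib[symmetric]
    by (intro sum.cong) (auto simp: power2_eq_square algebra_simps)
  finally have 1: "S\<^sup>2 * T \<le> (\<Sum>m\<in>M. a m * (om m)\<^sup>2) - 2 * S * (\<Sum>m\<in>M. a m * om m) + S\<^sup>2 * A 1"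
    by (simp add: A_def)
  have 2: "(\<Sum>m\<in>M. a m * (om m)\<^sup>2) \<le> x * S + \<delta> * x + x * S\<^sup>2 + 2 * \<delta> * x"
    using b1 b2 m2 by linarith
  have 3: "2 * S * (x * S - \<delta> * x) \<le> 2 * S * (\<Sum>m\<in>M. a m * om m)"
    unfolding m1 using b1 S by (intro mult_left_mono) linarith+
  have 4: "S\<^sup>2 * A 1 \<le> S\<^sup>2 * (x + \<delta> * x)"
    using e1 by (intro mult_left_mono) (linarith, simp)
  have *: "S\<^sup>2 * T \<le> x * S + \<delta> * x * (3 + 2 * S + S\<^sup>2)"
    using 1 2 3 4 by (simp add: algebra_simps power2_eq_square)
  \<comment> \<open>As \<open>S \<ge> 1\<close>, the error factor
    \<open>3 + 2 * S + S\<^sup>2\<close> is at most \<open>6 * S\<^sup>2\<close>; this is the 6 of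
    the conclusion.\<close>
  have "S \<le> S\<^sup>2" using S by (simp add: power2_eq_square)
  moreover have "1 \<le> S\<^sup>2" using S by simp
  ultimately have "\<delta> * x * (3 + 2 * S + S\<^sup>2) \<le> \<delta> * x * (6 * S\<^sup>2)"
    using x by (intro mult_left_mono) auto
  with * have "S\<^sup>2 * T \<le> S\<^sup>2 * (x / S + 6 * \<delta> * x)"
    using S by (simp add: algebra_simps power2_eq_square)
  then show ?thesis unfolding T_def using S by (subst (asm) mult_le_cancel_left_pos) auto
qed

text \<open>By unique factorization \<open>r = q * s\<close> arises from at most one pair with
  \<open>q < s\<close>, hence from at most two ordered pairs.\<close>

lemma sum_distinct_pairs_le:
  fixes e :: "nat \<Rightarrow> real"
  assumes fin: "finite Q" "finite R" and Q: "\<And>q. q \<in> Q \<Longrightarrow> prime q"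
    and e: "\<And>r. e r \<ge> 0" and sub: "\<And>q s. q \<in> Q \<Longrightarrow> s \<in> Q \<Longrightarrow> q * s \<in> R"
  shows "(\<Sum>q\<in>Q. \<Sum>s\<in>Q-{q}. e (q * s)) \<le> 2 * (\<Sum>r\<in>R. e r)"
proof -
  define P where "P = {(q,s). q \<in> Q \<and> s \<in> Q \<and> q < s}"
  have finP: "finite P" using fin by (auto simp: P_def intro: finite_subset[of _ "Q \<times> Q"])
  have inj: "inj_on (\<lambda>(q,s). q * s) P"
  proof (rule inj_onI, clarify)
    fix q s q' s' assume P: "(q, s) \<in> P" "(q', s') \<in> P" and eq: "q * s = q' * s'"
    have pr: "prime q" "prime s" "prime q'" "prime s'" "q < s" "q' < s'" using P Q by (auto simp: P_def)
    have "q dvd q' * s'" using eq by (metis dvd_triv_left)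
    then have "q = q' \<or> q = s'" using pr by (metis prime_dvd_mult_nat primes_dvd_imp_eq)
    moreover have "s dvd q' * s'" using eq by (metis dvd_triv_right)
    then have "s = q' \<or> s = s'" using pr by (metis prime_dvd_mult_nat primes_dvd_imp_eq)
    ultimately show "q = q' \<and> s = s'" using pr eq by auto
  qed
  have half: "(\<Sum>(q,s)\<in>P. e (q * s)) \<le> (\<Sum>r\<in>R. e r)"
  proof -
    have "(\<Sum>(q,s)\<in>P. e (q * s)) = (\<Sum>r\<in>(\<lambda>(q,s). q * s) ` P. e r)"
      by (subst sum.reindex[OF inj]) (auto intro!: sum.cong)
    also have "\<dots> \<le> (\<Sum>r\<in>R. e r)"
      using fin e sub by (intro sum_mono2) (auto simp: P_def)
    finally show ?thesis .
  qed
  have "(\<Sum>q\<in>Q. \<Sum>s\<in>Q-{q}. e (q * s)) = (\<Sum>(q,s)\<in>Sigma Q (\<lambda>q. Q - {q}). e (q * s))"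
    using fin by (subst sum.Sigma) auto
  also have "Sigma Q (\<lambda>q. Q - {q}) = P \<union> prod.swap ` P"
  proof -
    have "(q, s) \<in> prod.swap ` P \<longleftrightarrow> (s, q) \<in> P" for q s by force
    then show ?thesis by (auto simp: P_def)
  qed
  also have "(\<Sum>(q,s)\<in>P \<union> prod.swap ` P. e (q * s)) =
      (\<Sum>(q,s)\<in>P. e (q * s)) + (\<Sum>(q,s)\<in>prod.swap ` P. e (q * s))"
    using finP by (intro sum.union_disjoint) (auto simp: P_def)
  also have "(\<Sum>(q,s)\<in>prod.swap ` P. e (q * s)) = (\<Sum>(q,s)\<in>P. e (q * s))"
    by (subst sum.reindex) (auto simp: mult.commute intro!: sum.cong)
  finally show ?thesis using half by linarith
qed

text \<open>A \<open>z\<close>-rough divisor \<open>r \<ge> D\<close> of \<open>m \<le> w D\<close> leaves a cofactor at most \<open>w\<close>, so \<open>m\<close> has no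
  prime factor in \<open>(w, z]\<close>; few \<open>m\<close> have this property.  The remaining divisors are small
  enough for the level of distribution.\<close>

lemma rough_sum_estimate:
  fixes a :: "nat \<Rightarrow> real" and f :: "nat \<Rightarrow> complex" and x \<delta> w z D :: real and p k :: nat and M :: "nat set"
  defines "Q \<equiv> {q. prime q \<and> w < real q \<and> real q \<le> z}"
  defines "A \<equiv> \<lambda>r. \<Sum>m\<in>{m\<in>M. r dvd m}. a m"
    and "S \<equiv> \<Sum>q\<in>Q. 1 / real q"
    and "R \<equiv> {r. real r < D \<and> rough w r \<and> \<not> p dvd r}"
  assumes f: "\<And>m n. f (m * n) = f m * f n" "f 1 = 1" "\<And>n. norm (f n) \<le> 1"
    and one: "\<And>q. prime q \<Longrightarrow> real q \<le> z \<Longrightarrow> f q = 1"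
    and fin: "finite M" and p: "prime p" "z < real p" and z: "1 < z" "w \<le> z" "z * z < D" "D \<le> z ^ k"
    and M: "\<And>m. m \<in> M \<Longrightarrow> m > 0 \<and> \<not> p dvd m \<and> real m \<le> z ^ k \<and> real m < w * D"
    and a: "\<And>m. m \<in> M \<Longrightarrow> a m \<ge> 0" and S: "S \<ge> 1" and x: "x \<ge> 0" "\<delta> \<ge> 0"
    and e: "(\<Sum>r\<in>R. \<bar>A r - x / r\<bar>) \<le> \<delta> * x"
  shows "norm ((\<Sum>m\<in>M. of_real (a m) * f m) -
           of_real x * (\<Sum>r\<in>{r\<in>R. rough z r}. rough_transform f z r / of_nat r))
         \<le> 2 ^ (k\<^sup>2 + k) * (1 / S + 7 * \<delta>) * x"
proof -
  define g where "g = rough_transform f z"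
  define R' where "R' = {r\<in>R. rough z r}"
  have D: "D > 1" using z by (smt (verit) mult_le_cancel_left1)
  have finQ: "finite Q" unfolding Q_def
    by (rule finite_subset[of _ "{..nat \<lfloor>z\<rfloor>}"]) (auto simp: le_nat_floor)
  have finR: "finite R" unfolding R_def
    by (rule finite_subset[of _ "{..nat \<lfloor>D\<rfloor>}"]) (auto simp: le_nat_floor)
  have finR': "finite R'" unfolding R'_def using finR by simp
  \<comment> \<open>Admitting 1 as a factor covers at once the moduli 1, \<open>q\<close> and
    \<open>q * s\<close> that the second moment needs; \<open>z * z < D\<close> keeps them below the
    level.\<close>
  have QR: "q * s \<in> R" if "q \<in> Q \<union> {1}" "s \<in> Q \<union> {1}" for q s
  proof -
    have "real q \<le> z" "real s \<le> z" using that z by (auto simp: Q_def)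
    then have "real q * real s \<le> z * z" using z by (intro mult_mono) auto
    then have 1: "real (q * s) < D" using z by simp
    have qs: "r = q \<or> r = s" if "prime r" "r dvd q * s" for r
      using that \<open>q \<in> Q \<union> {1}\<close> \<open>s \<in> Q \<union> {1}\<close> unfolding Q_def
      by (metis (no_types, lifting) UnE mem_Collect_eq prime_dvd_mult_nat primes_dvd_imp_eq
          singletonD nat_dvd_1_iff_1 not_prime_1)
    have "rough w (q * s)" unfolding rough_def
    proof (intro conjI allI impI)
      show "q * s > 0" using that by (auto simp: Q_def prime_gt_0_nat)
      fix r assume r: "prime r \<and> r dvd q * s"
      then have "r = q \<or> r = s" using qs by blast
      then show "w < real r" using that r by (auto simp: Q_def)
    qed
    moreover have "\<not> p dvd q * s"
      using qs[OF p(1)] \<open>real q \<le> z\<close> \<open>real s \<le> z\<close> p(2) by auto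
    ultimately show ?thesis using 1 by (simp add: R_def)
  qed
  have T: "(\<Sum>m\<in>{m\<in>M. \<forall>q\<in>Q. \<not> q dvd m}. a m) \<le> x / S + 6 * \<delta> * x"
    unfolding S_def
  proof (rule second_moment_bound)
    have "1 \<in> R" using QR[of 1 1] by simp
    then have "\<bar>A 1 - x / real 1\<bar> \<le> (\<Sum>r\<in>R. \<bar>A r - x / r\<bar>)"
      by (intro member_le_sum finR) auto
    then show "\<bar>(\<Sum>m\<in>{m\<in>M. 1 dvd m}. a m) - x\<bar> \<le> \<delta> * x" using e by (simp add: A_def)
    have "(\<Sum>q\<in>Q. \<bar>A q - x / q\<bar>) \<le> (\<Sum>r\<in>R. \<bar>A r - x / r\<bar>)"
      using QR[of _ 1] finR by (intro sum_mono2) auto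
    then show "(\<Sum>q\<in>Q. \<bar>(\<Sum>m\<in>{m\<in>M. q dvd m}. a m) - x / q\<bar>) \<le> \<delta> * x"
      using e by (simp add: A_def)
    have "(\<Sum>q\<in>Q. \<Sum>s\<in>Q-{q}. \<bar>A (q * s) - x / real (q * s)\<bar>) \<le> 2 * (\<Sum>r\<in>R. \<bar>A r - x / r\<bar>)"
      by (rule sum_distinct_pairs_le[where e = "\<lambda>r. \<bar>A r - x / real r\<bar>"])
        (use finQ finR QR in \<open>auto simp: Q_def\<close>)
    then show "(\<Sum>q\<in>Q. \<Sum>s\<in>Q-{q}. \<bar>(\<Sum>m\<in>{m\<in>M. q * s dvd m}. a m) - x / (q * s)\<bar>) \<le> 2 * \<delta> * x"
      using e by (simp add: A_def)
  qed (use finQ fin a S x in \<open>auto simp: Q_def S_def\<close>)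
  have g_le: "norm (g r) \<le> 2 ^ k\<^sup>2" if "rough z r" "real r \<le> z ^ k" for r
  proof -
    have "bigomega r \<le> k" using rough_bigomega_le[OF that(1) z(1) that(2)] .
    then have "(2::real) ^ (bigomega r)\<^sup>2 \<le> 2 ^ k\<^sup>2" by (intro power_increasing power_mono) auto
    with norm_rough_transform_le[where f = f and z = z and r = r, OF f(3)]
    show ?thesis unfolding g_def by linarith
  qed
  have g0: "g r = 0" if "\<not> rough z r" for r
    unfolding g_def using that by (rule rough_transform_eq_0)
  \<comment> \<open>A \<open>z\<close>-rough divisor of \<open>m\<close> below \<open>D\<close> lies
    in \<open>R'\<close>: it is \<open>w\<close>-rough because \<open>w \<le> z\<close>, and prime
    to \<open>p\<close> because \<open>m\<close> is.\<close>
  have small: "(\<Sum>d\<in>{d. d dvd m \<and> real d < D}. g d) = (\<Sum>r\<in>R'. g r * of_bool (r dvd m))"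
    if "m \<in> M" for m
    using M[OF that] finR' g0 rough_mono[OF _ z(2)]
    by (intro sum.mono_neutral_cong) (auto simp: R'_def R_def dest: dvd_trans)
  have main: "(\<Sum>m\<in>M. of_real (a m) * (\<Sum>d\<in>{d. d dvd m \<and> real d < D}. g d)) =
      (\<Sum>r\<in>R'. g r * of_real (A r))"
  proof -
    have "(\<Sum>m\<in>M. of_real (a m) * (\<Sum>d\<in>{d. d dvd m \<and> real d < D}. g d)) =
        (\<Sum>m\<in>M. \<Sum>r\<in>R'. g r * (of_real (a m) * of_bool (r dvd m)))"
      by (intro sum.cong refl) (simp add: small sum_distrib_left mult_ac)
    also have "\<dots> = (\<Sum>r\<in>R'. g r * (\<Sum>m\<in>M. of_real (a m) * of_bool (r dvd m)))"
      by (subst sum.swap) (simp add: sum_distrib_left)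
    also have "\<dots> = (\<Sum>r\<in>R'. g r * of_real (A r))"
      unfolding A_def of_real_sum using fin
      by (intro sum.cong refl arg_cong2[where f = "(*)"] sum.mono_neutral_cong_right) auto
    finally show ?thesis .
  qed
  have split: "f m = (\<Sum>d\<in>{d. d dvd m \<and> real d < D}. g d) + (\<Sum>d\<in>{d. d dvd m \<and> real d \<ge> D}. g d)"
    if "m \<in> M" for m
  proof -
    have "m > 0" using M[OF that] by simp
    have "f m = (\<Sum>d | d dvd m. g d)"
      unfolding g_def by (rule sum_rough_transform[symmetric]) (use f one \<open>m > 0\<close> in auto)
    also have "{d. d dvd m} = {d. d dvd m \<and> real d < D} \<union> {d. d dvd m \<and> real d \<ge> D}" by auto
    also have "(\<Sum>d\<in>\<dots>. g d) = (\<Sum>d\<in>{d. d dvd m \<and> real d < D}. g d) + (\<Sum>d\<in>{d. d dvd m \<and> real d \<ge> D}. g d)"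
      using \<open>m > 0\<close> by (intro sum.union_disjoint) auto
    finally show ?thesis .
  qed
  have tail: "norm (\<Sum>d\<in>{d. d dvd m \<and> real d \<ge> D}. g d) \<le>
      (if \<forall>q\<in>Q. \<not> q dvd m then 2 ^ (k\<^sup>2 + k) else 0)" if "m \<in> M" for m
  proof -
    have m: "m > 0" "real m \<le> z ^ k" "real m < w * D" using M[OF that] by auto
    have eq: "(\<Sum>d\<in>{d. d dvd m \<and> real d \<ge> D}. g d) = (\<Sum>d\<in>{d. d dvd m \<and> rough z d \<and> real d \<ge> D}. g d)"
      using m g0 by (intro sum.mono_neutral_right) auto
    show ?thesis
    proof (cases "\<forall>q\<in>Q. \<not> q dvd m")
      case True
      have "norm (\<Sum>d\<in>{d. d dvd m \<and> rough z d \<and> real d \<ge> D}. g d) \<le>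
          (\<Sum>d\<in>{d. d dvd m \<and> rough z d \<and> real d \<ge> D}. 2 ^ k\<^sup>2)"
      proof (rule sum_norm_le)
        fix d assume "d \<in> {d. d dvd m \<and> rough z d \<and> real d \<ge> D}"
        moreover then have "real d \<le> real m" using m by (simp add: dvd_imp_le)
        ultimately show "norm (g d) \<le> 2 ^ k\<^sup>2" using m by (intro g_le) auto
      qed
      also have "\<dots> = real (card {d. d dvd m \<and> rough z d \<and> real d \<ge> D}) * 2 ^ k\<^sup>2" by simp
      also have "real (card {d. d dvd m \<and> rough z d \<and> real d \<ge> D}) \<le> real (card {d. d dvd m \<and> rough z d})"
        using m by (intro of_nat_mono card_mono) auto
      also have "\<dots> \<le> real (2 ^ k)"
        using card_rough_divisors_le[OF m(1) z(1) m(2)] by (intro of_nat_mono)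
      finally show ?thesis unfolding eq using True by (simp add: power_add mult_ac)
    next
      case False
      then obtain q where q: "q \<in> Q" "q dvd m" by auto
      have "{d. d dvd m \<and> rough z d \<and> real d \<ge> D} = {}"
      proof (rule equals0I)
        fix d assume "d \<in> {d. d dvd m \<and> rough z d \<and> real d \<ge> D}"
        then have d: "d dvd m" "rough z d" "real d \<ge> D" by auto
        then obtain c where c: "m = d * c" by auto
        have "c > 0" using c m by auto
        have pq: "prime q" "w < real q" "real q \<le> z" using q by (auto simp: Q_def)
        have "\<not> q dvd d" using d(2) pq unfolding rough_def by (meson not_less)
        then have "q dvd c" using q(2) c pq(1) by (simp add: prime_dvd_mult_iff)
        then have "w < real c" using pq(2) \<open>c > 0\<close> by (meson dvd_imp_le less_le_trans of_nat_le_iff)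
        then have "w * D \<le> real c * real d" using d(3) D by (intro mult_mono) auto
        then show False using m c by (simp add: mult_ac)
      qed
      then show ?thesis unfolding eq using False by (simp only: sum.empty) simp
    qed
  qed
  have "norm ((\<Sum>m\<in>M. of_real (a m) * f m) - of_real x * (\<Sum>r\<in>R'. g r / of_nat r)) =
      norm ((\<Sum>r\<in>R'. g r * of_real (A r - x / r)) +
        (\<Sum>m\<in>M. of_real (a m) * (\<Sum>d\<in>{d. d dvd m \<and> real d \<ge> D}. g d)))" (is "_ = norm (?U + ?V)")
  proof -
    have "(\<Sum>m\<in>M. of_real (a m) * f m) = (\<Sum>m\<in>M. of_real (a m) * (\<Sum>d\<in>{d. d dvd m \<and> real d < D}. g d)) +
        (\<Sum>m\<in>M. of_real (a m) * (\<Sum>d\<in>{d. d dvd m \<and> real d \<ge> D}. g d))"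
      unfolding sum.distrib[symmetric] by (intro sum.cong refl) (simp add: split distrib_left)
    then show ?thesis unfolding main
      by (simp add: algebra_simps sum_subtractf sum_distrib_left)
  qed
  also have "\<dots> \<le> norm ?U + norm ?V" by (rule norm_triangle_ineq)
  \<comment> \<open>The moduli below \<open>D\<close> cost one \<open>\<delta>\<close>; together
    with \<open>6 * \<delta>\<close> from the second moment this makes
    \<open>7 * \<delta>\<close>.\<close>
  also have "norm ?U \<le> (\<Sum>r\<in>R'. 2 ^ k\<^sup>2 * \<bar>A r - x / r\<bar>)"
  proof (rule sum_norm_le)
    fix r assume "r \<in> R'"
    then have "rough z r" "real r \<le> z ^ k" using z by (auto simp: R'_def R_def)
    from g_le[OF this] show "norm (g r * of_real (A r - x / r)) \<le> 2 ^ k\<^sup>2 * \<bar>A r - x / r\<bar>"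
      unfolding norm_mult norm_of_real by (intro mult_right_mono) auto
  qed
  also have "\<dots> = 2 ^ k\<^sup>2 * (\<Sum>r\<in>R'. \<bar>A r - x / r\<bar>)" by (simp add: sum_distrib_left)
  also have "\<dots> \<le> 2 ^ k\<^sup>2 * (\<Sum>r\<in>R. \<bar>A r - x / r\<bar>)"
    using finR by (intro mult_left_mono sum_mono2) (auto simp: R'_def)
  also have "\<dots> \<le> 2 ^ k\<^sup>2 * (\<delta> * x)" using e by (intro mult_left_mono) auto
  also have "\<dots> \<le> 2 ^ (k\<^sup>2 + k) * (\<delta> * x)"
    using x by (intro mult_right_mono power_increasing) auto
  also have "norm ?V \<le> (\<Sum>m\<in>M. a m * (if \<forall>q\<in>Q. \<not> q dvd m then 2 ^ (k\<^sup>2 + k) else 0))"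
    by (rule sum_norm_le) (auto simp only: norm_mult norm_of_real intro!: mult_mono tail, use a in auto)
  also have "\<dots> = (\<Sum>m\<in>{m\<in>M. \<forall>q\<in>Q. \<not> q dvd m}. a m * 2 ^ (k\<^sup>2 + k))"
    using fin by (intro sum.mono_neutral_cong_right) auto
  also have "\<dots> = 2 ^ (k\<^sup>2 + k) * (\<Sum>m\<in>{m\<in>M. \<forall>q\<in>Q. \<not> q dvd m}. a m)"
    by (simp add: sum_distrib_left mult_ac)
  also have "\<dots> \<le> 2 ^ (k\<^sup>2 + k) * (x / S + 6 * \<delta> * x)"
    using T by (intro mult_left_mono) auto
  finally show ?thesis unfolding R'_def g_def by (simp add: algebra_simps)
qed

section \<open>Consequences of the conjecture: arbitrary classes, Chebyshev and Mertens
  bounds\<close>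

lemma psi_ap_cong: "[a = b] (mod r) \<Longrightarrow> psi_ap x r a = psi_ap x r b"
  unfolding psi_ap_def using cong_trans cong_sym by (intro sum.cong) blast+

text \<open>The supremum is traded for a freely chosen class \<open>b r\<close> per modulus. The
  saving with exponent 2 already gives the \<open>o(x)\<close> that the argument needs.\<close>

lemma elliott_halberstam_error:
  assumes EH: elliott_halberstam and "0 < \<theta>" "\<theta> < 1" "\<delta> > 0"
  obtains x0 where "x0 \<ge> 2"
    "\<And>x R b. x \<ge> x0 \<Longrightarrow> R \<subseteq> {r. 0 < r \<and> real r < x powr \<theta>} \<Longrightarrow> (\<And>r. r \<in> R \<Longrightarrow> coprime (b r) r) \<Longrightarrow>
       (\<Sum>r\<in>R. \<bar>psi_ap x r (b r) - x / real (totient r)\<bar>) \<le> \<delta> * x"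
proof -
  obtain C where C: "\<And>x. x \<ge> 2 \<Longrightarrow>
      (\<Sum>r\<in>{r :: nat. 0 < r \<and> real r < x powr \<theta>}.
          Max {\<bar>psi_ap x r a - x / real (totient r)\<bar> | a. a < r \<and> coprime a r})
        \<le> C * x * ln x powr (- 2)"
    using EH[unfolded elliott_halberstam_def, rule_format, of \<theta> 2] assms by auto
  have "((\<lambda>x::real. \<bar>C\<bar> * ln x powr (-2)) \<longlongrightarrow> 0) at_top" by real_asymp
  then have "\<forall>\<^sub>F x::real in at_top. \<bar>C\<bar> * ln x powr (-2) < \<delta>"
    using assms by (intro order_tendstoD) auto
  then obtain x1 where x1: "\<And>x. x \<ge> x1 \<Longrightarrow> \<bar>C\<bar> * ln x powr (-2) < \<delta>"
    by (auto simp: eventually_at_top_linorder)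
  show ?thesis
  proof (rule that[of "max 2 x1"])
    fix x :: real and R and b :: "nat \<Rightarrow> nat"
    assume x: "x \<ge> max 2 x1" and R: "R \<subseteq> {r. 0 < r \<and> real r < x powr \<theta>}"
      and b: "\<And>r. r \<in> R \<Longrightarrow> coprime (b r) r"
    let ?S = "\<lambda>r. {\<bar>psi_ap x r a - x / real (totient r)\<bar> | a. a < r \<and> coprime a r}"
    have fin: "finite {r :: nat. 0 < r \<and> real r < x powr \<theta>}"
      by (rule finite_subset[of _ "{..nat \<lfloor>x powr \<theta>\<rfloor>}"]) (auto simp: le_nat_floor)
    have mem: "\<bar>psi_ap x r a - x / real (totient r)\<bar> \<le> Max (?S r)" if "r > 0" "coprime a r" for r a
    proof (rule Max_ge)
      show "finite (?S r)" by simp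
      have "psi_ap x r a = psi_ap x r (a mod r)" by (rule psi_ap_cong) (simp add: cong_def)
      then show "\<bar>psi_ap x r a - x / real (totient r)\<bar> \<in> ?S r"
        using that by (auto intro!: exI[of _ "a mod r"])
    qed
    have nonneg: "Max (?S r) \<ge> 0" if "r > 0" for r
      using mem[OF that, of 1] by (simp add: order_trans[OF abs_ge_zero])
    have "(\<Sum>r\<in>R. \<bar>psi_ap x r (b r) - x / real (totient r)\<bar>) \<le> (\<Sum>r\<in>R. Max (?S r))"
      using R b by (intro sum_mono mem) auto
    also have "\<dots> \<le> (\<Sum>r\<in>{r :: nat. 0 < r \<and> real r < x powr \<theta>}. Max (?S r))"
      using R fin nonneg by (intro sum_mono2) auto
    also have "\<dots> \<le> C * x * ln x powr (-2)" using C[of x] x by simp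
    also have "\<dots> \<le> \<bar>C\<bar> * x * ln x powr (-2)" using x by (intro mult_right_mono) auto
    also have "\<dots> = (\<bar>C\<bar> * ln x powr (-2)) * x" by simp
    also have "\<dots> \<le> \<delta> * x" using x1[of x] x by (intro mult_right_mono) auto
    finally show "(\<Sum>r\<in>R. \<bar>psi_ap x r (b r) - x / real (totient r)\<bar>) \<le> \<delta> * x" .
  qed simp
qed

lemma mangoldt_nonneg [simp]: "mangoldt n \<ge> (0 :: real)"
proof (cases "primepow n")
  case True
  then obtain q k where "prime q" "k > 0" "n = q ^ k" by (auto simp: primepow_def)
  then show ?thesis using prime_ge_1_nat[of q] by (simp add: of_real_def)
qed (simp add: mangoldt_def)

lemma psi_ap_1: "psi_ap (real N) 1 a = (\<Sum>n=1..N. mangoldt n)"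
  unfolding psi_ap_def by (intro sum.cong) auto

text \<open>The single modulus 1 in the conjecture compares \<open>psi_ap x 1 1\<close> with
  \<open>x\<close>; the finitely many small \<open>N\<close> go into \<open>K\<close>.\<close>

lemma chebyshev_bound:
  assumes elliott_halberstam
  obtains c :: real where "c \<ge> 1" "\<And>N. (\<Sum>n=1..N. mangoldt n) \<le> c * real N"
proof -
  obtain x0 :: real where x0: "x0 \<ge> 2" "\<And>x R b. x \<ge> x0 \<Longrightarrow> R \<subseteq> {r. 0 < r \<and> real r < x powr (1/2)} \<Longrightarrow>
       (\<And>r. r \<in> R \<Longrightarrow> coprime (b r) r) \<Longrightarrow>
       (\<Sum>r\<in>R. \<bar>psi_ap x r (b r) - x / real (totient r)\<bar>) \<le> 1 * x"
    using elliott_halberstam_error[OF assms, of "1/2" 1] by auto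
  define K where "K = (\<Sum>n=1..nat \<lceil>x0\<rceil>. mangoldt n :: real)"
  have K: "K \<ge> 0" unfolding K_def by (intro sum_nonneg) auto
  show ?thesis
  proof (rule that[of "2 + K"])
    fix N :: nat
    show "(\<Sum>n=1..N. mangoldt n) \<le> (2 + K) * real N"
    proof (cases "real N \<ge> x0")
      case True
      have "real 1 < real N powr (1/2)"
        using True x0(1) powr_less_mono2[of "1/2" 1 "real N"] by simp
      then have "\<bar>psi_ap (real N) 1 1 - real N\<bar> \<le> real N"
        using x0(2)[OF True, of "{1}" "\<lambda>_. 1"] by simp
      then show ?thesis using K unfolding psi_ap_1 by (simp add: algebra_simps) (smt (verit) mult_nonneg_nonneg of_nat_0_le_iff)
    next
      case False
      show ?thesis
      proof (cases "N = 0")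
        case False
        have "(\<Sum>n=1..N. mangoldt n) \<le> K"
          unfolding K_def using \<open>\<not> real N \<ge> x0\<close> by (intro sum_mono2) (auto, linarith)
        also have "K * 1 \<le> K * real N" using K False by (intro mult_left_mono) auto
        finally show ?thesis by (simp add: algebra_simps)
      qed simp
    qed
  qed (use K in auto)
qed

lemma ln_fact_ge: "N > 0 \<Longrightarrow> ln (fact N :: real) \<ge> real N * ln (real N) - real N"
proof (induction N)
  case (Suc N)
  show ?case
  proof (cases "N = 0")
    case False
    have "ln (1 + 1 / real N) \<le> 1 / real N" using False by (intro ln_add_one_self_le_self) auto
    moreover have "ln (1 + 1 / real N) = ln (1 + real N) - ln (real N)"
    proof -
      have "1 + 1 / real N = (1 + real N) / real N" using False by (simp add: field_simps)
      then show ?thesis using False by (simp add: ln_div)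
    qed
    ultimately have "ln (1 + real N) - ln (real N) \<le> 1 / real N" by linarith
    then have "real N * (ln (1 + real N) - ln (real N)) \<le> 1"
      using False by (simp add: pos_le_divide_eq mult.commute)
    moreover have "ln (fact (Suc N) :: real) = ln (1 + real N) + ln (fact N)"
      by (simp add: ln_mult)
    ultimately show ?thesis using Suc.IH False by (simp add: algebra_simps)
  qed simp
qed simp

lemma ln_fact_le: "ln (fact N :: real) \<le> real N * ln (real N)"
proof (cases "N = 0")
  case False
  have "ln (fact N :: real) \<le> ln (real N ^ N)"
    using fact_le_power[of N, where 'a = real] by (intro ln_mono) auto
  then show ?thesis using False by (simp add: ln_realpow)
qed simp

lemma card_multiples:
  assumes "d > 0"
  shows "card {n\<in>{1..N}. d dvd n} = N div d"
proof -
  have "{n\<in>{1..N}. d dvd n} = (\<lambda>k. d * k) ` {1..N div d}"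
  proof (intro equalityI subsetI)
    fix n assume "n \<in> {n\<in>{1..N}. d dvd n}"
    then obtain k where k: "n = d * k" "1 \<le> n" "n \<le> N" by auto
    then have "k \<le> N div d" using assms div_le_mono[OF k(3), of d] by simp
    then show "n \<in> (\<lambda>k. d * k) ` {1..N div d}" using k by (auto intro: Nat.gr0I)
  next
    fix n assume "n \<in> (\<lambda>k. d * k) ` {1..N div d}"
    then obtain k where k: "n = d * k" "1 \<le> k" "k \<le> N div d" by (metis atLeastAtMost_iff imageE)
    then have "d * k \<le> d * (N div d)" by simp
    then show "n \<in> {n\<in>{1..N}. d dvd n}" using k assms le_trans[OF _ times_div_less_eq_dividend[of d N]] by auto
  qed
  then show ?thesis using assms by (simp add: card_image inj_on_def)
qed

lemma ln_fact_eq_sum_mangoldt: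
  "ln (fact N :: real) = (\<Sum>d=1..N. mangoldt d * real (N div d))"
proof -
  have "ln (fact N :: real) = (\<Sum>n=1..N. ln (real n))"
    by (induction N) (simp_all add: ln_mult)
  also have "\<dots> = (\<Sum>n=1..N. \<Sum>d | d dvd n. mangoldt d)"
    by (intro sum.cong refl) (simp add: mangoldt_sum)
  also have "\<dots> = (\<Sum>n=1..N. \<Sum>d=1..N. mangoldt d * of_bool (d dvd n))"
  proof (rule sum.cong[OF refl])
    fix n assume n: "n \<in> {1..N}"
    then have "1 \<le> d \<and> d \<le> N" if "d dvd n" for d
      using dvd_imp_le[OF that] dvd_pos_nat[OF _ that] by simp
    then show "(\<Sum>d | d dvd n. mangoldt d :: real) = (\<Sum>d=1..N. mangoldt d * of_bool (d dvd n))"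
      by (intro sum.mono_neutral_cong_left) auto
  qed
  also have "\<dots> = (\<Sum>d=1..N. mangoldt d * (\<Sum>n=1..N. of_bool (d dvd n)))"
    unfolding sum_distrib_left by (rule sum.swap)
  also have "\<dots> = (\<Sum>d=1..N. mangoldt d * real (N div d))"
  proof (intro sum.cong refl arg_cong2[where f = "(*)"])
    fix d assume d: "d \<in> {1..N}"
    have "(\<Sum>n=1..N. of_bool (d dvd n)) = real (card {n\<in>{1..N}. d dvd n})"
      by (simp add: sum.If_cases of_bool_def Int_def)
    also have "card {n\<in>{1..N}. d dvd n} = N div d" using d by (intro card_multiples) auto
    finally show "(\<Sum>n=1..N. of_bool (d dvd n)) = real (N div d)" .
  qed
  finally show ?thesis .
qed

text \<open>Replacing \<open>N div d\<close> by \<open>N / d\<close> in Legendre's formula for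
  \<open>ln (fact N)\<close> costs at most the Chebyshev sum, which is \<open>O(N)\<close>; a weak
  Stirling formula and division by \<open>N\<close> give the claim.\<close>

lemma mertens_bound:
  assumes elliott_halberstam
  obtains C :: real where "C \<ge> 1" "\<And>N. N > 0 \<Longrightarrow> \<bar>(\<Sum>n=1..N. mangoldt n / real n) - ln (real N)\<bar> \<le> C"
proof -
  obtain c :: real where c: "c \<ge> 1" "\<And>N. (\<Sum>n=1..N. mangoldt n) \<le> c * real N"
    using chebyshev_bound[OF assms] by blast
  show ?thesis
  proof (rule that[of c])
    fix N :: nat assume N: "N > 0"
    let ?T = "\<Sum>n=1..N. mangoldt n / real n"
    have div_le: "real (N div d) \<le> real N / real d" for d
      by (metis of_nat_div_le_of_nat)
    have div_ge: "real N / real d - 1 \<le> real (N div d)" for d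
      using floor_divide_of_nat_eq[of N d, where 'a = real] by linarith
    have "ln (fact N :: real) \<le> (\<Sum>d=1..N. mangoldt d * (real N / real d))"
      unfolding ln_fact_eq_sum_mangoldt by (intro sum_mono mult_left_mono div_le) auto
    also have "\<dots> = real N * ?T" by (simp add: sum_distrib_left mult_ac)
    finally have "real N * (ln (real N) - 1) \<le> real N * ?T"
      using ln_fact_ge[OF N] by (simp add: algebra_simps)
    then have 1: "ln (real N) - 1 \<le> ?T" using N by simp
    have "real N * ?T - (\<Sum>d=1..N. mangoldt d) = (\<Sum>d=1..N. mangoldt d * (real N / real d - 1))"
      by (simp add: sum_distrib_left right_diff_distrib sum_subtractf mult_ac)
    also have "\<dots> \<le> ln (fact N :: real)"
      unfolding ln_fact_eq_sum_mangoldt by (intro sum_mono mult_left_mono div_ge) auto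
    finally have "real N * ?T \<le> real N * (ln (real N) + c)"
      using c(2)[of N] ln_fact_le[of N] by (simp add: algebra_simps)
    then have 2: "?T \<le> ln (real N) + c" using N by simp
    show "\<bar>?T - ln (real N)\<bar> \<le> c" using 1 2 c(1) by linarith
  qed (use c in auto)
qed

text \<open>The geometric series over exponents from 2 on leaves about \<open>ln q / q^2\<close> for
  each prime \<open>q\<close>, and \<open>ln q \<le> 2 * q powr (1/2)\<close> makes the sum over
  \<open>q\<close> converge.\<close>

lemma mangoldt_proper_powers_bound:
  obtains C :: real where "C \<ge> 0" "\<And>N. (\<Sum>n\<in>{n\<in>{1..N}. \<not> prime n}. mangoldt n / real n) \<le> C"
proof -
  have summ: "summable (\<lambda>n. real n powr (-(3/2)))" by (simp add: summable_real_powr_iff)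
  show ?thesis
  proof (rule that[of "4 * (\<Sum>n. real n powr (-(3/2)))"])
    show "4 * (\<Sum>n. real n powr (-(3/2))) \<ge> 0" using suminf_nonneg[OF summ] by simp
    fix N :: nat
    let ?P = "{q\<in>{2..N}. prime q} \<times> {2..N}"
    have sub: "{n\<in>{1..N}. \<not> prime n \<and> primepow n} \<subseteq> (\<lambda>(q,k). q ^ k) ` ?P"
    proof
      fix n assume "n \<in> {n\<in>{1..N}. \<not> prime n \<and> primepow n}"
      then obtain q k where n: "n = q ^ k" "prime q" "k > 0" "n \<le> N" "\<not> prime n"
        by (auto simp: primepow_def)
      have "k \<noteq> 1" using n by auto
      moreover have "k < q ^ k" using n prime_gt_1_nat by (intro power_gt_expt) auto
      moreover have "q ^ 1 \<le> q ^ k" using n prime_ge_1_nat[OF n(2)] by (intro power_increasing) auto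
      ultimately have "(q, k) \<in> ?P" using n prime_ge_2_nat[OF n(2)] by auto
      then show "n \<in> (\<lambda>(q,k). q ^ k) ` ?P" using n by force
    qed
    have "(\<Sum>n\<in>{n\<in>{1..N}. \<not> prime n}. mangoldt n / real n) =
        (\<Sum>n\<in>{n\<in>{1..N}. \<not> prime n \<and> primepow n}. mangoldt n / real n)"
      by (intro sum.mono_neutral_right) (auto simp: mangoldt_def)
    also have "\<dots> \<le> (\<Sum>n\<in>(\<lambda>(q,k). q ^ k) ` ?P. mangoldt n / real n)"
      using sub by (intro sum_mono2) auto
    also have "\<dots> \<le> (\<Sum>(q,k)\<in>?P. mangoldt (q ^ k) / real (q ^ k))"
      using sum_image_le[of ?P "\<lambda>n. mangoldt n / real n" "\<lambda>(q,k). q ^ k"]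
      by (auto simp: o_def case_prod_unfold)
    also have "\<dots> = (\<Sum>q\<in>{q\<in>{2..N}. prime q}. \<Sum>k\<in>{2..N}. ln (real q) * (1 / real q) ^ k)"
      by (subst sum.cartesian_product[symmetric]) (intro sum.cong refl, simp add: power_divide)
    also have "\<dots> \<le> (\<Sum>q\<in>{q\<in>{2..N}. prime q}. 4 * real q powr (-(3/2)))"
    proof (rule sum_mono)
      fix q assume "q \<in> {q\<in>{2..N}. prime q}"
      then have q: "real q \<ge> 2" by auto
      let ?t = "1 / real q"
      have t: "?t \<ge> 0" "?t \<le> 1/2" using q by (auto simp: field_simps)
      have "(\<Sum>k\<in>{2..N}. ?t ^ k) * (1 - ?t) \<le> ?t\<^sup>2"
      proof (cases "N \<ge> 2")
        case True
        have "(\<Sum>k\<in>{2..N}. ?t ^ k) * (1 - ?t) = ?t ^ 2 - ?t ^ Suc N"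
          using sum_gp_multiplied[OF True, of ?t] by (simp add: mult.commute)
        then show ?thesis using t by simp
      qed (simp add: q)
      moreover have "(\<Sum>k\<in>{2..N}. ?t ^ k) * (1/2) \<le> (\<Sum>k\<in>{2..N}. ?t ^ k) * (1 - ?t)"
        using t by (intro mult_left_mono sum_nonneg) auto
      ultimately have "(\<Sum>k\<in>{2..N}. ?t ^ k) \<le> 2 * ?t\<^sup>2" by linarith
      then have "ln (real q) * (\<Sum>k\<in>{2..N}. ?t ^ k) \<le> (2 * real q powr (1/2)) * (2 * ?t\<^sup>2)"
        using q ln_powr_bound[of "real q" "1/2"] t
        by (intro mult_mono sum_nonneg) auto
      also have "?t\<^sup>2 = real q powr (-2)"
        using q by (simp add: powr_minus powr_realpow power_divide field_simps flip: powr_numeral)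
      also have "2 * real q powr (1/2) * (2 * real q powr (-2)) = 4 * (real q powr (1/2) * real q powr (-2))"
        by simp
      also have "\<dots> = 4 * real q powr (-(3/2))" by (subst powr_add[symmetric]) simp
      finally show "(\<Sum>k\<in>{2..N}. ln (real q) * ?t ^ k) \<le> 4 * real q powr (-(3/2))"
        by (simp add: sum_distrib_left)
    qed
    also have "\<dots> = 4 * (\<Sum>q\<in>{q\<in>{2..N}. prime q}. real q powr (-(3/2)))"
      by (simp add: sum_distrib_left)
    also have "\<dots> \<le> 4 * (\<Sum>n. real n powr (-(3/2)))"
      using summ by (intro mult_left_mono sum_le_suminf) auto
    finally show "(\<Sum>n\<in>{n\<in>{1..N}. \<not> prime n}. mangoldt n / real n) \<le> 4 * (\<Sum>n. real n powr (-(3/2)))" .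
  qed
qed

text \<open>The Mertens sum over \<open>(y, y\<^sup>2]\<close> is \<open>ln y + O(1)\<close>, proper
  prime powers contribute \<open>O(1)\<close>, and each \<open>ln q\<close> is at most
  \<open>2 * ln y\<close>. This gives \<open>1/2 - o(1)\<close>, so 1/4 is safe.\<close>

lemma sum_inverse_primes_square_interval:
  assumes elliott_halberstam
  obtains y0 :: real where "y0 > 1"
    "\<And>y. y \<ge> y0 \<Longrightarrow> (\<Sum>q\<in>{q. prime q \<and> y < real q \<and> real q \<le> y\<^sup>2}. 1 / real q) \<ge> 1/4"
proof -
  obtain C :: real where C: "C \<ge> 1" "\<And>N. N > 0 \<Longrightarrow> \<bar>(\<Sum>n=1..N. mangoldt n / real n) - ln (real N)\<bar> \<le> C"
    using mertens_bound[OF assms] by blast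
  obtain C' :: real where C': "C' \<ge> 0" "\<And>N. (\<Sum>n\<in>{n\<in>{1..N}. \<not> prime n}. mangoldt n / real n) \<le> C'"
    using mangoldt_proper_powers_bound by blast
  define K where "K = 2 * C + C' + ln 2"
  have K: "K > 0" unfolding K_def using C(1) C'(1) ln_gt_zero[of "2::real"] by linarith
  show ?thesis
  proof (rule that[of "exp (2 * K)"])
    show "exp (2 * K) > 1" using K by simp
    fix y :: real assume y: "y \<ge> exp (2 * K)"
    then have y1: "y > 1" using K by (smt (verit) one_less_exp_iff)
    \<comment> \<open>Under this condition the error \<open>K\<close> uses up at most half of
      \<open>ln y\<close>.\<close>
    have lny: "ln y \<ge> 2 * K" using y y1 by (simp add: ln_ge_iff)
    define N M where "N = nat \<lfloor>y\<^sup>2\<rfloor>" and "M = nat \<lfloor>y\<rfloor>"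
    have "real M = of_int \<lfloor>y\<rfloor>" "real N = of_int \<lfloor>y\<^sup>2\<rfloor>" using y1 by (simp_all add: M_def N_def)
    moreover have "y\<^sup>2 > 1" using y1 by simp
    ultimately have "real M \<le> y" "y < real M + 1" "real M > 0" "real N \<le> y\<^sup>2" "y\<^sup>2 < real N + 1" "real N > 0"
      using y1 by linarith+
    then have M: "real M \<le> y" "M \<ge> 1" "y < real M + 1"
      and N: "real N \<le> y\<^sup>2" "N \<ge> 1" "y\<^sup>2 < real N + 1" by auto
    have MN: "M \<le> N" unfolding M_def N_def using y1
      by (intro nat_mono floor_mono) (simp add: power2_eq_square)
    have sets: "{q. prime q \<and> y < real q \<and> real q \<le> y\<^sup>2} = {q\<in>{M<..N}. prime q}"
    proof -
      have "y < real q \<longleftrightarrow> M < q" for q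
      proof
        show "M < q" if "y < real q" using that M(1) by linarith
        show "y < real q" if "M < q" using that M(3) by linarith
      qed
      moreover have "real q \<le> y\<^sup>2 \<longleftrightarrow> q \<le> N" for q
      proof
        show "q \<le> N" if "real q \<le> y\<^sup>2" using that unfolding N_def by (rule le_nat_floor)
        show "real q \<le> y\<^sup>2" if "q \<le> N" using that N(1) by linarith
      qed
      ultimately show ?thesis by auto
    qed
    have "(\<Sum>n=1..N. mangoldt n / real n) = (\<Sum>n=1..M. mangoldt n / real n) + (\<Sum>n\<in>{M<..N}. mangoldt n / real n :: real)"
    proof -
      have "{1..N} = {1..M} \<union> {M<..N}" using MN by auto
      then show ?thesis using MN by (simp only:) (rule sum.union_disjoint, auto)
    qed
    moreover have "(\<Sum>n\<in>{M<..N}. mangoldt n / real n) =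
        (\<Sum>n\<in>{n\<in>{M<..N}. prime n}. mangoldt n / real n) + (\<Sum>n\<in>{n\<in>{M<..N}. \<not> prime n}. mangoldt n / real n :: real)"
      by (subst sum.union_disjoint[symmetric]) (auto intro!: sum.cong)
    moreover have "(\<Sum>n\<in>{n\<in>{M<..N}. \<not> prime n}. mangoldt n / real n) \<le> C'"
      by (rule order_trans[OF sum_mono2 C'(2)[of N]]) auto
    ultimately have 1: "ln (real N) - ln (real M) - 2 * C - C' \<le> (\<Sum>n\<in>{n\<in>{M<..N}. prime n}. mangoldt n / real n)"
      using C(2)[of N] C(2)[of M] M N by linarith
    have "y\<^sup>2 \<le> 2 * real N" using N by linarith
    then have "ln (y\<^sup>2) \<le> ln (2 * real N)" using y1 by (intro ln_mono) auto
    then have "2 * ln y \<le> ln 2 + ln (real N)" using y1 N by (simp add: ln_mult ln_realpow)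
    moreover have "ln (real M) \<le> ln y" using M y1 by (intro ln_mono) auto
    ultimately have "ln y - K \<le> (\<Sum>n\<in>{n\<in>{M<..N}. prime n}. mangoldt n / real n)"
      using 1 unfolding K_def by linarith
    also have "\<dots> \<le> (\<Sum>n\<in>{n\<in>{M<..N}. prime n}. (2 * ln y) * (1 / real n))"
    proof (rule sum_mono)
      fix n assume n: "n \<in> {n\<in>{M<..N}. prime n}"
      then have "real n \<le> y\<^sup>2" using N by auto
      then have "ln (real n) \<le> ln (y\<^sup>2)" using n prime_gt_0_nat[of n] by (intro ln_mono) auto
      then have "ln (real n) \<le> 2 * ln y" using y1 by (simp add: ln_realpow)
      then show "mangoldt n / real n \<le> (2 * ln y) * (1 / real n)"
        using n by (simp add: divide_right_mono)
    qed
    also have "\<dots> = 2 * ln y * (\<Sum>n\<in>{n\<in>{M<..N}. prime n}. 1 / real n)"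
      by (simp add: sum_distrib_left)
    finally have "2 * ln y * (1/4) \<le> 2 * ln y * (\<Sum>n\<in>{n\<in>{M<..N}. prime n}. 1 / real n)"
      using lny by linarith
    then show "(\<Sum>q\<in>{q. prime q \<and> y < real q \<and> real q \<le> y\<^sup>2}. 1 / real q) \<ge> 1/4"
      unfolding sets using lny K by (subst (asm) mult_le_cancel_left_pos) auto
  qed
qed

text \<open>Each repeated squaring contributes another 1/4, so the sum exceeds any bound while
  \<open>y\<close> remains a fixed power of the upper end.\<close>

lemma sum_inverse_primes_ge:
  assumes elliott_halberstam
  obtains y0 :: real where "y0 > 1"
    "\<And>y j. y \<ge> y0 \<Longrightarrow> (\<Sum>q\<in>{q. prime q \<and> y < real q \<and> real q \<le> y ^ (2 ^ j)}. 1 / real q) \<ge> real j / 4"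
proof -
  obtain y0 :: real where y0: "y0 > 1"
    "\<And>y. y \<ge> y0 \<Longrightarrow> (\<Sum>q\<in>{q. prime q \<and> y < real q \<and> real q \<le> y\<^sup>2}. 1 / real q) \<ge> 1/4"
    using sum_inverse_primes_square_interval[OF assms] by blast
  show ?thesis
  proof (rule that[OF y0(1)])
    fix y :: real and j :: nat assume y: "y \<ge> y0"
    show "(\<Sum>q\<in>{q. prime q \<and> y < real q \<and> real q \<le> y ^ (2 ^ j)}. 1 / real q) \<ge> real j / 4"
    proof (induction j)
      case (Suc j)
      let ?I = "\<lambda>a b. {q. prime q \<and> a < real q \<and> real q \<le> (b::real)}"
      have yj: "y ^ (2 ^ j) \<ge> y" using y y0(1) by (intro self_le_power) auto
      have fin: "finite (?I a b)" for a b
        by (rule finite_subset[of _ "{..nat \<lfloor>b\<rfloor>}"]) (auto simp: le_nat_floor)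
      have "y ^ (2 ^ j) \<le> (y ^ (2 ^ j))\<^sup>2" using yj y y0(1) by (intro self_le_power) auto
      then have "?I y (y ^ (2 ^ Suc j)) = ?I y (y ^ (2 ^ j)) \<union> ?I (y ^ (2 ^ j)) ((y ^ (2 ^ j))\<^sup>2)"
        using yj by (auto simp: power_mult[symmetric] mult.commute)
      then have "(\<Sum>q\<in>?I y (y ^ (2 ^ Suc j)). 1 / real q) =
          (\<Sum>q\<in>?I y (y ^ (2 ^ j)). 1 / real q) + (\<Sum>q\<in>?I (y ^ (2 ^ j)) ((y ^ (2 ^ j))\<^sup>2). 1 / real q)"
        by (simp only:) (intro sum.union_disjoint fin, auto)
      then show ?case using Suc y0(2)[of "y ^ (2 ^ j)"] yj y by simp
    qed (auto intro!: sum_nonneg)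
  qed
qed

section \<open>Nonprincipal characters modulo a prime\<close>

definition nonprincipal_char :: "nat \<Rightarrow> (nat \<Rightarrow> complex) \<Rightarrow> bool" where
  "nonprincipal_char p \<xi> \<longleftrightarrow> prime p \<and> (\<forall>m n. \<xi> (m * n) = \<xi> m * \<xi> n) \<and> (\<forall>n. \<xi> (n + p) = \<xi> n) \<and>
     (\<forall>n. p dvd n \<longrightarrow> \<xi> n = 0) \<and> (\<forall>n. \<not> p dvd n \<longrightarrow> norm (\<xi> n) = 1) \<and>
     (\<exists>n. \<not> p dvd n \<and> \<xi> n \<noteq> 1)"

context
  fixes p :: nat and \<xi> :: "nat \<Rightarrow> complex"
  assumes \<xi>: "nonprincipal_char p \<xi>"
begin

lemma char_prime: "prime p"
  and char_mult: "\<xi> (m * n) = \<xi> m * \<xi> n"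
  and char_add: "\<xi> (n + p) = \<xi> n"
  and char_eq_0: "p dvd n \<Longrightarrow> \<xi> n = 0"
  and char_norm_eq_1: "\<not> p dvd n \<Longrightarrow> norm (\<xi> n) = 1"
  using \<xi> unfolding nonprincipal_char_def by simp_all

lemma char_norm_le_1: "norm (\<xi> n) \<le> 1"
  using char_eq_0[of n] char_norm_eq_1[of n] by (cases "p dvd n") auto

lemma char_one: "\<xi> 1 = 1"
proof -
  have "\<not> p dvd 1" using char_prime by auto
  then have "\<xi> 1 \<noteq> 0" using char_norm_eq_1[of 1] by auto
  moreover have "\<xi> 1 * \<xi> 1 = \<xi> 1" using char_mult[of 1 1] by simp
  ultimately show ?thesis by simp
qed

lemma char_mod: "\<xi> (n mod p) = \<xi> n"
proof -
  have "\<xi> (m + k * p) = \<xi> m" for m k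
  proof (induction k)
    case (Suc k)
    have "\<xi> (m + Suc k * p) = \<xi> ((m + k * p) + p)" by (simp add: algebra_simps)
    then show ?case using Suc char_add by simp
  qed simp
  from this[of "n mod p" "n div p"] show ?thesis by simp
qed

lemma sum_char_period: "(\<Sum>n<p. \<xi> n) = 0"
proof -
  obtain a where a: "\<not> p dvd a" "\<xi> a \<noteq> 1" using \<xi> unfolding nonprincipal_char_def by auto
  have cop: "coprime a p" using a(1) char_prime prime_imp_coprime_nat coprime_commute by blast
  have p: "p > 0" using char_prime prime_gt_0_nat by auto
  have inj: "inj_on (\<lambda>n. a * n mod p) {..<p}"
  proof (rule inj_onI)
    fix m n assume mn: "m \<in> {..<p}" "n \<in> {..<p}" "a * m mod p = a * n mod p"
    then have "[a * m = a * n] (mod p)" by (simp add: unique_euclidean_semiring_class.cong_def)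
    then have "[m = n] (mod p)" using cop by (simp add: cong_mult_lcancel_nat)
    then show "m = n" using mn by (simp add: unique_euclidean_semiring_class.cong_def)
  qed
  have "(\<lambda>n. a * n mod p) ` {..<p} = {..<p}"
    by (rule card_subset_eq) (use p in \<open>auto simp: card_image[OF inj]\<close>)
  then have "(\<Sum>n<p. \<xi> n) = (\<Sum>n\<in>(\<lambda>n. a * n mod p) ` {..<p}. \<xi> n)" by simp
  also have "\<dots> = (\<Sum>n<p. \<xi> (a * n mod p))" by (subst sum.reindex[OF inj]) simp
  also have "\<dots> = \<xi> a * (\<Sum>n<p. \<xi> n)" by (simp add: char_mod char_mult sum_distrib_left)
  finally have "(1 - \<xi> a) * (\<Sum>n<p. \<xi> n) = 0" by (simp add: algebra_simps)
  then show ?thesis using a(2) by simp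
qed

text \<open>Full periods cancel, leaving fewer than \<open>p\<close> terms. This trivial bound
  suffices for sums of length at least \<open>p^2\<close>.\<close>

lemma norm_sum_char_le: "norm (\<Sum>n<N. \<xi> n) \<le> real p"
proof (induction N rule: less_induct)
  case (less N)
  have p: "p > 0" using char_prime prime_gt_0_nat by auto
  have shift: "(\<Sum>n<M + p. \<xi> n) = (\<Sum>n<M. \<xi> n)" for M
  proof (induction M)
    case (Suc M)
    then show ?case using char_add[of M] by simp
  qed (use sum_char_period in simp)
  show ?case
  proof (cases "N < p")
    case True
    have "norm (\<Sum>n<N. \<xi> n) \<le> (\<Sum>n<N. 1)" by (intro sum_norm_le char_norm_le_1)
    then show ?thesis using True by simp
  next
    case False
    then show ?thesis using less[of "N - p"] shift[of "N - p"] p by simp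
  qed
qed

lemma norm_sum_char_interval_le: "norm (\<Sum>n=M..N. \<xi> n) \<le> 2 * real p"
proof (cases "M \<le> N")
  case True
  have "(\<Sum>n<Suc N. \<xi> n) = (\<Sum>n<M. \<xi> n) + (\<Sum>n=M..N. \<xi> n)"
  proof -
    have eq: "{..<Suc N} = {..<M} \<union> {M..N}" using True by auto
    show ?thesis unfolding eq by (rule sum.union_disjoint) auto
  qed
  then have "(\<Sum>n=M..N. \<xi> n) = (\<Sum>n<Suc N. \<xi> n) - (\<Sum>n<M. \<xi> n)" by (simp add: algebra_simps)
  also have "norm \<dots> \<le> norm (\<Sum>n<Suc N. \<xi> n) + norm (\<Sum>n<M. \<xi> n)" by (rule norm_triangle_ineq4)
  finally show ?thesis using norm_sum_char_le[of M] norm_sum_char_le[of "Suc N"] by linarith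
qed simp

end

section \<open>Levels of distribution of integers and shifted primes\<close>

lemma card_prime_factors_le: "card (prime_factors n) \<le> bigomega n" for n :: nat
proof -
  have "card (set_mset M) \<le> size M" for M :: "nat multiset"
    by (induction M) (auto simp: card_insert_if)
  then show ?thesis by simp
qed

text \<open>Turns the main term \<open>x / totient r\<close> of the primes into the
  \<open>x / r\<close> of the integers, so that both weights yield the same sum over
  \<open>r\<close>. The ratio \<open>totient r / r\<close> is a product of at most \<open>k\<close>
  factors above \<open>1 - 1/w\<close>, hence at least \<open>1 - k / w\<close> by
  Bernoulli.\<close>

lemma inverse_totient_rough:
  assumes "rough w r" "bigomega r \<le> k" "2 * real k \<le> w" "w \<ge> 1"
  shows "\<bar>1 / real (totient r) - 1 / real r\<bar> \<le> 2 * real k / w * (1 / real r)"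
proof -
  have r: "r > 0" using assms(1) rough_pos by auto
  define c where "c = card (prime_factors r)"
  have ck: "real c \<le> real k" using card_prime_factors_le[of r] assms(2) unfolding c_def by simp
  have "1 + real c * (- (1 / w)) \<le> (1 + (- (1 / w))) ^ c"
    using assms(4) by (intro Bernoulli_inequality) simp
  also have "\<dots> = (\<Prod>q\<in>prime_factors r. 1 - 1 / w)" by (simp add: c_def)
  also have "\<dots> \<le> (\<Prod>q\<in>prime_factors r. 1 - 1 / real q)"
  proof (rule prod_mono)
    fix q assume "q \<in> prime_factors r"
    then have "w < real q" using assms(1) unfolding rough_def by (auto simp: prime_factors_dvd)
    then show "0 \<le> 1 - 1 / w \<and> 1 - 1 / w \<le> 1 - 1 / real q"
      using assms(4) by (auto simp: frac_le)
  qed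
  finally have P: "1 - real c / w \<le> (\<Prod>q\<in>prime_factors r. 1 - 1 / real q)" (is "_ \<le> ?P") by simp
  have kw: "real c / w \<le> real k / w" using ck assms(4) by (intro divide_right_mono) auto
  have kw2: "real k / w \<le> 1/2" using assms(3,4) by (simp add: field_simps)
  define t where "t = real k / w"
  have t: "0 \<le> t" "t \<le> 1/2" "1 - t \<le> ?P" using P kw kw2 assms(4) unfolding t_def by auto
  have "?P \<le> 1"
  proof (rule prod_le_1)
    fix q assume "q \<in> prime_factors r"
    then have "real q \<ge> 1" using prime_ge_1_nat by auto
    then show "0 \<le> 1 - 1 / real q \<and> 1 - 1 / real q \<le> 1" by simp
  qed
  have "1 / ?P \<le> 1 / (1 - t)" using t by (intro frac_le) auto
  also have "\<dots> \<le> 1 + 2 * t" 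
  proof -
    have "t * (1 - 2 * t) \<ge> 0" using t by simp
    then have "1 \<le> (1 + 2 * t) * (1 - t)" by (simp add: algebra_simps)
    then show ?thesis using t by (simp add: pos_divide_le_eq)
  qed
  finally have 1: "1 / ?P - 1 \<le> 2 * t" by simp
  have 2: "1 / ?P \<ge> 1" using \<open>?P \<le> 1\<close> t by simp
  have "1 / real (totient r) - 1 / real r = (1 / ?P - 1) * (1 / real r)"
    unfolding totient_formula2 using r by (simp add: field_simps)
  also have "\<bar>\<dots>\<bar> \<le> 2 * t * (1 / real r)"
    unfolding abs_mult using 1 2 by (intro mult_mono) auto
  finally show ?thesis by (simp add: t_def)
qed

lemma sum_inverse_le: "N > 0 \<Longrightarrow> (\<Sum>n=1..N. 1 / real n) \<le> 1 + ln (real N)"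
proof -
  assume "N > 0"
  then obtain M where M: "N = Suc M" by (cases N) auto
  have "harm (Suc M) - ln (real (Suc M)) \<le> harm (Suc 0) - ln (real (Suc 0))"
    using decseq_harm_diff_ln by (rule decseqD) simp
  then show ?thesis by (simp add: M harm_def inverse_eq_divide)
qed

lemma sum_inverse_subset_le:
  assumes "R \<subseteq> {r. 0 < r \<and> real r < D}" "D \<le> real N" "N > 0"
  shows "(\<Sum>r\<in>R. 1 / real r) \<le> 1 + ln (real N)"
proof -
  have "(\<Sum>r\<in>R. 1 / real r) \<le> (\<Sum>n=1..N. 1 / real n)"
    using assms by (intro sum_mono2) force+
  then show ?thesis using sum_inverse_le[OF assms(3)] by linarith
qed

lemma card_le_of_bounded:
  assumes "R \<subseteq> {r. 0 < r \<and> real r < D}" "D \<ge> 0"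
  shows "real (card R) \<le> D"
proof -
  have "R \<subseteq> {1..nat \<lfloor>D\<rfloor>}" using assms by (auto simp: le_nat_floor Suc_le_eq)
  then have "card R \<le> nat \<lfloor>D\<rfloor>" using card_mono[of "{1..nat \<lfloor>D\<rfloor>}" R] by simp
  then show ?thesis using assms(2) by (simp add: le_nat_iff le_floor_iff)
qed

text \<open>The count is \<open>N div r - N div (p * r)\<close>: rounding costs at most 1 per
  modulus, the multiples of \<open>p\<close> cost \<open>N / (p * r)\<close>.\<close>

lemma integers_level_of_distribution:
  fixes N p :: nat and D :: real
  assumes R: "R \<subseteq> {r. 0 < r \<and> real r < D \<and> \<not> p dvd r}" and D: "0 \<le> D" "D \<le> real N" and "N > 0" "prime p"
  shows "(\<Sum>r\<in>R. \<bar>(\<Sum>m\<in>{m\<in>{m\<in>{1..N}. \<not> p dvd m}. r dvd m}. 1) - real N / r\<bar>)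
           \<le> D + real N / p * (1 + ln (real N))"
proof -
  let ?M = "{m\<in>{1..N}. \<not> p dvd m}"
  have "(\<Sum>r\<in>R. \<bar>(\<Sum>m\<in>{m\<in>?M. r dvd m}. 1) - real N / r\<bar>)
      \<le> (\<Sum>r\<in>R. 1 + real N / p * (1 / r))"
  proof (rule sum_mono)
    fix r assume "r \<in> R"
    then have r: "r > 0" "\<not> p dvd r" using R by auto
    have p: "p > 0" using assms prime_gt_0_nat by auto
    have "coprime p r" using r(2) assms(5) by (simp add: prime_imp_coprime)
    then have "p * r dvd m \<longleftrightarrow> p dvd m \<and> r dvd m" for m
      by (meson divides_mult dvd_mult_left dvd_mult_right)
    then have eq: "{m\<in>{1..N}. r dvd m} = {m\<in>?M. r dvd m} \<union> {m\<in>{1..N}. p * r dvd m}"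
      by auto
    have "card ({m\<in>?M. r dvd m} \<union> {m\<in>{1..N}. p * r dvd m}) =
        card {m\<in>?M. r dvd m} + card {m\<in>{1..N}. p * r dvd m}"
      by (intro card_Un_disjoint) (auto dest: dvd_mult_left)
    then have "N div r = card {m\<in>?M. r dvd m} + N div (p * r)"
      using r p unfolding eq[symmetric] by (simp only: card_multiples mult_pos_pos)
    then have "real (card {m\<in>?M. r dvd m}) = real (N div r) - real (N div (p * r))"
      by simp
    moreover have "real (N div r) \<le> real N / r" "real N / r - 1 \<le> real (N div r)"
      using floor_divide_of_nat_eq[of N r, where 'a = real] by linarith+
    moreover have "real (N div (p * r)) \<le> real N / (p * r)"
      using floor_divide_of_nat_eq[of N "p * r", where 'a = real] by linarith
    moreover have "real N / (p * r) \<ge> 0" by simp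
    ultimately have "\<bar>real (card {m\<in>?M. r dvd m}) - real N / r\<bar> \<le> 1 + real N / (p * r)"
      by linarith
    then show "\<bar>(\<Sum>m\<in>{m\<in>?M. r dvd m}. 1) - real N / r\<bar> \<le> 1 + real N / p * (1 / r)"
      by simp
  qed
  also have "\<dots> = real (card R) + real N / p * (\<Sum>r\<in>R. 1 / r)"
    by (simp add: sum.distrib sum_distrib_left)
  also have "\<dots> \<le> D + real N / p * (1 + ln (real N))"
    using R D assms(4)
    by (intro add_mono mult_left_mono card_le_of_bounded sum_inverse_subset_le[where D = D]) auto
  finally show ?thesis .
qed

lemma sum_mangoldt_multiples_le:
  assumes "prime p" "N \<le> p ^ 4"
  shows "(\<Sum>n\<in>{n\<in>{1..N}. p dvd n}. mangoldt n) \<le> 4 * ln (real p)"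
proof -
  have p: "p > 1" using assms prime_gt_1_nat by auto
  have sub: "{n\<in>{1..N}. p dvd n \<and> primepow n} \<subseteq> (\<lambda>k. p ^ k) ` {1..4}"
  proof
    fix n assume "n \<in> {n\<in>{1..N}. p dvd n \<and> primepow n}"
    then obtain q k where n: "n = q ^ k" "prime q" "k > 0" "n \<le> N" "p dvd n"
      by (auto simp: primepow_def)
    then have "q = p" using assms(1) by (metis prime_dvd_power primes_dvd_imp_eq)
    moreover have "p ^ k \<le> p ^ 4" using n assms \<open>q = p\<close> by simp
    then have "k \<le> 4" using p power_le_imp_le_exp by blast
    ultimately show "n \<in> (\<lambda>k. p ^ k) ` {1..4}" using n by auto
  qed
  have "(\<Sum>n\<in>{n\<in>{1..N}. p dvd n}. mangoldt n :: real) = (\<Sum>n\<in>{n\<in>{1..N}. p dvd n \<and> primepow n}. mangoldt n)"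
    by (intro sum.mono_neutral_right) (auto simp: mangoldt_def)
  also have "\<dots> \<le> (\<Sum>n\<in>(\<lambda>k. p ^ k) ` {1..4}. mangoldt n)"
    using sub by (intro sum_mono2) auto
  also have "\<dots> \<le> (\<Sum>k\<in>{1..4}. mangoldt (p ^ k))"
    using sum_image_le[of "{1..4::nat}" "\<lambda>n. mangoldt n :: real" "\<lambda>k. p ^ k"] by (auto simp: o_def)
  also have "\<dots> = (\<Sum>k\<in>{1..4::nat}. ln (real p))"
    using assms(1) by (intro sum.cong) auto
  finally show ?thesis by simp
qed

text \<open>Since \<open>\<xi>\<close> has period \<open>p\<close>, shifting by \<open>p\<close> turns \<open>\<Sum>\<Lambda>(n)\<xi>(n)\<close> into a sum of \<open>\<xi>\<close> against the
  weight \<open>\<Lambda>(m - p)\<close>, whose distribution in the class 0 mod \<open>r\<close> is that of \<open>\<Lambda>\<close> in the class \<open>-p\<close>.\<close>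

lemma shifted_primes_level_of_distribution:
  fixes N p k :: nat and D w :: real
  assumes R: "R \<subseteq> {r. real r < D \<and> rough w r \<and> bigomega r \<le> k \<and> \<not> p dvd r}"
    and D: "0 \<le> D" "D \<le> real N" and p: "N > 0" "prime p" "N \<le> p ^ 4" and w: "2 * real k \<le> w" "w \<ge> 1"
    and EH: "\<And>b. (\<And>r. r \<in> R \<Longrightarrow> coprime (b r) r) \<Longrightarrow>
       (\<Sum>r\<in>R. \<bar>psi_ap (real N) r (b r) - real N / real (totient r)\<bar>) \<le> E"
  shows "(\<Sum>r\<in>R. \<bar>(\<Sum>m\<in>{m\<in>{m\<in>{p+1..N+p}. \<not> p dvd m}. r dvd m}. mangoldt (m - p)) - real N / r\<bar>)
           \<le> E + real N * (2 * real k / w) * (1 + ln (real N)) + D * (4 * ln (real p))"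
proof -
  let ?M = "{m\<in>{p+1..N+p}. \<not> p dvd m}"
  \<comment> \<open>A natural number in the class of \<open>- p\<close> modulo \<open>r\<close>,
    since \<open>b r + p = p * r\<close>.\<close>
  define b where "b r = p * (r - 1)" for r
  have Rpos: "r > 0" if "r \<in> R" for r using that R by (auto dest: rough_pos)
  have b: "coprime (b r) r" if "r \<in> R" for r
  proof -
    have "coprime p r" using that R p(2) by (auto simp: prime_imp_coprime)
    moreover have "coprime (r - 1) r" using Rpos[OF that] by (cases r) auto
    ultimately show ?thesis by (simp add: b_def)
  qed
  have R0: "R \<subseteq> {r. 0 < r \<and> real r < D}" using R Rpos by auto
  have "(\<Sum>r\<in>R. \<bar>(\<Sum>m\<in>{m\<in>?M. r dvd m}. mangoldt (m - p)) - real N / r\<bar>) \<le>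
     (\<Sum>r\<in>R. \<bar>psi_ap (real N) r (b r) - real N / real (totient r)\<bar> +
        real N * (2 * real k / w) * (1 / real r) + 4 * ln (real p))"
  proof (rule sum_mono)
    fix r assume r: "r \<in> R"
    let ?A = "\<Sum>m\<in>{m\<in>?M. r dvd m}. mangoldt (m - p) :: real"
    have "?A = (\<Sum>n\<in>{n\<in>{1..N}. \<not> p dvd n \<and> r dvd n + p}. mangoldt n)"
    proof (rule sum.reindex_bij_witness[where j = "\<lambda>m. m - p" and i = "\<lambda>n. n + p"])
      fix m assume m: "m \<in> {m\<in>?M. r dvd m}"
      then have "\<not> p dvd (m - p)" by (metis atLeastAtMost_iff dvd_diffD dvd_refl le_add1 le_trans mem_Collect_eq)
      then show "m - p \<in> {n\<in>{1..N}. \<not> p dvd n \<and> r dvd n + p}" using m by auto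
    qed auto
    moreover have "psi_ap (real N) r (b r) = (\<Sum>n\<in>{n\<in>{1..N}. r dvd n + p}. mangoldt n)"
    proof -
      have "[n = b r] (mod r) \<longleftrightarrow> r dvd n + p" for n
      proof -
        have "[n = b r] (mod r) \<longleftrightarrow> [n + p = b r + p] (mod r)" by (simp add: cong_add_rcancel_nat)
        also have "b r + p = p * r" using Rpos[OF r] by (cases r) (auto simp: b_def)
        also have "[n + p = p * r] (mod r) \<longleftrightarrow> r dvd n + p" by (simp add: unique_euclidean_semiring_class.cong_def mod_eq_0_iff_dvd)
        finally show ?thesis .
      qed
      then show ?thesis unfolding psi_ap_def by (intro sum.cong) auto
    qed
    moreover have "(\<Sum>n\<in>{n\<in>{1..N}. r dvd n + p}. mangoldt n :: real) =
        (\<Sum>n\<in>{n\<in>{1..N}. \<not> p dvd n \<and> r dvd n + p}. mangoldt n) +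
        (\<Sum>n\<in>{n\<in>{1..N}. p dvd n \<and> r dvd n + p}. mangoldt n)"
      by (subst sum.union_disjoint[symmetric]) (auto intro!: sum.cong)
    moreover have "(\<Sum>n\<in>{n\<in>{1..N}. p dvd n \<and> r dvd n + p}. mangoldt n) \<le> 4 * ln (real p)"
      by (rule order_trans[OF sum_mono2 sum_mangoldt_multiples_le[OF p(2,3)]]) auto
    moreover have "(\<Sum>n\<in>{n\<in>{1..N}. p dvd n \<and> r dvd n + p}. mangoldt n) \<ge> (0 :: real)"
      by (intro sum_nonneg) auto
    ultimately have 1: "\<bar>?A - psi_ap (real N) r (b r)\<bar> \<le> 4 * ln (real p)" by linarith
    have "\<bar>real N / real (totient r) - real N / r\<bar> = real N * \<bar>1 / real (totient r) - 1 / real r\<bar>"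
    proof -
      have "real N / real (totient r) - real N / r = real N * (1 / real (totient r) - 1 / real r)"
        by (simp add: right_diff_distrib)
      then show ?thesis by (simp only: abs_mult abs_of_nat)
    qed
    also have "\<dots> \<le> real N * (2 * real k / w * (1 / real r))"
      using r R w by (intro mult_left_mono inverse_totient_rough) auto
    finally show "\<bar>?A - real N / r\<bar> \<le> \<bar>psi_ap (real N) r (b r) - real N / real (totient r)\<bar> +
        real N * (2 * real k / w) * (1 / real r) + 4 * ln (real p)"
      using 1 by linarith
  qed
  also have "\<dots> = (\<Sum>r\<in>R. \<bar>psi_ap (real N) r (b r) - real N / real (totient r)\<bar>) +
        real N * (2 * real k / w) * (\<Sum>r\<in>R. 1 / real r) + real (card R) * (4 * ln (real p))"
    by (simp add: sum.distrib sum_distrib_left)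
  also have "\<dots> \<le> E + real N * (2 * real k / w) * (1 + ln (real N)) + D * (4 * ln (real p))"
    using R0 D p w prime_ge_1_nat[OF p(2)] b
    by (intro add_mono mult_left_mono mult_right_mono EH card_le_of_bounded
        sum_inverse_subset_le[where D = D]) auto
  finally show ?thesis .
qed

section \<open>Cancellation in the sum of \<Lambda>\<xi>\<close>

text \<open>One threshold for the conditions on \<open>p\<close> in the next lemma: the room
  \<open>w * D > 2 * N\<close>, the start of the prime sums, the error terms of both levels of
  distribution, and the character sum \<open>2 * p\<close>.\<close>

lemma large_parameter_conditions:
  fixes \<omega> \<delta> \<eta> y0 x0 :: real and k :: nat
  assumes "\<omega> > 0" "\<delta> > 0" "\<eta> > 0"
  obtains x1 where "\<And>x. x \<ge> x1 \<Longrightarrow> x \<ge> 2 \<and> x \<ge> x0 \<and> x powr (\<omega>/5) > 2 \<and> x powr \<omega> \<ge> y0 \<and> 2 * real k \<le> x powr \<omega> \<and>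
    2 * real k * x powr (-\<omega>) * (1 + 4 * ln x) \<le> \<delta>/4 \<and> 4 * ln x * x powr (-(2*\<omega>/5)) \<le> \<delta>/4 \<and>
    x powr (-(2*\<omega>/5)) \<le> \<delta>/4 \<and> (1 + 4 * ln x) / x \<le> \<delta>/4 \<and> 2 / x \<le> \<eta>/4"
proof -
  have "filterlim (\<lambda>x::real. x powr (\<omega>/5)) at_top at_top" using assms by real_asymp
  then have 1: "\<forall>\<^sub>F x::real in at_top. x powr (\<omega>/5) > 2" by (simp add: filterlim_at_top_dense)
  have l: "filterlim (\<lambda>x::real. x powr \<omega>) at_top at_top" using assms by real_asymp
  then have 2: "\<forall>\<^sub>F x::real in at_top. x powr \<omega> \<ge> y0" by (simp add: filterlim_at_top)
  from l have 3: "\<forall>\<^sub>F x::real in at_top. x powr \<omega> \<ge> 2 * real k" by (simp add: filterlim_at_top)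
  have "((\<lambda>x::real. 2 * real k * (x powr (-\<omega>) * (1 + 4 * ln x))) \<longlongrightarrow> 2 * real k * 0) at_top"
    by (rule tendsto_mult_left) (use assms in real_asymp)
  then have 4: "\<forall>\<^sub>F x::real in at_top. 2 * real k * (x powr (-\<omega>) * (1 + 4 * ln x)) < \<delta>/4"
    by (rule order_tendstoD) (use assms in simp)
  have "((\<lambda>x::real. 4 * ln x * x powr (-(2*\<omega>/5))) \<longlongrightarrow> 0) at_top" using assms by real_asymp
  then have 5: "\<forall>\<^sub>F x::real in at_top. 4 * ln x * x powr (-(2*\<omega>/5)) < \<delta>/4"
    by (rule order_tendstoD) (use assms in simp)
  have "((\<lambda>x::real. x powr (-(2*\<omega>/5))) \<longlongrightarrow> 0) at_top" using assms by real_asymp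
  then have 6: "\<forall>\<^sub>F x::real in at_top. x powr (-(2*\<omega>/5)) < \<delta>/4"
    by (rule order_tendstoD) (use assms in simp)
  have "((\<lambda>x::real. (1 + 4 * ln x) / x) \<longlongrightarrow> 0) at_top" by real_asymp
  then have 7: "\<forall>\<^sub>F x::real in at_top. (1 + 4 * ln x) / x < \<delta>/4"
    by (rule order_tendstoD) (use assms in simp)
  have "((\<lambda>x::real. 2 / x) \<longlongrightarrow> 0) at_top" by real_asymp
  then have 8: "\<forall>\<^sub>F x::real in at_top. 2 / x < \<eta>/4"
    by (rule order_tendstoD) (use assms in simp)
  have "\<forall>\<^sub>F x::real in at_top. x \<ge> 2 \<and> x \<ge> x0 \<and> x powr (\<omega>/5) > 2 \<and> x powr \<omega> \<ge> y0 \<and> 2 * real k \<le> x powr \<omega> \<and>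
    2 * real k * x powr (-\<omega>) * (1 + 4 * ln x) \<le> \<delta>/4 \<and> 4 * ln x * x powr (-(2*\<omega>/5)) \<le> \<delta>/4 \<and>
    x powr (-(2*\<omega>/5)) \<le> \<delta>/4 \<and> (1 + 4 * ln x) / x \<le> \<delta>/4 \<and> 2 / x \<le> \<eta>/4"
    using 1 2 3 4 5 6 7 8 eventually_ge_at_top[of 2] eventually_ge_at_top[of x0]
    by eventually_elim (simp add: mult.assoc)
  then show ?thesis using that by (auto simp: eventually_at_top_linorder)
qed

lemma char_mangoldt_sum_small:
  assumes EH: elliott_halberstam and \<epsilon>: "0 < \<epsilon>" "\<epsilon> \<le> 1/2" and \<eta>: "\<eta> > 0"
  obtains p0 :: nat where
    "\<And>p \<xi> N. p \<ge> p0 \<Longrightarrow> nonprincipal_char p \<xi> \<Longrightarrow> (\<And>n. 1 \<le> n \<Longrightarrow> real n \<le> real p powr \<epsilon> \<Longrightarrow> \<xi> n = 1) \<Longrightarrow>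
       p ^ 2 \<le> N \<Longrightarrow> N \<le> p ^ 4 \<Longrightarrow> norm (\<Sum>n=1..N. mangoldt n * \<xi> n) \<le> \<eta> * real N"
proof -
  \<comment> \<open>Ensures \<open>z ^ k \<ge> p^5 \<ge> 2 * N\<close>, which bounds the number of
    prime factors of \<open>z\<close>-rough divisors.\<close>
  define k where "k = nat \<lceil>5 / \<epsilon>\<rceil>"
  define B :: real where "B = 2 ^ (k\<^sup>2 + k)"
  \<comment> \<open>Gives \<open>S \<ge> j / 4 \<ge> 8 * B / \<eta>\<close>, hence
    \<open>B / S \<le> \<eta> / 8\<close>; the added 4 ensures \<open>S \<ge> 1\<close>.\<close>
  define j where "j = nat \<lceil>32 * B / \<eta>\<rceil> + 4"
  \<comment> \<open>With \<open>w = p powr \<omega>\<close> this makes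
    \<open>w ^ (2 ^ j) = z\<close>, the range of primes summed in \<open>S\<close>.\<close>
  define \<omega> where "\<omega> = \<epsilon> / 2 ^ j"
  \<comment> \<open>As \<open>N \<le> p^4\<close>, the level loses only
    \<open>N powr (\<omega>/5) \<le> p powr (4 * \<omega> / 5)\<close>, so
    \<open>w * D \<ge> N * p powr (\<omega>/5) > 2 * N\<close>.\<close>
  define \<theta> where "\<theta> = 1 - \<omega> / 5"
  \<comment> \<open>Chosen so that \<open>B * (7 * \<delta>) = \<eta> / 8\<close>.\<close>
  define \<delta> where "\<delta> = \<eta> / (56 * B)"
  \<comment> \<open>The moduli in \<open>R\<close> are only \<open>w\<close>-rough;
    \<open>w ^ k2 \<ge> p^4\<close> bounds the number of their prime factors.\<close>
  define k2 where "k2 = nat \<lceil>4 / \<omega>\<rceil>"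
  have B: "B \<ge> 1" by (simp add: B_def)
  have \<omega>: "\<omega> > 0" "\<omega> \<le> 1/2" "\<omega> \<le> \<epsilon>" "\<omega> * 2 ^ j = \<epsilon>"
  proof -
    show 1: "\<omega> > 0" "\<omega> * 2 ^ j = \<epsilon>" using \<epsilon> by (auto simp: \<omega>_def)
    have "\<omega> * 1 \<le> \<omega> * 2 ^ j" using 1 by (intro mult_left_mono) auto
    then show "\<omega> \<le> \<epsilon>" using 1 by simp
    then show "\<omega> \<le> 1/2" using \<epsilon> by simp
  qed
  have \<theta>: "0 < \<theta>" "\<theta> < 1" "2 * \<theta> > 1" using \<omega> by (auto simp: \<theta>_def)
  have \<delta>: "\<delta> > 0" using \<eta> B by (simp add: \<delta>_def)
  have k: "\<epsilon> * real k \<ge> 5"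
  proof -
    have "real k \<ge> 5 / \<epsilon>" unfolding k_def by linarith
    then show ?thesis using \<epsilon> by (simp add: pos_divide_le_eq mult.commute)
  qed
  have k2: "\<omega> * real k2 \<ge> 4"
  proof -
    have "real k2 \<ge> 4 / \<omega>" unfolding k2_def by linarith
    then show ?thesis using \<omega> by (simp add: pos_divide_le_eq mult.commute)
  qed
  have j: "real j \<ge> 32 * B / \<eta>" "real j \<ge> 4" unfolding j_def by linarith+
  obtain y0 :: real where y0: "y0 > 1"
    "\<And>y j. y \<ge> y0 \<Longrightarrow> (\<Sum>q\<in>{q. prime q \<and> y < real q \<and> real q \<le> y ^ (2 ^ j)}. 1 / real q) \<ge> real j / 4"
    using sum_inverse_primes_ge[OF EH] by blast
  obtain x0 where x0: "x0 \<ge> 2"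
    "\<And>x R b. x \<ge> x0 \<Longrightarrow> R \<subseteq> {r. 0 < r \<and> real r < x powr \<theta>} \<Longrightarrow> (\<And>r. r \<in> R \<Longrightarrow> coprime (b r) r) \<Longrightarrow>
       (\<Sum>r\<in>R. \<bar>psi_ap x r (b r) - x / real (totient r)\<bar>) \<le> \<delta> / 4 * x"
    using elliott_halberstam_error[OF EH \<theta>(1,2), of "\<delta>/4"] \<delta> by auto
  obtain x1 where x1: "\<And>x. x \<ge> x1 \<Longrightarrow> x \<ge> 2 \<and> x \<ge> x0 \<and> x powr (\<omega>/5) > 2 \<and> x powr \<omega> \<ge> y0 \<and> 2 * real k2 \<le> x powr \<omega> \<and>
    2 * real k2 * x powr (-\<omega>) * (1 + 4 * ln x) \<le> \<delta>/4 \<and> 4 * ln x * x powr (-(2*\<omega>/5)) \<le> \<delta>/4 \<and>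
    x powr (-(2*\<omega>/5)) \<le> \<delta>/4 \<and> (1 + 4 * ln x) / x \<le> \<delta>/4 \<and> 2 / x \<le> \<eta>/4"
    using large_parameter_conditions[OF \<omega>(1) \<delta> \<eta>] by metis
  show ?thesis
  proof (rule that[of "nat \<lceil>x1\<rceil>"])
    fix p :: nat and \<xi> :: "nat \<Rightarrow> complex" and N :: nat
    assume "p \<ge> nat \<lceil>x1\<rceil>" and \<xi>: "nonprincipal_char p \<xi>"
      and one: "\<And>n. 1 \<le> n \<Longrightarrow> real n \<le> real p powr \<epsilon> \<Longrightarrow> \<xi> n = 1"
      and N: "p ^ 2 \<le> N" "N \<le> p ^ 4"
    then have "real p \<ge> x1" by linarith
    note C = x1[OF this]
    let ?M = "{m\<in>{1..N}. \<not> p dvd m}"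
    let ?P = "{m\<in>{p+1..N+p}. \<not> p dvd m}"
    define w z D where "w = real p powr \<omega>" and "z = real p powr \<epsilon>" and "D = real N powr \<theta>"
    define R where "R = {r. real r < D \<and> rough w r \<and> \<not> p dvd r}"
    define S where "S = (\<Sum>q\<in>{q. prime q \<and> w < real q \<and> real q \<le> z}. 1 / real q)"
    define G where "G = (\<Sum>r\<in>{r\<in>R. rough z r}. rough_transform \<xi> z r / of_nat r)"
    have pp: "prime p" by (rule char_prime[OF \<xi>])
    have p2: "real p \<ge> 2" using C by simp
    have Nr: "real p ^ 2 \<le> real N" "real N \<le> real p ^ 4" "real p \<le> real N"
    proof -
      show "real p ^ 2 \<le> real N" using N(1) by (metis of_nat_le_iff of_nat_power)
      then show "real p \<le> real N" using self_le_power[of "real p" 2] p2 by simp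
      show "real N \<le> real p ^ 4" using N(2) by (metis of_nat_le_iff of_nat_power)
    qed
    have N1: "real N \<ge> 2" "N > 0" using Nr(3) p2 by auto
    have lnN: "ln (real N) \<le> 4 * ln (real p)"
      using ln_mono[OF Nr(2)] N1 p2 by (simp add: ln_realpow)
    have lnp: "ln (real p) \<ge> 0" using p2 by simp
    have w: "w \<ge> y0" "w \<ge> 1" "2 * real k2 \<le> w" using C y0(1) by (auto simp: w_def)
    have wz: "w ^ (2 ^ j) = z"
      unfolding w_def z_def using p2 \<omega> by (simp add: powr_powr flip: powr_realpow)
    have z: "1 < z" "w \<le> z" "z < real p" unfolding z_def w_def
      using p2 \<epsilon> \<omega> powr_less_mono[of 0 \<epsilon> "real p"] powr_less_mono[of \<epsilon> 1 "real p"] by auto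
    have S: "S \<ge> real j / 4" using y0(2)[OF w(1), of j] unfolding wz S_def .
    have S1: "S \<ge> 1" using S j(2) by linarith
    have SB: "B * (1 / S) \<le> \<eta> / 8"
    proof -
      have "8 * B / \<eta> \<le> S" using S j(1) by simp
      then have "8 * B \<le> S * \<eta>" using \<eta> by (simp add: pos_divide_le_eq)
      then have "B / S \<le> \<eta> / 8" using S1 by (simp add: pos_divide_le_eq mult.commute)
      then show ?thesis by simp
    qed
    have D_eq: "D = real N * real N powr (- (\<omega>/5))"
    proof -
      have "\<theta> = 1 + (- (\<omega>/5))" by (simp add: \<theta>_def)
      then show ?thesis unfolding D_def using N1 by (simp only: powr_add) simp
    qed
    have "real N powr (- (\<omega>/5)) \<le> (real p ^ 2) powr (- (\<omega>/5))"
      using Nr p2 \<omega> by (intro powr_mono2') auto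
    also have "(real p ^ 2) powr (- (\<omega>/5)) = real p powr (- (2 * \<omega> / 5))"
      using p2 by (simp add: powr_powr flip: powr_numeral)
    finally have D_le: "D \<le> real N * real p powr (- (2 * \<omega> / 5))"
      unfolding D_eq by (intro mult_left_mono) auto
    have "(real p ^ 4) powr (- (\<omega>/5)) \<le> real N powr (- (\<omega>/5))"
      using Nr p2 N1 \<omega> by (intro powr_mono2') auto
    moreover have "(real p ^ 4) powr (- (\<omega>/5)) = real p powr (- (4 * \<omega> / 5))"
      using p2 by (simp add: powr_powr flip: powr_numeral)
    ultimately have "w * D \<ge> w * (real N * real p powr (- (4 * \<omega> / 5)))"
      unfolding D_eq using w by (intro mult_left_mono) auto
    also have "w * (real N * real p powr (- (4 * \<omega> / 5))) = real N * real p powr (\<omega>/5)"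
    proof -
      have "\<omega> / 5 = \<omega> + (- (4 * \<omega> / 5))" by simp
      then have "real p powr (\<omega>/5) = w * real p powr (- (4 * \<omega> / 5))" unfolding w_def by (metis powr_add)
      then show ?thesis by simp
    qed
    finally have "w * D \<ge> real N * real p powr (\<omega>/5)" .
    moreover have "real N * real p powr (\<omega>/5) > real N * 2"
      using C N1 by (intro mult_strict_left_mono) auto
    ultimately have wD: "w * D > real N * 2" by linarith
    have Dpos: "D > 0" unfolding D_def using N1 by simp
    have DN: "D \<le> real N"
      unfolding D_def using N1 \<theta> powr_mono[of \<theta> 1 "real N"] by simp
    have zz: "z * z < D"
    proof -
      have "z * z = real p powr (2 * \<epsilon>)" unfolding z_def by (simp flip: powr_add)
      also have "\<dots> \<le> real p powr 1" using p2 \<epsilon> by (intro powr_mono) auto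
      also have "\<dots> < real p powr (2 * \<theta>)" using p2 \<theta> by (intro powr_less_mono) auto
      also have "\<dots> = (real p ^ 2) powr \<theta>" using p2 by (simp add: powr_powr flip: powr_numeral)
      also have "\<dots> \<le> D" unfolding D_def using Nr \<theta> by (intro powr_mono2) auto
      finally show ?thesis .
    qed
    have zk: "2 * real N \<le> z ^ k"
    proof -
      have "2 * real N \<le> real p * real p ^ 4" using p2 Nr by (intro mult_mono) auto
      also have "\<dots> = real p powr 5" using p2 by (simp add: powr_numeral numeral_eq_Suc)
      also have "\<dots> \<le> real p powr (\<epsilon> * real k)" using p2 k by (intro powr_mono) auto
      also have "\<dots> = z ^ k" unfolding z_def using p2 by (simp add: powr_powr flip: powr_realpow)
      finally show ?thesis .
    qed
    have wk2: "real N \<le> w ^ k2"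
    proof -
      have "real N \<le> real p powr 4" using p2 Nr by (simp add: powr_numeral)
      also have "\<dots> \<le> real p powr (\<omega> * real k2)" using p2 k2 by (intro powr_mono) auto
      also have "\<dots> = w ^ k2" unfolding w_def using p2 by (simp add: powr_powr flip: powr_realpow)
      finally show ?thesis .
    qed
    have w1: "w > 1" using w y0 by linarith
    have Rk2: "bigomega r \<le> k2" if "r \<in> R" for r
      by (rule rough_bigomega_le[where z = w]) (use that w1 wk2 DN in \<open>auto simp: R_def\<close>)
    have oneq: "\<xi> q = 1" if "prime q" "real q \<le> z" for q
      using one[of q] that prime_ge_1_nat[of q] by (simp add: z_def)
    have bound: "B * (1 / S + 7 * \<delta>) * real N \<le> \<eta> / 4 * real N"
    proof (intro mult_right_mono)
      have "B * (7 * \<delta>) = \<eta> / 8" unfolding \<delta>_def using B by (simp add: field_simps)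
      then show "B * (1 / S + 7 * \<delta>) \<le> \<eta> / 4" using SB unfolding distrib_left by linarith
    qed simp
    have Dzk: "D \<le> z ^ k" using DN zk by simp
    \<comment> \<open>Shared by both weights. The bound on \<open>m\<close> is \<open>2 * N\<close>
      because the shifted primes reach \<open>N + p\<close>.\<close>
    have est: "norm ((\<Sum>m\<in>M. of_real (a m) * \<xi> m) - of_real (real N) * G) \<le> B * (1 / S + 7 * \<delta>) * real N"
      if "finite M" "\<And>m. m \<in> M \<Longrightarrow> m > 0 \<and> \<not> p dvd m \<and> real m \<le> 2 * real N" "\<And>m. m \<in> M \<Longrightarrow> a m \<ge> 0"
        "(\<Sum>r\<in>R. \<bar>(\<Sum>m\<in>{m\<in>M. r dvd m}. a m) - real N / r\<bar>) \<le> \<delta> * real N" for M and a :: "nat \<Rightarrow> real"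
    proof -
      note M0 = that(2)
      have M: "m > 0 \<and> \<not> p dvd m \<and> real m \<le> z ^ k \<and> real m < w * D" if "m \<in> M" for m
        using M0[OF that] zk wD by auto
      show ?thesis unfolding G_def B_def S_def R_def
        by (rule rough_sum_estimate[OF char_mult[OF \<xi>] char_one[OF \<xi>] char_norm_le_1[OF \<xi>] oneq that(1) pp
              z(3,1,2) zz Dzk M that(3) S1[unfolded S_def] of_nat_0_le_iff less_imp_le[OF \<delta>] that(4)[unfolded R_def]])
    qed
    have ints: "norm ((\<Sum>m\<in>?M. of_real 1 * \<xi> m) - of_real (real N) * G) \<le> \<eta> / 4 * real N"
    proof (rule order_trans[OF _ bound])
      have "(\<Sum>r\<in>R. \<bar>(\<Sum>m\<in>{m\<in>?M. r dvd m}. 1) - real N / r\<bar>)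
           \<le> D + real N / p * (1 + ln (real N))"
        using Dpos DN N1 pp
        by (intro integers_level_of_distribution) (auto simp: R_def dest: rough_pos)
      also have "\<dots> \<le> real N * real p powr (- (2 * \<omega> / 5)) + real N * ((1 + 4 * ln (real p)) / p)"
      proof -
        have "real N / p * (1 + ln (real N)) \<le> real N / p * (1 + 4 * ln (real p))"
          using lnN by (intro mult_left_mono) auto
        then show ?thesis using D_le by simp
      qed
      also have "\<dots> \<le> real N * (\<delta>/4) + real N * (\<delta>/4)"
        using C by (intro add_mono mult_left_mono) auto
      also have "\<dots> \<le> \<delta> * real N" using \<delta> by simp
      finally have lvl: "(\<Sum>r\<in>R. \<bar>(\<Sum>m\<in>{m\<in>?M. r dvd m}. 1) - real N / r\<bar>) \<le> \<delta> * real N" .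
      show "norm ((\<Sum>m\<in>?M. of_real 1 * \<xi> m) - of_real (real N) * G) \<le> B * (1 / S + 7 * \<delta>) * real N"
        by (rule est) (use lvl in auto)
    qed
    have prms: "norm ((\<Sum>m\<in>?P. of_real (mangoldt (m - p)) * \<xi> m) - of_real (real N) * G) \<le> \<eta> / 4 * real N"
    proof (rule order_trans[OF _ bound])
      have "(\<Sum>r\<in>R. \<bar>(\<Sum>m\<in>{m\<in>?P. r dvd m}. mangoldt (m - p)) - real N / r\<bar>)
           \<le> \<delta> / 4 * real N + real N * (2 * real k2 / w) * (1 + ln (real N)) + D * (4 * ln (real p))"
      proof (rule shifted_primes_level_of_distribution)
        show "(\<Sum>r\<in>R. \<bar>psi_ap (real N) r (b r) - real N / real (totient r)\<bar>) \<le> \<delta> / 4 * real N"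
          if "\<And>r. r \<in> R \<Longrightarrow> coprime (b r) r" for b
          by (rule x0(2)) (use that C Nr(3) in \<open>auto simp: R_def D_def dest: rough_pos\<close>)
      qed (use Rk2 Dpos DN N1 pp N w in \<open>auto simp: R_def\<close>)
      also have "real N * (2 * real k2 / w) * (1 + ln (real N)) \<le> real N * (\<delta>/4)"
      proof -
        have "real N * (2 * real k2 / w) * (1 + ln (real N)) \<le> real N * (2 * real k2 / w) * (1 + 4 * ln (real p))"
          using lnN w by (intro mult_left_mono) auto
        also have "\<dots> = real N * (2 * real k2 * real p powr (-\<omega>) * (1 + 4 * ln (real p)))"
          by (simp add: w_def powr_minus divide_inverse)
        also have "\<dots> \<le> real N * (\<delta>/4)" using C by (intro mult_left_mono) auto
        finally show ?thesis .
      qed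
      also have "D * (4 * ln (real p)) \<le> real N * (\<delta>/4)"
      proof -
        have "D * (4 * ln (real p)) \<le> real N * real p powr (- (2 * \<omega> / 5)) * (4 * ln (real p))"
          using D_le lnp by (intro mult_right_mono) auto
        also have "\<dots> = real N * (4 * ln (real p) * real p powr (- (2 * \<omega> / 5)))" by simp
        also have "\<dots> \<le> real N * (\<delta>/4)" using C by (intro mult_left_mono) auto
        finally show ?thesis .
      qed
      also have "\<delta> / 4 * real N + real N * (\<delta>/4) + real N * (\<delta>/4) \<le> \<delta> * real N"
      proof -
        have "\<delta> / 4 * real N + real N * (\<delta>/4) + real N * (\<delta>/4) = 3/4 * (\<delta> * real N)" by simp
        moreover have "\<delta> * real N \<ge> 0" using \<delta> by simp
        ultimately show ?thesis by linarith
      qed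
      finally have lvl: "(\<Sum>r\<in>R. \<bar>(\<Sum>m\<in>{m\<in>?P. r dvd m}. mangoldt (m - p)) - real N / r\<bar>) \<le> \<delta> * real N"
        by simp
      have M: "m > 0 \<and> \<not> p dvd m \<and> real m \<le> 2 * real N" if "m \<in> ?P" for m
      proof -
        have "real m \<le> real N + real p" using that by auto
        then show ?thesis using that Nr(3) by auto
      qed
      show "norm ((\<Sum>m\<in>?P. of_real (mangoldt (m - p)) * \<xi> m) - of_real (real N) * G) \<le> B * (1 / S + 7 * \<delta>) * real N"
        by (rule est[OF _ M _ lvl]) simp_all
    qed
    have "(\<Sum>m\<in>?M. of_real 1 * \<xi> m) = (\<Sum>m=1..N. \<xi> m)"
      using char_eq_0[OF \<xi>] by (intro sum.mono_neutral_cong_left) auto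
    then have i: "norm (\<Sum>m\<in>?M. of_real 1 * \<xi> m) \<le> 2 * real p"
      using norm_sum_char_interval_le[OF \<xi>, of 1 N] by simp
    have "(\<Sum>m\<in>?P. of_real (mangoldt (m - p)) * \<xi> m) =
        (\<Sum>m\<in>{p+1..N+p}. of_real (mangoldt (m - p)) * \<xi> m)"
      using char_eq_0[OF \<xi>] by (intro sum.mono_neutral_left) auto
    also have "\<dots> = (\<Sum>n=1..N. mangoldt n * \<xi> n)"
    proof (rule sum.reindex_bij_witness[where j = "\<lambda>m. m - p" and i = "\<lambda>n. n + p"])
      fix m assume "m \<in> {p+1..N+p}"
      then show "mangoldt (m - p) * \<xi> (m - p) = of_real (mangoldt (m - p)) * \<xi> m"
        using char_add[OF \<xi>, of "m - p"] by simp
    qed auto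
    finally have eq: "(\<Sum>m\<in>?P. of_real (mangoldt (m - p)) * \<xi> m) =
        (\<Sum>n=1..N. mangoldt n * \<xi> n)" .
    \<comment> \<open>\<open>G\<close> is estimated only through the integers, whose character sum
      is at most \<open>2 * p\<close>.\<close>
    have "norm (of_real (real N) * G) \<le> 2 * real p + \<eta> / 4 * real N"
      using i ints norm_triangle_sub[of "of_real (real N) * G" "\<Sum>m\<in>?M. of_real 1 * \<xi> m"]
      by (simp only: norm_minus_commute)
    moreover have "norm (\<Sum>n=1..N. mangoldt n * \<xi> n) \<le> norm (of_real (real N) * G) + \<eta> / 4 * real N"
      using prms norm_triangle_sub[of "\<Sum>n=1..N. mangoldt n * \<xi> n" "of_real (real N) * G"]
      unfolding eq by linarith
    moreover have "2 * real p \<le> \<eta> / 4 * real N"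
    proof -
      have "2 * real p = 2 / real p * real p ^ 2" using p2 by (simp add: power2_eq_square)
      also have "\<dots> \<le> \<eta> / 4 * real N" using C Nr \<eta> by (intro mult_mono) auto
      finally show ?thesis .
    qed
    moreover have "\<eta> / 4 * real N + (\<eta> / 4 * real N + \<eta> / 4 * real N) \<le> \<eta> * real N"
      using mult_nonneg_nonneg[of \<eta> "real N"] \<eta> by simp
    ultimately show "norm (\<Sum>n=1..N. mangoldt n * \<xi> n) \<le> \<eta> * real N" by linarith
  qed
qed

section \<open>Tools from complex analysis and partial summation\<close>

lemma norm_exp_diff_one_le: "norm (exp z - 1) \<le> norm z * exp (norm z)" for z :: complex
proof -
  have "norm (exp z - exp 0) \<le> exp (norm z) * norm (z - 0)"
  proof (rule field_differentiable_bound[where S = "cball 0 (norm z)" and f' = exp])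
    fix x :: complex assume "x \<in> cball 0 (norm z)"
    then have "Re x \<le> norm z" using complex_Re_le_cmod[of x] by simp
    then show "norm (exp x) \<le> exp (norm z)" by simp
  qed (auto intro!: derivative_eq_intros)
  then show ?thesis by (simp add: mult.commute)
qed

text \<open>The map \<open>F / (2 * M - F)\<close> sends the half plane \<open>Re < M\<close> into
  the unit disc and 0 to 0. Schwarz's lemma at \<open>norm x \<le> 1/2\<close> gives
  \<open>norm F \<le> (2 * M + norm F) / 2\<close>.\<close>

lemma borel_caratheodory_half_disc:
  assumes F: "F holomorphic_on ball 0 R" "F 0 = 0" and M: "\<And>w. w \<in> ball 0 R \<Longrightarrow> Re (F w) < M"
    and R: "R > 0" and w: "norm w \<le> R / 2"
  shows "norm (F w) \<le> 2 * M"
proof -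
  have M0: "M > 0" using M[of 0] F(2) R by simp
  define g where "g x = F (of_real R * x) / (of_real (2 * M) - F (of_real R * x))" for x
  have ball: "of_real R * x \<in> ball 0 R" if "x \<in> ball 0 1" for x :: complex
    using that R by (simp add: norm_mult)
  have lt: "norm (F x) < norm (of_real (2 * M) - F x)" if "x \<in> ball 0 R" for x
  proof -
    have "(norm (of_real (2 * M) - F x))\<^sup>2 - (norm (F x))\<^sup>2 = 4 * M * (M - Re (F x))"
      unfolding cmod_power2 by (simp add: power2_eq_square algebra_simps)
    also have "\<dots> > 0" using M[OF that] M0 by simp
    finally show ?thesis by (simp add: power_less_imp_less_base)
  qed
  have holo: "(\<lambda>x. F (of_real R * x)) holomorphic_on ball 0 1"
  proof -
    have "(\<lambda>x::complex. of_real R * x) ` ball 0 1 \<subseteq> ball 0 R" using ball by blast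
    then show ?thesis
      using holomorphic_on_compose_gen[OF _ F(1), of "\<lambda>x. of_real R * x" "ball 0 1"]
      by (auto simp: o_def intro!: holomorphic_intros)
  qed
  have g: "norm (g x) \<le> norm x" if "norm x < 1" for x
  proof (rule Schwarz_Lemma(1))
    have "of_real (2 * M) - F (of_real R * x) \<noteq> 0" if "x \<in> ball 0 1" for x
    proof
      assume "of_real (2 * M) - F (of_real R * x) = 0"
      with lt[OF ball[OF that]] show False by (simp only: norm_zero) simp
    qed
    then show "g holomorphic_on ball 0 1" unfolding g_def
      by (intro holomorphic_on_divide holomorphic_on_diff holomorphic_on_const holo)
    show "g 0 = 0" by (simp add: g_def F)
    show "norm (g x) < 1" if "norm x < 1" for x
      unfolding g_def norm_divide using lt[OF ball[of x]] that
      by (smt (verit) divide_less_eq_1_pos mem_ball_0 norm_ge_zero)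
  qed (use that in auto)
  define x where "x = w / of_real R"
  have x: "norm x \<le> 1/2" "of_real R * x = w" using w R by (auto simp: x_def norm_divide field_simps)
  have wb: "w \<in> ball 0 R" using w R by simp
  have "norm (g x) \<le> 1/2" using g[of x] x by simp
  then have "norm (F w) \<le> 1/2 * norm (of_real (2 * M) - F w)"
    unfolding g_def x(2) norm_divide using lt[OF wb]
    by (smt (verit) divide_le_eq norm_ge_zero)
  also have "norm (of_real (2 * M) - F w) \<le> 2 * M + norm (F w)"
    using norm_triangle_ineq4[of "of_real (2 * M)" "F w"] M0 by simp
  finally show ?thesis by simp
qed

text \<open>The bound \<open>b n\<close> on partial sums may vary with \<open>n\<close>: it will be
  constant for sums of \<xi> and linear for sums of \<Lambda>\<xi>.\<close>

lemma norm_abel_sum_le: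
  fixes a h :: "nat \<Rightarrow> complex" and b :: "nat \<Rightarrow> real"
  assumes "M \<le> N" and b: "\<And>n. M \<le> n \<Longrightarrow> n \<le> N \<Longrightarrow> norm (\<Sum>i\<in>{M<..n}. a i) \<le> b n"
  shows "norm (\<Sum>n\<in>{M<..N}. a n * h n) \<le> b N * norm (h N) + (\<Sum>n\<in>{M<..<N}. b n * norm (h n - h (Suc n)))"
proof -
  define S where "S n = (\<Sum>i\<in>{M<..n}. a i)" for n
  have "(\<Sum>n\<in>{M<..N}. a n * h n) = S N * h N + (\<Sum>n\<in>{M<..<N}. S n * (h n - h (Suc n)))"
    using assms(1)
  proof (induction N rule: dec_induct)
    case (step n)
    have 1: "{M<..Suc n} = insert (Suc n) {M<..n}" using step.hyps by auto
    have SS: "S (Suc n) = S n + a (Suc n)" unfolding S_def 1 by simp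
    show ?case
    proof (cases "n = M")
      case True
      have "{M<..Suc M} = {Suc M}" "{M<..<Suc M} = {}" by auto
      then show ?thesis using True by (simp add: S_def)
    next
      case False
      then have 2: "{M<..<Suc n} = insert n {M<..<n}" using step.hyps by auto
      show ?thesis unfolding 1 2 using step.IH SS by (simp add: algebra_simps)
    qed
  qed (simp add: S_def)
  also have "norm \<dots> \<le> norm (S N * h N) + norm (\<Sum>n\<in>{M<..<N}. S n * (h n - h (Suc n)))"
    by (rule norm_triangle_ineq)
  also have "norm (S N * h N) \<le> b N * norm (h N)"
    unfolding norm_mult S_def using b[of N] assms(1) by (intro mult_right_mono) auto
  also have "norm (\<Sum>n\<in>{M<..<N}. S n * (h n - h (Suc n))) \<le> (\<Sum>n\<in>{M<..<N}. b n * norm (h n - h (Suc n)))"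
    unfolding S_def by (rule sum_norm_le) (auto simp: norm_mult intro!: mult_right_mono b)
  finally show ?thesis by simp
qed

lemma sum_inverse_squares_tail_le:
  assumes "M > 0"
  shows "(\<Sum>n\<in>{M<..<N}. 1 / (real n)\<^sup>2) \<le> 1 / real M"
proof (cases "M < N")
  case True
  have "(\<Sum>n\<in>{M<..<N}. 1 / (real n)\<^sup>2) \<le> 1 / real M - 1 / real (N - 1)"
    using Suc_leI[OF True]
  proof (induction N rule: dec_induct)
    case (step n)
    then have n: "n > 1" "{M<..<Suc n} = insert n {M<..<n}" using assms by auto
    have "1 / (real n)\<^sup>2 \<le> 1 / (real n * (real n - 1))"
      using n(1) by (intro divide_left_mono) (auto simp: power2_eq_square)
    also have "\<dots> = 1 / (real n - 1) - 1 / real n" using n(1) by (simp add: field_simps)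
    finally show ?case using step.IH n by (simp add: of_nat_diff)
  qed (simp add: atLeastSucLessThan_greaterThanLessThan[symmetric])
  then show ?thesis by (rule order_trans) simp
qed auto

section \<open>The weights of the scaled Dirichlet series\<close>

text \<open>This is \<open>n\<close> to the power \<open>- s\<close> with
  \<open>s = 1 + u / ln p\<close>. In this scale a disc of fixed radius in \<open>u\<close> suits
  every \<open>p\<close>, since \<open>ln n / ln p\<close> stays in \<open>[0, 4]\<close> up to
  \<open>p^4\<close>.\<close>

definition twist :: "nat \<Rightarrow> complex \<Rightarrow> nat \<Rightarrow> complex" where
  "twist p u n = exp (- u * of_real (ln (real n) / ln (real p))) / of_nat n"

lemma twist_mult: "m > 0 \<Longrightarrow> n > 0 \<Longrightarrow> twist p u (m * n) = twist p u m * twist p u n"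
  by (simp add: twist_def ln_mult add_divide_distrib distrib_left distrib_right exp_add exp_diff exp_minus field_simps)

lemma ln_ratio_bounds:
  assumes "ln (real p) \<ge> 1" "1 \<le> n" "n \<le> p ^ 4"
  shows "0 \<le> ln (real n) / ln (real p)" "ln (real n) / ln (real p) \<le> 4"
proof -
  have "p \<noteq> 0" using assms(2,3) by (cases p) auto
  moreover have "p \<noteq> 1" using assms(1) by auto
  ultimately have p: "p > 1" by linarith
  have "ln (real n) \<le> ln (real (p ^ 4))" using assms p by (intro ln_mono of_nat_mono) auto
  then show "ln (real n) / ln (real p) \<le> 4" using assms p by (subst pos_divide_le_eq) (auto simp: ln_realpow)
  show "0 \<le> ln (real n) / ln (real p)" using assms by simp
qed

lemma norm_twist_le:
  assumes "ln (real p) \<ge> 1" "1 \<le> n" "n \<le> p ^ 4" "\<kappa> \<ge> 0" "norm w \<le> R"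
  shows "norm (twist p (of_real \<kappa> + w) n) \<le> exp (4 * R) / real n"
proof -
  define v where "v = ln (real n) / ln (real p)"
  have v: "0 \<le> v" "v \<le> 4" unfolding v_def using ln_ratio_bounds[OF assms(1-3)] by auto
  have "- Re w \<le> R" using abs_Re_le_cmod[of w] assms(5) by linarith
  then have "- Re w * v \<le> R * v" using v by (intro mult_right_mono) auto
  also have "\<dots> \<le> R * 4" using v assms(5) norm_ge_zero[of w] by (intro mult_left_mono) linarith+
  finally have "- (\<kappa> + Re w) * v \<le> 4 * R" using mult_nonneg_nonneg[OF assms(4) v(1)] by (simp add: algebra_simps)
  then show ?thesis unfolding twist_def v_def[symmetric]
    by (simp add: norm_divide divide_right_mono)
qed

text \<open>A bound, uniform in \<open>p\<close>, for \<open>n\<^sup>2\<close> times the step of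
  \<open>twist\<close> from \<open>n\<close> to \<open>n + 1\<close>. The first factor bounds the
  size of \<open>twist\<close>, the second bounds \<open>norm s * exp (norm s)\<close>, because
  \<open>ln p \<ge> 1\<close> gives \<open>norm s \<le> 1 + \<kappa> + R\<close>.\<close>

definition twist_lip :: "real \<Rightarrow> real \<Rightarrow> real" where
  "twist_lip \<kappa> R = exp (4 * R) * ((1 + \<kappa> + R) * exp (1 + \<kappa> + R))"

lemma twist_lip_ge: "\<kappa> \<ge> 0 \<Longrightarrow> R \<ge> 0 \<Longrightarrow> exp (4 * R) \<le> twist_lip \<kappa> R"
proof -
  assume "\<kappa> \<ge> 0" "R \<ge> 0"
  then have "1 * 1 \<le> (1 + \<kappa> + R) * exp (1 + \<kappa> + R)" by (intro mult_mono) auto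
  then show ?thesis unfolding twist_lip_def by simp
qed

lemma norm_twist_diff_le:
  assumes "ln (real p) \<ge> 1" "1 \<le> n" "n \<le> p ^ 4" "\<kappa> \<ge> 0" "norm w \<le> R"
  shows "norm (twist p (of_real \<kappa> + w) n - twist p (of_real \<kappa> + w) (Suc n)) \<le> twist_lip \<kappa> R / (real n)\<^sup>2"
proof -
  define u where "u = of_real \<kappa> + w"
  define s where "s = 1 + u / of_real (ln (real p))"
  define \<delta> where "\<delta> = ln (real (Suc n)) - ln (real n)"
  have tw: "twist p u m = exp (- s * of_real (ln (real m)))" if "m > 0" for m
  proof -
    have "- s * of_real (ln (real m)) = - u * of_real (ln (real m) / ln (real p)) - of_real (ln (real m))"
      by (simp add: s_def algebra_simps)
    also have "exp \<dots> = twist p u m"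
      using that by (simp add: twist_def exp_diff exp_of_real)
    finally show ?thesis by simp
  qed
  have R: "R \<ge> 0" using assms(5) norm_ge_zero[of w] by linarith
  have "norm u \<le> \<kappa> + R" unfolding u_def using assms norm_triangle_ineq[of "of_real \<kappa>" w] by simp
  moreover have "norm (u / of_real (ln (real p))) \<le> norm u"
    using assms(1) mult_left_mono[OF assms(1), of "norm u"] by (simp add: norm_divide pos_divide_le_eq)
  ultimately have s: "norm s \<le> 1 + \<kappa> + R"
    unfolding s_def using norm_triangle_ineq[of 1 "u / of_real (ln (real p))"] by simp
  have \<delta>: "0 \<le> \<delta>" "\<delta> \<le> 1 / real n"
  proof -
    show "0 \<le> \<delta>" using assms(2) by (simp add: \<delta>_def)
    have "\<delta> = ln (1 + 1 / real n)"
    proof -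
      have "1 + 1 / real n = real (Suc n) / real n" using assms(2) by (simp add: field_simps)
      then show ?thesis using assms(2) by (simp add: \<delta>_def ln_div)
    qed
    then show "\<delta> \<le> 1 / real n" using assms(2) by (simp add: ln_add_one_self_le_self)
  qed
  have n1: "1 / real n \<le> 1" using assms(2) by simp
  have sd: "norm (- s * of_real \<delta>) \<le> (1 + \<kappa> + R) * (1 / real n)"
    unfolding norm_mult norm_minus_cancel using s \<delta> assms(4) R by (intro mult_mono) auto
  also have "\<dots> \<le> (1 + \<kappa> + R) * 1" using n1 assms(4) R by (intro mult_left_mono) auto
  finally have sd2: "norm (- s * of_real \<delta>) \<le> 1 + \<kappa> + R" by simp
  have "twist p u (Suc n) = twist p u n * exp (- s * of_real \<delta>)"
    using assms(2) by (simp add: tw \<delta>_def exp_add[symmetric] algebra_simps del: of_nat_Suc)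
  then have "norm (twist p u n - twist p u (Suc n)) = norm (twist p u n) * norm (exp (- s * of_real \<delta>) - 1)"
    by (simp add: norm_mult[symmetric] norm_minus_commute algebra_simps)
  also have "\<dots> \<le> (exp (4 * R) / real n) * ((1 + \<kappa> + R) * (1 / real n) * exp (1 + \<kappa> + R))"
  proof (intro mult_mono)
    show "norm (twist p u n) \<le> exp (4 * R) / real n" unfolding u_def by (rule norm_twist_le[OF assms])
    have "norm (exp (- s * of_real \<delta>) - 1) \<le> norm (- s * of_real \<delta>) * exp (norm (- s * of_real \<delta>))"
      by (rule norm_exp_diff_one_le)
    also have "\<dots> \<le> (1 + \<kappa> + R) * (1 / real n) * exp (1 + \<kappa> + R)"
      using sd sd2 assms(4) R by (intro mult_mono) auto
    finally show "norm (exp (- s * of_real \<delta>) - 1) \<le> (1 + \<kappa> + R) * (1 / real n) * exp (1 + \<kappa> + R)" .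
  qed auto
  also have "\<dots> = twist_lip \<kappa> R / (real n)\<^sup>2" by (simp add: twist_lip_def power2_eq_square)
  finally show ?thesis unfolding u_def .
qed

text \<open>The logarithm is the Dirichlet convolution of 1 and \<Lambda>. For completely
  multiplicative \<open>g\<close> the result would be a product of two sums but for the constraint
  \<open>d * m \<le> y\<close>.\<close>

lemma sum_ln_eq_sum_mangoldt_pairs:
  fixes g :: "nat \<Rightarrow> complex"
  assumes g: "\<And>m n. m > 0 \<Longrightarrow> n > 0 \<Longrightarrow> g (m * n) = g m * g n"
  shows "(\<Sum>n=1..y. of_real (ln (real n)) * g n) =
         (\<Sum>d=1..y. \<Sum>m\<in>{m\<in>{1..y}. d * m \<le> y}. mangoldt d * g d * g m)"
proof -
  have "(\<Sum>n=1..y. of_real (ln (real n)) * g n) = (\<Sum>n=1..y. \<Sum>d\<in>{d. d dvd n}. mangoldt d * g n)"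
    by (intro sum.cong refl) (simp add: mangoldt_sum[symmetric] sum_distrib_right)
  also have "\<dots> = (\<Sum>(n,d)\<in>Sigma {1..y} (\<lambda>n. {d. d dvd n}). mangoldt d * g n)"
    by (subst sum.Sigma) auto
  also have "\<dots> = (\<Sum>(d,m)\<in>Sigma {1..y} (\<lambda>d. {m\<in>{1..y}. d * m \<le> y}). mangoldt d * g d * g m)"
  proof (rule sum.reindex_bij_witness[where j = "\<lambda>(n,d). (d, n div d)" and i = "\<lambda>(d,m). (d * m, d)"])
    fix a assume "a \<in> Sigma {1..y} (\<lambda>n. {d. d dvd n})"
    then obtain d m where a: "a = (d * m, d)" "d > 0" "m > 0" "d * m \<le> y"
      by (auto simp: Suc_le_eq elim!: dvdE)
    then have "d * 1 \<le> d * m" "1 * m \<le> d * m" by (intro mult_le_mono; simp)+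
    then have "d \<le> y" "m \<le> y" using a by linarith+
    with a show "(case a of (n,d) \<Rightarrow> (d, n div d)) \<in> Sigma {1..y} (\<lambda>d. {m\<in>{1..y}. d * m \<le> y})"
      "(case case a of (n,d) \<Rightarrow> (d, n div d) of (d,m) \<Rightarrow> (d * m, d)) = a"
      "(case case a of (n,d) \<Rightarrow> (d, n div d) of (d,m) \<Rightarrow> mangoldt d * g d * g m) = (case a of (n,d) \<Rightarrow> mangoldt d * g n)"
      by (auto simp: g)
  qed auto
  also have "\<dots> = (\<Sum>d=1..y. \<Sum>m\<in>{m\<in>{1..y}. d * m \<le> y}. mangoldt d * g d * g m)"
    by (subst sum.Sigma) auto
  finally show ?thesis .
qed

section \<open>The truncated series and its approximate logarithmic derivative\<close>

text \<open>Only these estimates enter the analytic part, which is thereby separated from the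
  conjecture. The 5 is \<open>ln (p^4) = 4 * ln p\<close> plus one \<open>ln p\<close> of room for a
  bounded error.\<close>

locale twisted_char_sums =
  fixes p :: nat and \<xi> :: "nat \<Rightarrow> complex" and \<kappa> \<eta> :: real
  assumes \<xi>: "nonprincipal_char p \<xi>" and ln_p_ge: "ln (real p) \<ge> 1" and \<kappa>: "\<kappa> \<ge> 0" and \<eta>: "\<eta> \<ge> 0"
    and mangoldt_char_small: "\<And>N. p ^ 2 \<le> N \<Longrightarrow> N \<le> p ^ 4 \<Longrightarrow> norm (\<Sum>n=1..N. mangoldt n * \<xi> n) \<le> \<eta> * real N"
    and mangoldt_le: "(\<Sum>n=1..p^4. mangoldt n / real n) \<le> 5 * ln (real p)"
    and inverse_le: "(\<Sum>n=1..p^4. 1 / real n) \<le> 5 * ln (real p)"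
begin

definition L :: real where "L = ln (real p)"
definition v :: "nat \<Rightarrow> real" where "v n = ln (real n) / L"
definition g :: "complex \<Rightarrow> nat \<Rightarrow> complex" where "g w n = \<xi> n * twist p (of_real \<kappa> + w) n"
definition A :: "complex \<Rightarrow> complex" where "A w = (\<Sum>n=1..p^4. g w n) / of_real L"
definition A' :: "complex \<Rightarrow> complex" where "A' w = - (\<Sum>n=1..p^4. of_real (v n) * g w n) / of_real L"
definition B :: "complex \<Rightarrow> complex" where "B w = (\<Sum>n=1..p^4. mangoldt n * g w n) / of_real L"
text \<open>The primitive of \<open>B\<close> that vanishes at 0. For \<open>n = 1\<close> the
  quotient is \<open>0 / 0 = 0\<close>, which is harmless because \<Lambda>(1) = 0.\<close>

definition H :: "complex \<Rightarrow> complex" where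
  "H w = (\<Sum>n=1..p^4. mangoldt n * g 0 n * ((1 - exp (- w * of_real (v n))) / of_real (v n))) / of_real L"

lemma p_gt_1: "p > 1" using char_prime[OF \<xi>] prime_gt_1_nat by auto

lemma L: "L \<ge> 1" "L > 0" using ln_p_ge by (auto simp: L_def)

lemma v_bounds: "n \<in> {1..p^4} \<Longrightarrow> 0 \<le> v n" "n \<in> {1..p^4} \<Longrightarrow> v n \<le> 4"
  using ln_ratio_bounds[OF ln_p_ge, of n] by (auto simp: v_def L_def)

lemma norm_mangoldt [simp]: "norm (mangoldt n :: complex) = mangoldt n"
  by (metis abs_of_nonneg mangoldt_nonneg norm_of_real of_real_mangoldt)

lemma g_eq: "g w n = g 0 n * exp (- w * of_real (v n))"
proof -
  have "- (of_real \<kappa> + w) * of_real (v n) = - (of_real \<kappa> + 0) * of_real (v n) + - w * of_real (v n)"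
    by (simp add: algebra_simps)
  then have "exp (- (of_real \<kappa> + w) * of_real (v n)) =
      exp (- (of_real \<kappa> + 0) * of_real (v n)) * exp (- w * of_real (v n))"
    by (simp only: exp_add)
  then show ?thesis unfolding g_def twist_def L_def[symmetric] v_def[symmetric] by simp
qed

lemma norm_g_le:
  assumes "norm w \<le> R" "n \<in> {1..p^4}"
  shows "norm (g w n) \<le> exp (4 * R) / real n"
proof -
  have "norm (g w n) \<le> 1 * norm (twist p (of_real \<kappa> + w) n)"
    unfolding g_def norm_mult using char_norm_le_1[OF \<xi>] by (intro mult_right_mono) auto
  also have "\<dots> \<le> exp (4 * R) / real n"
    using norm_twist_le[OF ln_p_ge _ _ \<kappa> assms(1), of n] assms(2) by simp
  finally show ?thesis .
qed

text \<open>Partial sums of \<xi> are at most \<open>2 * p\<close>, the total variation of the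
  weights beyond \<open>M\<close> is \<open>O(1 / M)\<close>, and
  \<open>p / M \<le> 1 / p\<close>.\<close>

lemma norm_char_tail_le:
  assumes "norm w \<le> R" "p ^ 2 \<le> M" "M \<le> p ^ 4"
  shows "norm (\<Sum>m\<in>{M<..p^4}. g w m) \<le> 4 * twist_lip \<kappa> R / real p"
proof -
  let ?K = "twist_lip \<kappa> R" and ?h = "twist p (of_real \<kappa> + w)"
  have R: "R \<ge> 0" using assms(1) norm_ge_zero[of w] by linarith
  have K: "exp (4 * R) \<le> ?K" using twist_lip_ge[OF \<kappa> R] .
  then have K0: "?K \<ge> 0" using exp_ge_zero[of "4 * R"] by linarith
  have M: "M > 0" using assms(2) p_gt_1 by (intro Nat.gr0I) auto
  have "norm (\<Sum>m\<in>{M<..p^4}. \<xi> m * ?h m) \<le>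
      2 * real p * norm (?h (p ^ 4)) + (\<Sum>n\<in>{M<..<p^4}. 2 * real p * norm (?h n - ?h (Suc n)))"
  proof (rule norm_abel_sum_le[OF assms(3)])
    fix n
    have "{M<..n} = {Suc M..n}" by auto
    then show "norm (\<Sum>i\<in>{M<..n}. \<xi> i) \<le> 2 * real p"
      using norm_sum_char_interval_le[OF \<xi>, of "Suc M" n] by simp
  qed
  also have "\<dots> \<le> 2 * real p * (?K / real M) + (\<Sum>n\<in>{M<..<p^4}. 2 * real p * (?K / (real n)\<^sup>2))"
  proof (intro add_mono mult_left_mono sum_mono)
    have "norm (?h (p ^ 4)) \<le> exp (4 * R) / real (p ^ 4)"
      by (rule norm_twist_le[OF ln_p_ge _ _ \<kappa> assms(1)]) (use p_gt_1 in auto)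
    also have "\<dots> \<le> ?K / real M"
      using K assms(3) M by (intro frac_le of_nat_mono) (auto simp: K0)
    finally show "norm (?h (p ^ 4)) \<le> ?K / real M" .
    fix n assume "n \<in> {M<..<p^4}"
    then show "norm (?h n - ?h (Suc n)) \<le> ?K / (real n)\<^sup>2"
      by (intro norm_twist_diff_le[OF ln_p_ge _ _ \<kappa> assms(1)]) auto
  qed auto
  also have "(\<Sum>n\<in>{M<..<p^4}. 2 * real p * (?K / (real n)\<^sup>2)) = 2 * real p * ?K * (\<Sum>n\<in>{M<..<p^4}. 1 / (real n)\<^sup>2)"
    by (simp add: sum_distrib_left)
  also have "\<dots> \<le> 2 * real p * ?K * (1 / real M)"
    using sum_inverse_squares_tail_le[OF M] K0 by (intro mult_left_mono) auto
  also have "2 * real p * (?K / real M) + 2 * real p * ?K * (1 / real M) = 4 * ?K * (real p / real M)" by simp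
  also have "\<dots> \<le> 4 * ?K * (1 / real p)"
  proof (intro mult_left_mono)
    have "real p ^ 2 \<le> real M" using assms(2) by (metis of_nat_le_iff of_nat_power)
    then have "real p / real M \<le> real p / real p ^ 2" using p_gt_1 M by (intro divide_left_mono) auto
    then show "real p / real M \<le> 1 / real p" using p_gt_1 by (simp add: power2_eq_square)
  qed (use K0 in auto)
  finally show ?thesis by (simp add: g_def)
qed

text \<open>Partial sums \<open>2 * \<eta> * n\<close> against steps of order
  \<open>1 / n\<^sup>2\<close> leave a harmonic sum, at most \<open>5 * L\<close>. The 12 is
  \<open>2 + 2 * 5\<close>, with \<open>L \<ge> 1\<close> applied to the end term.\<close>

lemma norm_mangoldt_tail_le:
  assumes "norm w \<le> R" "p ^ 2 \<le> M" "M \<le> p ^ 4"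
  shows "norm (\<Sum>m\<in>{M<..p^4}. mangoldt m * g w m) \<le> 12 * \<eta> * twist_lip \<kappa> R * L"
proof -
  let ?K = "twist_lip \<kappa> R" and ?h = "twist p (of_real \<kappa> + w)"
  have R: "R \<ge> 0" using assms(1) norm_ge_zero[of w] by linarith
  have K: "exp (4 * R) \<le> ?K" using twist_lip_ge[OF \<kappa> R] .
  then have K0: "?K \<ge> 0" using exp_ge_zero[of "4 * R"] by linarith
  have M: "M > 0" using assms(2) p_gt_1 by (intro Nat.gr0I) auto
  have "norm (\<Sum>m\<in>{M<..p^4}. mangoldt m * \<xi> m * ?h m) \<le>
      2 * \<eta> * real (p ^ 4) * norm (?h (p ^ 4)) + (\<Sum>n\<in>{M<..<p^4}. 2 * \<eta> * real n * norm (?h n - ?h (Suc n)))"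
  proof (rule norm_abel_sum_le[OF assms(3)])
    fix n assume n: "M \<le> n" "n \<le> p ^ 4"
    have "{1..n} = {1..M} \<union> {M<..n}" using n M by auto
    then have "(\<Sum>i=1..n. mangoldt i * \<xi> i) = (\<Sum>i=1..M. mangoldt i * \<xi> i) + (\<Sum>i\<in>{M<..n}. mangoldt i * \<xi> i)"
      by (simp only:) (rule sum.union_disjoint, auto)
    then have "(\<Sum>i\<in>{M<..n}. mangoldt i * \<xi> i) = (\<Sum>i=1..n. mangoldt i * \<xi> i) - (\<Sum>i=1..M. mangoldt i * \<xi> i)"
      by (simp add: algebra_simps)
    also have "norm \<dots> \<le> norm (\<Sum>i=1..n. mangoldt i * \<xi> i) + norm (\<Sum>i=1..M. mangoldt i * \<xi> i)"
      by (rule norm_triangle_ineq4)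
    also have "\<dots> \<le> \<eta> * real n + \<eta> * real M"
      using n assms by (intro add_mono mangoldt_char_small) auto
    also have "\<dots> \<le> \<eta> * real n + \<eta> * real n" using n \<eta> by (intro add_mono mult_left_mono) auto
    finally show "norm (\<Sum>i\<in>{M<..n}. mangoldt i * \<xi> i) \<le> 2 * \<eta> * real n" by simp
  qed
  also have "\<dots> \<le> 2 * \<eta> * real (p ^ 4) * (?K / real (p ^ 4)) + (\<Sum>n\<in>{M<..<p^4}. 2 * \<eta> * real n * (?K / (real n)\<^sup>2))"
  proof (intro add_mono mult_left_mono sum_mono)
    have "norm (?h (p ^ 4)) \<le> exp (4 * R) / real (p ^ 4)"
      by (rule norm_twist_le[OF ln_p_ge _ _ \<kappa> assms(1)]) (use p_gt_1 in auto)
    also have "\<dots> \<le> ?K / real (p ^ 4)" using K by (intro divide_right_mono) auto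
    finally show "norm (?h (p ^ 4)) \<le> ?K / real (p ^ 4)" .
    fix n assume "n \<in> {M<..<p^4}"
    then show "norm (?h n - ?h (Suc n)) \<le> ?K / (real n)\<^sup>2"
      by (intro norm_twist_diff_le[OF ln_p_ge _ _ \<kappa> assms(1)]) auto
  qed (use \<eta> in auto)
  also have "(\<Sum>n\<in>{M<..<p^4}. 2 * \<eta> * real n * (?K / (real n)\<^sup>2)) = 2 * \<eta> * ?K * (\<Sum>n\<in>{M<..<p^4}. 1 / real n)"
    by (simp add: sum_distrib_left power2_eq_square mult.assoc)
  also have "\<dots> \<le> 2 * \<eta> * ?K * (5 * L)"
  proof (rule mult_left_mono)
    have "(\<Sum>n\<in>{M<..<p^4}. 1 / real n) \<le> (\<Sum>n=1..p^4. 1 / real n)" by (intro sum_mono2) auto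
    then show "(\<Sum>n\<in>{M<..<p^4}. 1 / real n) \<le> 5 * L" using inverse_le by (simp add: L_def)
  qed (use K0 \<eta> in auto)
  finally have "norm (\<Sum>m\<in>{M<..p^4}. mangoldt m * \<xi> m * ?h m) \<le>
      2 * \<eta> * real (p ^ 4) * (?K / real (p ^ 4)) + 2 * \<eta> * ?K * (5 * L)" by simp
  moreover have "2 * \<eta> * real (p ^ 4) * (?K / real (p ^ 4)) = 2 * \<eta> * ?K" using p_gt_1 by simp
  moreover have "2 * \<eta> * ?K \<le> 2 * \<eta> * ?K * L" using L K0 \<eta> mult_left_mono[of 1 L "2 * \<eta> * ?K"] by simp
  ultimately have "norm (\<Sum>m\<in>{M<..p^4}. mangoldt m * \<xi> m * ?h m) \<le> 2 * \<eta> * ?K * L + 2 * \<eta> * ?K * (5 * L)"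
    by linarith
  then show ?thesis by (simp add: g_def mult_ac)
qed

lemma norm_weighted_sum_le:
  assumes "norm w \<le> R" "\<And>n. n \<in> {1..p^4} \<Longrightarrow> norm (f n) \<le> c * mangoldt n" "c \<ge> 0"
  shows "norm (\<Sum>n=1..p^4. f n * g w n) \<le> c * exp (4 * R) * (5 * L)"
proof -
  have "norm (\<Sum>n=1..p^4. f n * g w n) \<le> (\<Sum>n=1..p^4. (c * exp (4 * R)) * (mangoldt n / real n))"
  proof (rule sum_norm_le)
    fix n assume n: "n \<in> {1..p^4}"
    have "norm (f n * g w n) \<le> (c * mangoldt n) * (exp (4 * R) / real n)"
      unfolding norm_mult using assms(2)[OF n] norm_g_le[OF assms(1) n] by (intro mult_mono) (auto simp: assms(3))
    then show "norm (f n * g w n) \<le> (c * exp (4 * R)) * (mangoldt n / real n)" by (simp add: mult_ac)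
  qed
  also have "\<dots> = c * exp (4 * R) * (\<Sum>n=1..p^4. mangoldt n / real n)" by (simp add: sum_distrib_left)
  also have "\<dots> \<le> c * exp (4 * R) * (5 * L)"
    using mangoldt_le assms(3) by (intro mult_left_mono) (auto simp: L_def)
  finally show ?thesis .
qed

lemma norm_A_le:
  assumes "norm w \<le> R"
  shows "norm (A w) \<le> 5 * exp (4 * R)"
proof -
  have "norm (\<Sum>n=1..p^4. g w n) \<le> (\<Sum>n=1..p^4. exp (4 * R) * (1 / real n))"
    by (rule sum_norm_le) (use norm_g_le[OF assms] in auto)
  also have "\<dots> = exp (4 * R) * (\<Sum>n=1..p^4. 1 / real n)" by (simp add: sum_distrib_left)
  also have "\<dots> \<le> exp (4 * R) * (5 * L)" using inverse_le by (intro mult_left_mono) (auto simp: L_def)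
  finally show ?thesis using L by (simp add: A_def norm_divide pos_divide_le_eq mult_ac)
qed

text \<open>\<open>\<Sum>\<xi>(n)/n\<^sup>s\<close> and \<open>\<Sum>\<Lambda>(n)\<xi>(n)/n\<^sup>s\<close>, both truncated at \<open>y = p^4\<close>, satisfy \<open>A' = - A B\<close> up to the
  terms \<open>d m > y\<close>.  There \<open>d \<le> p^2\<close> forces \<open>m \<ge> p^2\<close>, so \<open>\<xi>\<close> cancels in the sum over \<open>m\<close>;
  otherwise \<open>\<Lambda>\<xi>\<close> cancels in the sum over \<open>d\<close>.\<close>

lemma norm_logderiv_error_le:
  assumes "norm w \<le> R"
  shows "norm (A' w + A w * B w) \<le> (twist_lip \<kappa> R)\<^sup>2 * (20 / real p + 60 * \<eta>)"
proof -
  let ?y = "p ^ 4" and ?K = "twist_lip \<kappa> R"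
  have R: "R \<ge> 0" using assms(1) norm_ge_zero[of w] by linarith
  have K: "exp (4 * R) \<le> ?K" using twist_lip_ge[OF \<kappa> R] .
  then have K0: "?K \<ge> 0" using exp_ge_zero[of "4 * R"] by linarith
  have gm: "g w (m * n) = g w m * g w n" if "m > 0" "n > 0" for m n
    using that by (simp add: g_def char_mult[OF \<xi>] twist_mult)
  have pp: "p ^ 2 * p ^ 2 = ?y" by (simp flip: power_add)
  have AB: "A w * B w = (\<Sum>d=1..?y. \<Sum>m=1..?y. mangoldt d * g w d * g w m) / of_real (L ^ 2)"
    unfolding A_def B_def by (simp add: sum_product power2_eq_square mult_ac) (subst sum.swap, simp add: mult_ac)
  have A'_eq: "A' w = - (\<Sum>d=1..?y. \<Sum>m\<in>{m\<in>{1..?y}. d * m \<le> ?y}. mangoldt d * g w d * g w m) / of_real (L ^ 2)"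
  proof -
    have "(\<Sum>n=1..?y. of_real (v n) * g w n) = (\<Sum>n=1..?y. of_real (ln (real n)) * g w n) / of_real L"
      by (simp add: v_def sum_divide_distrib)
    then show ?thesis unfolding A'_def
      using sum_ln_eq_sum_mangoldt_pairs[of "g w" ?y, OF gm] by (simp add: power2_eq_square)
  qed
  have split: "(\<Sum>m=1..?y. mangoldt d * g w d * g w m) =
      (\<Sum>m\<in>{m\<in>{1..?y}. d * m \<le> ?y}. mangoldt d * g w d * g w m) +
      (\<Sum>m\<in>{m\<in>{1..?y}. d * m > ?y}. mangoldt d * g w d * g w m)" for d
    by (subst sum.union_disjoint[symmetric]) (auto intro!: sum.cong)
  define S where "S = (\<Sum>d=1..p^2. \<Sum>m\<in>{m\<in>{1..?y}. d * m > ?y}. mangoldt d * g w d * g w m)"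
  define T where "T = (\<Sum>d\<in>{p^2<..?y}. \<Sum>m\<in>{m\<in>{1..?y}. d * m > ?y}. mangoldt d * g w d * g w m)"
  have "A' w + A w * B w = (\<Sum>d=1..?y. \<Sum>m\<in>{m\<in>{1..?y}. d * m > ?y}. mangoldt d * g w d * g w m) / of_real (L ^ 2)"
    unfolding AB A'_eq split by (simp add: sum.distrib add_divide_distrib)
  also have "(\<Sum>d=1..?y. \<Sum>m\<in>{m\<in>{1..?y}. d * m > ?y}. mangoldt d * g w d * g w m) = S + T"
  proof -
    have "p ^ 2 \<le> ?y" using p_gt_1 by (intro power_increasing) auto
    then have eq: "{1..?y} = {1..p^2} \<union> {p^2<..?y}" by auto
    show ?thesis unfolding S_def T_def by (subst (1) eq, rule sum.union_disjoint) auto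
  qed
  finally have "norm (A' w + A w * B w) \<le> (norm S + norm T) / L ^ 2"
    by (simp only: norm_divide norm_of_real abs_of_nonneg[OF zero_le_power2])
      (rule divide_right_mono[OF norm_triangle_ineq], simp)
  moreover have "norm S \<le> ?K * (5 * L) * (4 * ?K / real p)"
  proof -
    have "norm S \<le> (\<Sum>d=1..p^2. ?K * (mangoldt d / real d) * (4 * ?K / real p))"
      unfolding S_def
    proof (rule sum_norm_le)
      fix d assume d: "d \<in> {1..p^2}"
      have "p ^ 2 \<le> ?y" using p_gt_1 by (intro power_increasing) auto
      then have dy: "d \<in> {1..?y}" using d by auto
      have "d * p ^ 2 \<le> ?y" unfolding pp[symmetric] using d by (intro mult_le_mono) auto
      then have M: "p ^ 2 \<le> ?y div d" using d by (simp add: less_eq_div_iff_mult_less_eq mult.commute)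
      have "{m\<in>{1..?y}. d * m > ?y} = {?y div d<..?y}"
        using d by (auto simp: div_less_iff_less_mult mult.commute Suc_le_eq intro!: Nat.gr0I)
      then have "(\<Sum>m\<in>{m\<in>{1..?y}. d * m > ?y}. mangoldt d * g w d * g w m) =
          mangoldt d * g w d * (\<Sum>m\<in>{?y div d<..?y}. g w m)"
        by (simp add: sum_distrib_left)
      also have "norm \<dots> \<le> ?K * (mangoldt d / real d) * (4 * ?K / real p)"
        unfolding norm_mult[of "mangoldt d * g w d"]
      proof (rule mult_mono)
        have "norm (mangoldt d * g w d) \<le> mangoldt d * (exp (4 * R) / real d)"
          unfolding norm_mult norm_mangoldt using norm_g_le[OF assms dy] by (intro mult_left_mono) auto
        also have "\<dots> \<le> mangoldt d * (?K / real d)" using K by (intro mult_left_mono divide_right_mono) auto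
        finally show "norm (mangoldt d * g w d) \<le> ?K * (mangoldt d / real d)" by (simp add: mult_ac)
        show "norm (\<Sum>m\<in>{?y div d<..?y}. g w m) \<le> 4 * ?K / real p"
          by (rule norm_char_tail_le[OF assms M]) simp
      qed (use K0 in auto)
      finally show "norm (\<Sum>m\<in>{m\<in>{1..?y}. d * m > ?y}. mangoldt d * g w d * g w m) \<le>
          ?K * (mangoldt d / real d) * (4 * ?K / real p)" .
    qed
    also have "\<dots> = ?K * (\<Sum>d=1..p^2. mangoldt d / real d) * (4 * ?K / real p)"
      by (simp only: sum_distrib_left sum_distrib_right)
    also have "\<dots> \<le> ?K * (5 * L) * (4 * ?K / real p)"
    proof (intro mult_right_mono mult_left_mono)
      have "(\<Sum>d=1..p^2. mangoldt d / real d) \<le> (\<Sum>n=1..?y. mangoldt n / real n)"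
        using p_gt_1 power_increasing[of 2 4 p] by (intro sum_mono2) auto
      then show "(\<Sum>d=1..p^2. mangoldt d / real d) \<le> 5 * L" using mangoldt_le by (simp add: L_def)
    qed (use K0 in auto)
    finally show ?thesis .
  qed
  moreover have "norm T \<le> ?K * (5 * L) * (12 * \<eta> * ?K * L)"
  proof -
    have p24: "p ^ 2 \<le> ?y" using p_gt_1 by (intro power_increasing) auto
    have "T = (\<Sum>d\<in>{p^2<..?y}. \<Sum>m=1..?y. if d * m > ?y then mangoldt d * g w d * g w m else 0)"
      unfolding T_def by (rule sum.cong[OF refl], rule sum.mono_neutral_cong_left) auto
    also have "\<dots> = (\<Sum>m=1..?y. \<Sum>d\<in>{p^2<..?y}. if d * m > ?y then mangoldt d * g w d * g w m else 0)"
      by (rule sum.swap)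
    also have "norm \<dots> \<le> (\<Sum>m=1..?y. ?K * (1 / real m) * (12 * \<eta> * ?K * L))"
    proof (rule sum_norm_le)
      fix m assume m: "m \<in> {1..?y}"
      \<comment> \<open>Both lower bounds on \<open>d\<close>, namely \<open>p^2\<close> and
        \<open>?y / m\<close>, hold beyond \<open>?M\<close>, so a single tail estimate
        applies.\<close>
      let ?M = "max (p ^ 2) (?y div m)"
      have M: "p ^ 2 \<le> ?M" "?M \<le> ?y" using p24 by auto
      have "{d\<in>{p^2<..?y}. d * m > ?y} = {?M<..?y}"
        using m by (auto simp: div_less_iff_less_mult)
      moreover have "(\<Sum>d\<in>{p^2<..?y}. if d * m > ?y then mangoldt d * g w d * g w m else 0) =
          (\<Sum>d\<in>{d\<in>{p^2<..?y}. d * m > ?y}. mangoldt d * g w d * g w m)"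
        by (intro sum.mono_neutral_cong_right) auto
      ultimately have "(\<Sum>d\<in>{p^2<..?y}. if d * m > ?y then mangoldt d * g w d * g w m else 0) =
          g w m * (\<Sum>d\<in>{?M<..?y}. mangoldt d * g w d)"
        by (simp add: sum_distrib_left mult_ac)
      also have "norm \<dots> \<le> ?K * (1 / real m) * (12 * \<eta> * ?K * L)"
        unfolding norm_mult
      proof (rule mult_mono)
        have "norm (g w m) \<le> exp (4 * R) / real m" by (rule norm_g_le[OF assms m])
        also have "\<dots> \<le> ?K / real m" using K by (intro divide_right_mono) auto
        finally show "norm (g w m) \<le> ?K * (1 / real m)" by simp
        show "norm (\<Sum>d\<in>{?M<..?y}. mangoldt d * g w d) \<le> 12 * \<eta> * ?K * L"
          by (rule norm_mangoldt_tail_le[OF assms M])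
      qed (use K0 in auto)
      finally show "norm (\<Sum>d\<in>{p^2<..?y}. if d * m > ?y then mangoldt d * g w d * g w m else 0)
          \<le> ?K * (1 / real m) * (12 * \<eta> * ?K * L)" .
    qed
    also have "\<dots> = ?K * (\<Sum>m=1..?y. 1 / real m) * (12 * \<eta> * ?K * L)"
      by (simp only: sum_distrib_left sum_distrib_right)
    also have "\<dots> \<le> ?K * (5 * L) * (12 * \<eta> * ?K * L)"
      using K0 \<eta> L inverse_le by (intro mult_right_mono mult_left_mono) (auto simp: L_def)
    finally show ?thesis .
  qed
  ultimately have "norm (A' w + A w * B w) \<le>
      (?K * (5 * L) * (4 * ?K / real p) + ?K * (5 * L) * (12 * \<eta> * ?K * L)) / L ^ 2"
    by (meson add_mono divide_right_mono order_trans zero_le_power2)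
  also have "\<dots> = ?K\<^sup>2 * (20 / real p * (1 / L) + 60 * \<eta>)"
    using L p_gt_1 by (simp add: field_simps power2_eq_square)
  also have "\<dots> \<le> ?K\<^sup>2 * (20 / real p * 1 + 60 * \<eta>)"
    using L by (intro mult_left_mono add_mono) auto
  finally show ?thesis by simp
qed

end

section \<open>The logarithm and its moments\<close>

context twisted_char_sums
begin

lemma has_field_derivative_g [derivative_intros]:
  "((\<lambda>w. g w n) has_field_derivative (- of_real (v n) * g w n)) (at w within S)"
proof -
  have "((\<lambda>w. g 0 n * exp (- w * of_real (v n))) has_field_derivative
      (- of_real (v n) * (g 0 n * exp (- w * of_real (v n))))) (at w within S)"
    by (rule derivative_eq_intros refl)+ (simp add: mult_ac)
  then show ?thesis by (simp only: g_eq[symmetric])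
qed

lemma has_field_derivative_A: "(A has_field_derivative A' w) (at w within S)"
  unfolding A_def[abs_def] A'_def
  by (rule DERIV_cong[OF DERIV_cdivide[OF DERIV_sum[OF has_field_derivative_g]]])
    (simp add: sum_negf)

lemma has_field_derivative_H: "(H has_field_derivative B w) (at w within S)"
proof -
  let ?f = "\<lambda>n w. mangoldt n * g 0 n * ((1 - exp (- w * of_real (v n))) / of_real (v n))"
  have "(?f n has_field_derivative mangoldt n * g w n) (at w within S)" if "n \<in> {1..p^4}" for n
  proof (cases "v n = 0")
    case True
    then have "n = 1" using that L p_gt_1 by (auto simp: v_def ln_eq_zero_iff)
    then show ?thesis by simp
  next
    case False
    then have "(?f n has_field_derivative mangoldt n * (g 0 n * exp (- w * of_real (v n)))) (at w within S)"
      by (auto intro!: derivative_eq_intros simp: field_simps)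
    then show ?thesis by (simp only: g_eq[symmetric])
  qed
  then show ?thesis unfolding H_def[abs_def] B_def
    by (intro DERIV_cdivide DERIV_sum)
qed

lemma H_0 [simp]: "H 0 = 0" by (simp add: H_def)

text \<open>Too weak for Borel--Caratheodory, where linear growth in \<open>R\<close> is wanted. It
  only bounds the factor \<open>exp (H z)\<close> in the error term, for which small
  \<open>\<eta>\<close> and large \<open>p\<close> compensate.\<close>

lemma norm_H_le:
  assumes "norm w \<le> R"
  shows "norm (H w) \<le> 5 * (R * exp (4 * R))"
proof -
  have R: "R \<ge> 0" using assms norm_ge_zero[of w] by linarith
  define f where "f n = mangoldt n * ((1 - exp (- w * of_real (v n))) / of_real (v n))" for n
  have "norm (\<Sum>n=1..p^4. f n * g 0 n) \<le> (R * exp (4 * R)) * exp (4 * 0) * (5 * L)"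
  proof (rule norm_weighted_sum_le)
    fix n assume n: "n \<in> {1..p^4}"
    have "norm ((1 - exp (- w * of_real (v n))) / of_real (v n)) \<le> R * exp (4 * R)"
    proof (cases "v n = 0")
      case False
      then have v: "v n > 0" using v_bounds(1)[OF n] by simp
      have 1: "norm (- w * of_real (v n)) \<le> R * v n"
        using assms v by (auto simp: norm_mult intro!: mult_right_mono)
      also have "\<dots> \<le> R * 4" using v_bounds(2)[OF n] R by (intro mult_left_mono)
      finally have 2: "norm (- w * of_real (v n)) \<le> 4 * R" by simp
      have "norm (exp (- w * of_real (v n)) - 1) \<le> norm (- w * of_real (v n)) * exp (norm (- w * of_real (v n)))"
        by (rule norm_exp_diff_one_le)
      also have "\<dots> \<le> (R * v n) * exp (4 * R)" using 1 2 R v by (intro mult_mono) auto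
      finally show ?thesis using v by (simp add: norm_divide pos_divide_le_eq norm_minus_commute mult_ac)
    qed (use R in simp)
    then show "norm (f n) \<le> R * exp (4 * R) * mangoldt n"
      unfolding f_def norm_mult norm_mangoldt by (simp add: mult_left_mono mult.commute)
  qed (use R in auto)
  also have "(\<Sum>n=1..p^4. f n * g 0 n) = H w * of_real L"
    using L by (simp add: H_def f_def mult_ac)
  finally show ?thesis using L by (simp add: norm_mult)
qed

text \<open>\<open>H\<close> is a logarithm of \<open>A 0 / A w\<close> up to a small error, and \<open>A\<close> has at most exponential growth; so
  \<open>- Re H\<close> has at most linear growth.\<close>

lemma Re_H_ge:
  assumes "norm w \<le> R" "a > 0" "a \<le> norm (A 0)"
    and small: "(twist_lip \<kappa> R)\<^sup>2 * (20 / real p + 60 * \<eta>) * exp (5 * (R * exp (4 * R))) * R \<le> a / 2"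
  shows "Re (- H w) \<le> 4 * R + ln (10 / a)"
proof -
  let ?E = "(twist_lip \<kappa> R)\<^sup>2 * (20 / real p + 60 * \<eta>) * exp (5 * (R * exp (4 * R)))"
  have R: "R \<ge> 0" using assms(1) norm_ge_zero[of w] by linarith
  \<comment> \<open>The derivative of \<open>A * exp H\<close> is
    \<open>(A' + A * B) * exp H\<close>, which is small, so the product stays within
    \<open>a / 2\<close> of its value \<open>A 0\<close> at the origin.\<close>
  have "norm (A w * exp (H w) - A 0 * exp (H 0)) \<le> ?E * norm (w - 0)"
  proof (rule field_differentiable_bound[where S = "cball 0 R" and f' = "\<lambda>z. (A' z + A z * B z) * exp (H z)"])
    fix z :: complex assume "z \<in> cball 0 R"
    then have z: "norm z \<le> R" by simp
    show "((\<lambda>z. A z * exp (H z)) has_field_derivative (A' z + A z * B z) * exp (H z)) (at z within cball 0 R)"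
      by (rule derivative_eq_intros has_field_derivative_A has_field_derivative_H refl)+ (simp add: algebra_simps)
    have "norm (exp (H z)) \<le> exp (5 * (R * exp (4 * R)))"
      using norm_H_le[OF z] complex_Re_le_cmod[of "H z"] by simp
    then show "norm ((A' z + A z * B z) * exp (H z)) \<le> ?E"
      unfolding norm_mult using norm_logderiv_error_le[OF z] \<eta>
      by (intro mult_mono) auto
  qed (use assms R in auto)
  also have "\<dots> \<le> ?E * R" using assms(1) \<eta> by (intro mult_left_mono) auto
  finally have "norm (A w * exp (H w) - A 0) \<le> ?E * R" by simp
  then have "norm (A w * exp (H w) - A 0) \<le> a / 2" using small by (rule order_trans)
  then have "a / 2 \<le> norm (A w * exp (H w))"
    using assms(3) norm_triangle_ineq2[of "A 0" "A w * exp (H w)"] by (simp add: norm_minus_commute)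
  also have "\<dots> \<le> 5 * exp (4 * R) * exp (Re (H w))"
    unfolding norm_mult using norm_A_le[OF assms(1)] by (intro mult_mono) auto
  finally have "a / 10 \<le> exp (4 * R + Re (H w))" by (simp add: exp_add)
  then have "ln (a / 10) \<le> 4 * R + Re (H w)" using assms(2) ln_mono[of "a / 10"] by fastforce
  moreover have "ln (a / 10) = - ln (10 / a)" using assms(2) by (simp add: ln_div)
  ultimately show ?thesis by simp
qed

text \<open>Up to sign the \<open>j\<close>-th moment is the derivative of order
  \<open>j + 1\<close> of \<open>- H\<close> at 0. Cauchy's inequality on the disc of radius
  \<open>R / 2\<close> applies to a bound that is linear in \<open>R\<close>.\<close>

lemma norm_moment_le:
  assumes "R > 0" "a > 0" "a \<le> norm (A 0)"
    and small: "(twist_lip \<kappa> R)\<^sup>2 * (20 / real p + 60 * \<eta>) * exp (5 * (R * exp (4 * R))) * R \<le> a / 2"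
  shows "norm ((\<Sum>n=1..p^4. mangoldt n * g 0 n * of_real (v n ^ j)) / of_real L)
           \<le> fact (Suc j) * (2 * (4 * R + ln (10 / a) + 1)) / (R / 2) ^ Suc j"
proof -
  define F where "F w = - H w" for w
  have derF: "(F has_field_derivative - B w) (at w within S)" for w S
    unfolding F_def by (intro derivative_intros has_field_derivative_H)
  have holF: "F holomorphic_on S" for S
    unfolding holomorphic_on_def field_differentiable_def using derF by blast
  have bound: "norm (F w) \<le> 2 * (4 * R + ln (10 / a) + 1)" if "norm w \<le> R / 2" for w
  proof (rule borel_caratheodory_half_disc[OF holF _ _ assms(1) that])
    \<comment> \<open>The extra 1 supplies the strict inequality that Borel--Caratheodory asks
      for.\<close>
    show "Re (F w) < 4 * R + ln (10 / a) + 1" if "w \<in> ball 0 R" for w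
      using Re_H_ge[of w R a, OF _ assms(2,3) small] that by (simp add: F_def)
  qed (simp add: F_def)
  have derivs: "(deriv ^^ Suc i) F = (\<lambda>w. (\<Sum>n=1..p^4. (-1) ^ Suc i * of_real (v n ^ i) * (mangoldt n * g w n)) / of_real L)" for i
  proof (induction i)
    case 0
    have "deriv F = (\<lambda>w. - B w)" using derF by (auto intro!: ext DERIV_imp_deriv)
    then show ?case by (simp add: B_def sum_negf)
  next
    case (Suc i)
    have "deriv ((deriv ^^ Suc i) F) w =
        (\<Sum>n=1..p^4. (-1) ^ Suc (Suc i) * of_real (v n ^ Suc i) * (mangoldt n * g w n)) / of_real L" for w
    proof -
      let ?c = "\<lambda>i n. (-1) ^ Suc i * of_real (v n ^ i) :: complex"
      have "((\<lambda>w. ?c i n * (mangoldt n * g w n)) has_field_derivative ?c (Suc i) n * (mangoldt n * g w n)) (at w)" for n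
        by (rule derivative_eq_intros refl)+ (simp add: mult_ac)
      then have "((\<lambda>w. (\<Sum>n=1..p^4. ?c i n * (mangoldt n * g w n)) / of_real L) has_field_derivative
          (\<Sum>n=1..p^4. ?c (Suc i) n * (mangoldt n * g w n)) / of_real L) (at w)"
        by (intro DERIV_cdivide DERIV_sum)
      then show ?thesis unfolding Suc.IH by (rule DERIV_imp_deriv)
    qed
    then show ?case by (simp only: funpow.simps o_def)
  qed
  have "norm ((deriv ^^ Suc j) F 0) \<le> fact (Suc j) * (2 * (4 * R + ln (10 / a) + 1)) / (R / 2) ^ Suc j"
    by (rule Cauchy_inequality)
      (use holF bound assms(1) in \<open>auto intro: holomorphic_on_imp_continuous_on\<close>)
  moreover have "(deriv ^^ Suc j) F 0 = (-1) ^ Suc j * ((\<Sum>n=1..p^4. mangoldt n * g 0 n * of_real (v n ^ j)) / of_real L)"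
    unfolding derivs by (simp add: sum_distrib_left sum_divide_distrib mult_ac)
  ultimately show ?thesis by (simp only: norm_mult norm_power norm_minus_cancel norm_one power_one mult_1_left)
qed

end

section \<open>Lower bounds from the range where \<xi> = 1\<close>

context twisted_char_sums
begin

definition t :: "nat \<Rightarrow> real" where "t n = exp (- \<kappa> * v n)"

lemma g_0_eq: "g 0 n = \<xi> n * of_real (t n / real n)"
  unfolding g_def twist_def t_def v_def L_def by (simp flip: exp_of_real)

lemma t_pos: "t n > 0" by (simp add: t_def)

lemma t_le_1: "n \<in> {1..p^4} \<Longrightarrow> t n \<le> 1"
  using v_bounds[of n] \<kappa> by (simp add: t_def)

text \<open>\<open>t n\<close> is \<open>n\<close> to the power \<open>- \<kappa> / L\<close>, with
  slope \<open>- \<kappa> / L * (t n / n)\<close>. One step of \<open>t\<close> is compared with the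
  slope at either end, so that sums of \<open>t n / n\<close> telescope.\<close>

lemma t_Suc:
  assumes "n > 0"
  shows "t n - t (Suc n) \<le> \<kappa> / L * (t n / real n)"
    and "\<kappa> / L * (t (Suc n) / real (Suc n)) \<le> t n - t (Suc n)"
proof -
  define \<delta> where "\<delta> = ln (real (Suc n)) - ln (real n)"
  have \<delta>_eq: "\<delta> = ln (1 + 1 / real n)"
  proof -
    have "1 + 1 / real n = real (Suc n) / real n" using assms by (simp add: field_simps)
    then show ?thesis using assms by (simp add: \<delta>_def ln_div)
  qed
  have \<delta>: "\<delta> \<le> 1 / real n" unfolding \<delta>_eq using assms by (simp add: ln_add_one_self_le_self)
  have \<delta>2: "1 / real (Suc n) \<le> \<delta>"
  proof -
    have "ln (real n / real (Suc n)) \<le> real n / real (Suc n) - 1"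
      using assms by (intro ln_le_minus_one) auto
    moreover have "ln (real n / real (Suc n)) = - \<delta>" using assms by (simp add: \<delta>_def ln_div)
    moreover have "real n / real (Suc n) - 1 = - (1 / real (Suc n))" by (simp add: field_simps)
    ultimately show ?thesis by linarith
  qed
  have vS: "v (Suc n) = v n + \<delta> / L" by (simp add: v_def \<delta>_def diff_divide_distrib)
  have a0: "\<kappa> / L \<ge> 0" using \<kappa> L by simp
  have tS: "t (Suc n) = t n * exp (- (\<kappa> / L * \<delta>))"
    unfolding t_def vS exp_add[symmetric] by (simp add: algebra_simps)
  have "t n - t (Suc n) = t n * (1 - exp (- (\<kappa> / L * \<delta>)))" by (simp add: tS algebra_simps)
  also have "\<dots> \<le> t n * (\<kappa> / L * \<delta>)"
    using exp_ge_add_one_self[of "- (\<kappa> / L * \<delta>)"] t_pos[of n] by (intro mult_left_mono) auto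
  also have "\<dots> \<le> t n * (\<kappa> / L * (1 / real n))"
    using \<delta> t_pos[of n] a0 by (intro mult_left_mono) auto
  finally show "t n - t (Suc n) \<le> \<kappa> / L * (t n / real n)" by (simp add: mult_ac)
  have "t n = t (Suc n) * exp (\<kappa> / L * \<delta>)" by (simp add: tS exp_minus)
  then have "t n - t (Suc n) = t (Suc n) * (exp (\<kappa> / L * \<delta>) - 1)" by (simp add: algebra_simps)
  also have "\<dots> \<ge> t (Suc n) * (\<kappa> / L * \<delta>)"
  proof (rule mult_left_mono)
    show "\<kappa> / L * \<delta> \<le> exp (\<kappa> / L * \<delta>) - 1" using exp_ge_add_one_self[of "\<kappa> / L * \<delta>"] by linarith
  qed (use t_pos[of "Suc n"] in simp)
  moreover have "t (Suc n) * (\<kappa> / L * (1 / real (Suc n))) \<le> t (Suc n) * (\<kappa> / L * \<delta>)"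
    using \<delta>2 t_pos[of "Suc n"] a0 by (intro mult_left_mono) auto
  ultimately show "\<kappa> / L * (t (Suc n) / real (Suc n)) \<le> t n - t (Suc n)" by (simp add: mult_ac)
qed

lemma sum_t_lower: "\<kappa> / L * (\<Sum>n=1..N. t n / real n) \<ge> 1 - t (Suc N)"
proof (induction N)
  case 0
  then show ?case by (simp add: t_def v_def)
next
  case (Suc N)
  then show ?case using t_Suc(1)[of "Suc N"] by (simp add: distrib_left)
qed

lemma sum_t_upper:
  assumes "0 < M" "M \<le> N"
  shows "\<kappa> / L * (\<Sum>n\<in>{M<..N}. t n / real n) \<le> t M - t N"
  using assms(2)
proof (induction N rule: dec_induct)
  case (step n)
  have "{M<..Suc n} = insert (Suc n) {M<..n}" using step.hyps by auto
  then show ?case using step.IH t_Suc(2)[of n] assms(1) step.hyps by (simp add: distrib_left del: of_nat_Suc)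
qed simp

lemma v_ge:
  assumes "real p powr c \<le> real n" "n > 0"
  shows "c \<le> v n"
proof -
  have "ln (real p powr c) \<le> ln (real n)" using assms p_gt_1 by (intro ln_mono) auto
  then have "c * L \<le> ln (real n)" using p_gt_1 by (simp add: L_def ln_powr)
  then show ?thesis using L by (simp add: v_def pos_le_divide_eq)
qed

lemma v_le:
  assumes "real n \<le> real p powr c" "n > 0"
  shows "v n \<le> c"
proof -
  have "ln (real n) \<le> ln (real p powr c)" using assms p_gt_1 by (intro ln_mono) auto
  then have "ln (real n) \<le> c * L" using p_gt_1 by (simp add: L_def ln_powr)
  then show ?thesis using L by (simp add: v_def pos_divide_le_eq)
qed

lemma floor_power_bounds:
  assumes "0 \<le> c" "c \<le> 4"
  defines "X \<equiv> nat \<lfloor>real p powr c\<rfloor>"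
  shows "1 \<le> X" "X \<le> p ^ 4" "real X \<le> real p powr c" "real p powr c < real X + 1"
    "real p powr c / 2 \<le> real X"
proof -
  have ge1: "real p powr c \<ge> 1" using p_gt_1 assms(1) by (simp add: ge_one_powr_ge_zero)
  then have "real X = of_int \<lfloor>real p powr c\<rfloor>" by (simp add: X_def)
  moreover have "of_int \<lfloor>real p powr c\<rfloor> \<ge> (1::real)" using ge1 by simp
  ultimately show 1: "1 \<le> X" "real X \<le> real p powr c" "real p powr c < real X + 1" by linarith+
  then show "real p powr c / 2 \<le> real X" by linarith
  have "real p powr c \<le> real p powr 4" using p_gt_1 assms(2) by (intro powr_mono) auto
  also have "\<dots> = real (p ^ 4)" using p_gt_1 by (simp add: powr_numeral)
  finally show "X \<le> p ^ 4" using 1(2) by (simp only: of_nat_le_iff[where 'a = real, symmetric])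
qed

text \<open>With \<open>\<kappa> * \<epsilon> = 3\<close>, the terms up to
  \<open>p powr \<epsilon>\<close> contribute at least \<open>1 - exp (- 3) \<ge> 7/8\<close> in
  units of \<open>L / \<kappa>\<close>, and the others at most
  \<open>2 * exp (- 3) \<le> 2/8\<close>, whatever the values of \<xi> there.\<close>

lemma norm_A_0_ge:
  assumes \<epsilon>: "0 < \<epsilon>" "\<epsilon> \<le> 4" and \<kappa>_def: "\<kappa> = 3 / \<epsilon>" and L\<kappa>: "\<kappa> \<le> L"
    and one: "\<And>n. 1 \<le> n \<Longrightarrow> real n \<le> real p powr \<epsilon> \<Longrightarrow> \<xi> n = 1"
  shows "\<epsilon> / 6 \<le> norm (A 0)"
proof -
  define X where "X = nat \<lfloor>real p powr \<epsilon>\<rfloor>"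
  have X: "1 \<le> X" "X \<le> p ^ 4" "real X \<le> real p powr \<epsilon>" "real p powr \<epsilon> < real X + 1"
    "real p powr \<epsilon> / 2 \<le> real X"
    using floor_power_bounds[of \<epsilon>] \<epsilon> unfolding X_def by auto
  have \<kappa>0: "\<kappa> > 0" "\<kappa> * \<epsilon> = 3" using \<epsilon> by (auto simp: \<kappa>_def)
  have e3: "exp (- 3) \<le> (1/8 :: real)"
  proof -
    have "(2::real) ^ 3 \<le> exp 1 ^ 3" using exp_ge_add_one_self[of 1] by (intro power_mono) auto
    then have "(8::real) \<le> exp 3" by (simp flip: exp_of_nat_mult)
    then show ?thesis by (simp add: exp_minus field_simps)
  qed
  have "t (Suc X) \<le> exp (- 3)"
  proof -
    have "\<epsilon> \<le> v (Suc X)" using X by (intro v_ge) auto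
    then have "\<kappa> * \<epsilon> \<le> \<kappa> * v (Suc X)" using \<kappa>0 by (intro mult_left_mono) auto
    then show ?thesis using \<kappa>0 by (simp add: t_def)
  qed
  then have 1: "\<kappa> / L * (\<Sum>n=1..X. t n / real n) \<ge> 7/8" using sum_t_lower[of X] e3 by linarith
  \<comment> \<open>Rounding \<open>p powr \<epsilon>\<close> down to \<open>X\<close> loses at most
    a factor 2, which costs \<open>exp (\<kappa> / L * ln 2) \<le> 2\<close> because
    \<open>\<kappa> \<le> L\<close>.\<close>
  have "t X \<le> exp (- 3) * 2"
  proof -
    have "\<epsilon> - ln 2 / L \<le> v X"
    proof (rule v_ge)
      have "real p powr (\<epsilon> - ln 2 / L) = real p powr \<epsilon> / 2"
      proof -
        have "real p powr (ln 2 / L) = 2" using p_gt_1 L by (simp add: powr_def L_def)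
        then show ?thesis by (simp add: powr_diff)
      qed
      then show "real p powr (\<epsilon> - ln 2 / L) \<le> real X" using X by simp
    qed (use X in auto)
    then have "\<kappa> * (\<epsilon> - ln 2 / L) \<le> \<kappa> * v X" using \<kappa>0 by (intro mult_left_mono) auto
    then have "- \<kappa> * v X \<le> - 3 + (\<kappa> / L) * ln 2" using \<kappa>0 by (simp add: right_diff_distrib)
    also have "\<dots> \<le> - 3 + 1 * ln 2" using L\<kappa> L by (intro add_left_mono mult_right_mono) auto
    finally have "t X \<le> exp (- 3 + ln 2)" by (simp add: t_def)
    also have "\<dots> = exp (- 3) * 2" by (subst exp_add) simp
    finally show ?thesis .
  qed
  then have 2: "\<kappa> / L * (\<Sum>n\<in>{X<..p^4}. t n / real n) \<le> 2/8"
    using sum_t_upper[of X "p^4"] X t_pos[of "p^4"] e3 by linarith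
  have eq: "{1..p^4} = {1..X} \<union> {X<..p^4}" using X by auto
  have "(\<Sum>n=1..p^4. g 0 n) = (\<Sum>n=1..X. g 0 n) + (\<Sum>n\<in>{X<..p^4}. g 0 n)"
    unfolding eq by (rule sum.union_disjoint) auto
  also have "(\<Sum>n=1..X. g 0 n) = of_real (\<Sum>n=1..X. t n / real n)"
    unfolding of_real_sum
  proof (rule sum.cong[OF refl])
    fix n assume "n \<in> {1..X}"
    then show "g 0 n = of_real (t n / real n)" using one[of n] X(3) by (simp add: g_0_eq)
  qed
  finally have sum_eq: "(\<Sum>n=1..p^4. g 0 n) = of_real (\<Sum>n=1..X. t n / real n) + (\<Sum>n\<in>{X<..p^4}. g 0 n)" .
  have "norm (\<Sum>n\<in>{X<..p^4}. g 0 n) \<le> (\<Sum>n\<in>{X<..p^4}. t n / real n)"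
  proof (rule sum_norm_le)
    fix n
    have "norm (g 0 n) \<le> 1 * (t n / real n)"
      unfolding g_0_eq norm_mult norm_of_real using char_norm_le_1[OF \<xi>] t_pos[of n]
      by (intro mult_mono) auto
    then show "norm (g 0 n) \<le> t n / real n" by simp
  qed
  moreover have "(\<Sum>n=1..X. t n / real n) = norm (of_real (\<Sum>n=1..X. t n / real n) :: complex)"
    using t_pos by (simp only: norm_of_real) (intro abs_of_nonneg[symmetric] sum_nonneg, simp add: less_imp_le)
  ultimately have "(\<Sum>n=1..X. t n / real n) - (\<Sum>n\<in>{X<..p^4}. t n / real n) \<le> norm (\<Sum>n=1..p^4. g 0 n)"
    unfolding sum_eq using norm_diff_ineq[of "of_real (\<Sum>n=1..X. t n / real n) :: complex" "\<Sum>n\<in>{X<..p^4}. g 0 n"]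
    by linarith
  then have "\<kappa> / L * ((\<Sum>n=1..X. t n / real n) - (\<Sum>n\<in>{X<..p^4}. t n / real n)) \<le> \<kappa> / L * norm (\<Sum>n=1..p^4. g 0 n)"
    using \<kappa> L by (intro mult_left_mono) auto
  then have "1/2 \<le> \<kappa> / L * norm (\<Sum>n=1..p^4. g 0 n)"
    using 1 2 unfolding right_diff_distrib by linarith
  then have "1/2 \<le> \<kappa> * norm (A 0)"
    using L by (simp add: A_def norm_divide)
  then have "\<epsilon> * (1/2) \<le> \<epsilon> * (\<kappa> * norm (A 0))" using \<epsilon> by (intro mult_left_mono) auto
  also have "\<dots> = 3 * norm (A 0)" using \<kappa>0 by (simp add: mult.assoc[symmetric] mult.commute)
  finally show ?thesis by simp
qed

text \<open>Up to \<open>p powr \<epsilon>\<close> all terms are nonnegative, so the window from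
  \<open>p powr (1/K)\<close> to \<open>p powr (2/K)\<close> may be kept alone. There the Mertens
  mass is at least \<open>L / (2 * K)\<close>, \<open>t n \<ge> 1/4\<close>, and the test function
  is at least \<open>1 / (2 * K)\<close>. Beyond \<open>p powr \<epsilon>\<close> it is at most
  \<open>4 * (1 - \<epsilon>/4) ^ K\<close>, against a mass of at most \<open>5 * L\<close>.\<close>

lemma norm_test_sum_ge:
  assumes \<epsilon>: "0 < \<epsilon>" "\<epsilon> \<le> 4" and \<kappa>_def: "\<kappa> = 3 / \<epsilon>" and K: "real K \<ge> 6 / \<epsilon>" "K \<ge> 1"
    and one: "\<And>n. 1 \<le> n \<Longrightarrow> real n \<le> real p powr \<epsilon> \<Longrightarrow> \<xi> n = 1"
    and mertens: "\<And>N. N > 0 \<Longrightarrow> \<bar>(\<Sum>n=1..N. mangoldt n / real n) - ln (real N)\<bar> \<le> C"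
    and LK: "L \<ge> 2 * real K * (2 * C + 1)"
  shows "norm ((\<Sum>n=1..p^4. mangoldt n * g 0 n * of_real (v n * (1 - v n / 4) ^ K)) / of_real L)
     \<ge> 1 / (16 * real K ^ 2) - 20 * (1 - \<epsilon> / 4) ^ K"
proof -
  define P where "P x = x * (1 - x / 4) ^ K" for x :: real
  define f where "f n = mangoldt n * (t n / real n) * P (v n)" for n
  define X where "X = nat \<lfloor>real p powr \<epsilon>\<rfloor>"
  have X: "1 \<le> X" "X \<le> p ^ 4" "real X \<le> real p powr \<epsilon>" "real p powr \<epsilon> < real X + 1"
    using floor_power_bounds[of \<epsilon>] \<epsilon> unfolding X_def by auto
  have Kpos: "real K > 0" using K by simp
  have Pnn: "P (v n) \<ge> 0" if "n \<in> {1..p^4}" for n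
    using v_bounds[OF that] by (simp add: P_def)
  have fnn: "f n \<ge> 0" if "n \<in> {1..p^4}" for n
    unfolding f_def using Pnn[OF that] t_pos[of n] by simp
  have eq: "{1..p^4} = {1..X} \<union> {X<..p^4}" using X by auto
  have summand: "mangoldt n * g 0 n * of_real (P (v n)) = \<xi> n * of_real (f n)" for n
    by (simp add: f_def g_0_eq)
  have "(\<Sum>n=1..p^4. \<xi> n * of_real (f n)) = (\<Sum>n=1..X. \<xi> n * of_real (f n)) + (\<Sum>n\<in>{X<..p^4}. \<xi> n * of_real (f n))"
    unfolding eq by (rule sum.union_disjoint) auto
  also have "(\<Sum>n=1..X. \<xi> n * of_real (f n)) = of_real (\<Sum>n=1..X. f n)"
    unfolding of_real_sum
  proof (rule sum.cong[OF refl])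
    fix n assume "n \<in> {1..X}"
    then show "\<xi> n * of_real (f n) = of_real (f n)" using one[of n] X(3) by simp
  qed
  finally have sum_eq: "(\<Sum>n=1..p^4. \<xi> n * of_real (f n)) = of_real (\<Sum>n=1..X. f n) + (\<Sum>n\<in>{X<..p^4}. \<xi> n * of_real (f n))" .
  have tail: "norm (\<Sum>n\<in>{X<..p^4}. \<xi> n * of_real (f n)) \<le> 20 * (1 - \<epsilon> / 4) ^ K * L"
  proof -
    have "norm (\<Sum>n\<in>{X<..p^4}. \<xi> n * of_real (f n)) \<le> (\<Sum>n\<in>{X<..p^4}. (4 * (1 - \<epsilon> / 4) ^ K) * (mangoldt n / real n))"
    proof (rule sum_norm_le)
      fix n assume n: "n \<in> {X<..p^4}"
      then have n': "n \<in> {1..p^4}" using X by auto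
      have vn: "\<epsilon> \<le> v n" using X(4) n by (intro v_ge) auto
      have "P (v n) \<le> 4 * (1 - \<epsilon> / 4) ^ K"
        unfolding P_def using vn v_bounds[OF n'] \<epsilon> by (intro mult_mono power_mono) auto
      then have "f n \<le> mangoldt n * (1 / real n) * (4 * (1 - \<epsilon> / 4) ^ K)"
        unfolding f_def using t_le_1[OF n'] t_pos[of n] Pnn[OF n'] by (intro mult_mono divide_right_mono) auto
      moreover have "norm (\<xi> n * of_real (f n)) \<le> 1 * f n"
        unfolding norm_mult norm_of_real using char_norm_le_1[OF \<xi>] fnn[OF n'] by (intro mult_mono) auto
      ultimately show "norm (\<xi> n * of_real (f n)) \<le> (4 * (1 - \<epsilon> / 4) ^ K) * (mangoldt n / real n)"
        by (simp add: mult_ac)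
    qed
    also have "\<dots> = (4 * (1 - \<epsilon> / 4) ^ K) * (\<Sum>n\<in>{X<..p^4}. mangoldt n / real n)"
      by (simp add: sum_distrib_left)
    also have "\<dots> \<le> (4 * (1 - \<epsilon> / 4) ^ K) * (5 * L)"
    proof (intro mult_left_mono)
      have "(\<Sum>n\<in>{X<..p^4}. mangoldt n / real n :: real) \<le> (\<Sum>n=1..p^4. mangoldt n / real n)"
        using X by (intro sum_mono2) auto
      then show "(\<Sum>n\<in>{X<..p^4}. mangoldt n / real n) \<le> 5 * L" using mangoldt_le by (simp add: L_def)
    qed (use \<epsilon> in auto)
    finally show ?thesis by (simp add: mult_ac)
  qed
  have main: "L / (16 * real K ^ 2) \<le> (\<Sum>n=1..X. f n)"
  proof -
    define N1 N2 where "N1 = nat \<lfloor>real p powr (1 / K)\<rfloor>" and "N2 = nat \<lfloor>real p powr (2 / K)\<rfloor>"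
    \<comment> \<open>\<open>K \<ge> 6 / \<epsilon>\<close> does two things: the window ends before
      \<open>p powr \<epsilon>\<close>, and inside it the damping exponent
      \<open>\<kappa> * v n\<close> is at most 1.\<close>
    have K\<epsilon>: "2 / real K \<le> \<epsilon>" "\<kappa> * (2 / real K) \<le> 1"
    proof -
      have "6 \<le> real K * \<epsilon>" using K \<epsilon> by (simp add: pos_divide_le_eq)
      then show "2 / real K \<le> \<epsilon>" "\<kappa> * (2 / real K) \<le> 1"
        using Kpos \<epsilon> by (auto simp: \<kappa>_def field_simps)
    qed
    have N1: "1 \<le> N1" "real N1 \<le> real p powr (1 / K)" "real p powr (1 / K) < real N1 + 1"
      using floor_power_bounds[of "1 / K"] K unfolding N1_def by (auto simp: field_simps)
    have N2: "1 \<le> N2" "real N2 \<le> real p powr (2 / K)" "real p powr (2 / K) / 2 \<le> real N2" "N2 \<le> p ^ 4"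
      using floor_power_bounds[of "2 / K"] K unfolding N2_def by (auto simp: field_simps)
    have N12: "N1 \<le> N2" unfolding N1_def N2_def using p_gt_1 Kpos
      by (intro nat_mono floor_mono powr_mono) (auto simp: divide_right_mono)
    have N2X: "N2 \<le> X" unfolding X_def N2_def using p_gt_1 K\<epsilon>
      by (intro nat_mono floor_mono powr_mono) auto
    have lnN1: "ln (real N1) \<le> L / K"
      using v_le[OF N1(2)] N1(1) L Kpos by (simp add: v_def field_simps)
    have lnN2: "2 * L / K - ln 2 \<le> ln (real N2)"
    proof -
      have "ln (real p powr (2 / K) / 2) \<le> ln (real N2)" using N2 p_gt_1 by (intro ln_mono) auto
      then show ?thesis using p_gt_1 by (simp add: ln_div ln_powr L_def)
    qed
    have eqN: "{1..N2} = {1..N1} \<union> {N1<..N2}" using N12 by auto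
    have "(\<Sum>n=1..N2. mangoldt n / real n :: real) = (\<Sum>n=1..N1. mangoldt n / real n) + (\<Sum>n\<in>{N1<..N2}. mangoldt n / real n)"
      unfolding eqN by (rule sum.union_disjoint) auto
    then have "(\<Sum>n\<in>{N1<..N2}. mangoldt n / real n) \<ge> 2 * L / K - ln 2 - L / K - 2 * C"
      using mertens[of N1] mertens[of N2] N1(1) N2(1) lnN1 lnN2 by linarith
    moreover have "L / (2 * K) \<ge> 2 * C + 1" using LK Kpos by (simp add: pos_le_divide_eq mult_ac)
    moreover have "2 * L / K - L / K = L / (2 * K) + L / (2 * K)" using Kpos by (simp add: field_simps)
    moreover have "ln 2 \<le> (1 :: real)" using ln_le_minus_one[of "2::real"] by simp
    ultimately have big: "L / (2 * K) \<le> (\<Sum>n\<in>{N1<..N2}. mangoldt n / real n)" by linarith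
    have "L / (2 * K) * (1 / (8 * K)) \<le> (\<Sum>n\<in>{N1<..N2}. mangoldt n / real n) * (1 / (8 * K))"
      using big by (intro mult_right_mono) auto
    also have "\<dots> = (\<Sum>n\<in>{N1<..N2}. mangoldt n * (1/4 / real n) * (1 / real K * (1/2)))"
      unfolding sum_distrib_right by (intro sum.cong) auto
    also have "\<dots> \<le> (\<Sum>n\<in>{N1<..N2}. f n)"
    proof (rule sum_mono)
      fix n assume n: "n \<in> {N1<..N2}"
      then have n': "n \<in> {1..p^4}" using N1 N2 by auto
      have v1: "1 / real K \<le> v n" using N1(3) n by (intro v_ge) auto
      have v2: "v n \<le> 2 / real K" using N2(2) n by (intro v_le) auto
      have "\<kappa> * v n \<le> \<kappa> * (2 / real K)" using v2 \<kappa> by (intro mult_left_mono)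
      then have "- 1 \<le> - \<kappa> * v n" using K\<epsilon> by simp
      then have "exp (- 1) \<le> t n" by (simp add: t_def)
      moreover have "exp (- 1 :: real) \<ge> 1/4" using exp_le by (simp add: exp_minus field_simps)
      ultimately have tn: "1/4 \<le> t n" by linarith
      have "1 + real K * (- (1 / (2 * real K))) \<le> (1 + (- (1 / (2 * real K)))) ^ K"
        using K(2) by (intro Bernoulli_inequality) (simp add: field_simps)
      then have "1/2 \<le> (1 - 1 / (2 * real K)) ^ K" using Kpos by simp
      also have "\<dots> \<le> (1 - v n / 4) ^ K" using v2 K(2) by (intro power_mono) (auto simp: field_simps)
      finally have "1 / real K * (1/2) \<le> P (v n)"
        unfolding P_def using v1 Kpos v_bounds[OF n'] by (intro mult_mono) auto
      then show "mangoldt n * (1/4 / real n) * (1 / real K * (1/2)) \<le> f n"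
        unfolding f_def using tn t_pos[of n] by (intro mult_mono divide_right_mono) auto
    qed
    also have "\<dots> \<le> (\<Sum>n=1..X. f n)"
      using N1 N2X X fnn by (intro sum_mono2) auto
    finally show ?thesis by (simp add: power2_eq_square)
  qed
  have nn: "(\<Sum>n=1..X. f n) \<ge> 0" using X fnn by (intro sum_nonneg) auto
  have "L / (16 * real K ^ 2) - 20 * (1 - \<epsilon> / 4) ^ K * L \<le> norm (\<Sum>n=1..p^4. \<xi> n * of_real (f n))"
    unfolding sum_eq
    using norm_diff_ineq[of "of_real (\<Sum>n=1..X. f n) :: complex" "\<Sum>n\<in>{X<..p^4}. \<xi> n * of_real (f n)"] main tail nn
    by (simp only: norm_of_real abs_of_nonneg)
  then have "(L / (16 * real K ^ 2) - 20 * (1 - \<epsilon> / 4) ^ K * L) / L \<le> norm (\<Sum>n=1..p^4. \<xi> n * of_real (f n)) / L"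
    using L by (intro divide_right_mono) auto
  moreover have "(L / (16 * real K ^ 2) - 20 * (1 - \<epsilon> / 4) ^ K * L) / L = 1 / (16 * real K ^ 2) - 20 * (1 - \<epsilon> / 4) ^ K"
    using L by (simp add: diff_divide_distrib)
  ultimately show ?thesis using L unfolding P_def[symmetric] summand by (simp add: norm_divide)
qed

text \<open>The test polynomial has no constant term, so only moments of order 1 to
  \<open>K + 1\<close> occur; its coefficients are at most binomial coefficients, which sum to
  \<open>2 ^ K\<close>.\<close>

lemma norm_test_sum_le:
  assumes "\<And>j. 1 \<le> j \<Longrightarrow> j \<le> Suc K \<Longrightarrow>
     norm ((\<Sum>n=1..p^4. mangoldt n * g 0 n * of_real (v n ^ j)) / of_real L) \<le> \<tau>"
  shows "norm ((\<Sum>n=1..p^4. mangoldt n * g 0 n * of_real (v n * (1 - v n / 4) ^ K)) / of_real L) \<le> 2 ^ K * \<tau>"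
proof -
  define m where "m j = (\<Sum>n=1..p^4. mangoldt n * g 0 n * of_real (v n ^ j)) / of_real L" for j
  define c where "c i = real (K choose i) * (- 1 / 4) ^ i" for i
  have expand: "x * (1 - x / 4) ^ K = (\<Sum>i\<le>K. c i * x ^ Suc i)" for x :: real
  proof -
    have "(1 - x / 4) ^ K = (- x / 4 + 1) ^ K" by simp
    also have "\<dots> = (\<Sum>i\<le>K. real (K choose i) * (- x / 4) ^ i * 1 ^ (K - i))" by (rule binomial_ring)
    also have "\<dots> = (\<Sum>i\<le>K. c i * x ^ i)"
      by (intro sum.cong refl) (simp add: c_def power_mult_distrib[symmetric])
    finally show ?thesis by (simp add: sum_distrib_left mult_ac)
  qed
  have "(\<Sum>n=1..p^4. mangoldt n * g 0 n * of_real (v n * (1 - v n / 4) ^ K)) / of_real L =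
      (\<Sum>i\<le>K. of_real (c i) * m (Suc i))"
    unfolding expand m_def of_real_sum of_real_mult sum_distrib_left sum_divide_distrib
    by (subst sum.swap) (simp add: sum_divide_distrib sum_distrib_left mult_ac)
  also have "norm \<dots> \<le> (\<Sum>i\<le>K. real (K choose i) * \<tau>)"
  proof (rule sum_norm_le)
    fix i assume "i \<in> {..K}"
    then have "norm (m (Suc i)) \<le> \<tau>" unfolding m_def by (intro assms) auto
    moreover have "\<bar>c i\<bar> \<le> real (K choose i)"
      by (simp add: c_def abs_mult power_abs mult_left_le power_le_one)
    ultimately show "norm (of_real (c i) * m (Suc i)) \<le> real (K choose i) * \<tau>"
      unfolding norm_mult norm_of_real by (intro mult_mono) auto
  qed
  also have "\<dots> = (\<Sum>i\<le>K. real (K choose i)) * \<tau>" by (simp add: sum_distrib_right)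
  also have "(\<Sum>i\<le>K. real (K choose i)) = 2 ^ K"
    using choose_row_sum[of K] by (simp flip: of_nat_sum)
  finally show ?thesis .
qed

end

section \<open>Choice of parameters and the contradiction\<close>

text \<open>With \<open>d\<close> the square root of \<open>1 - \<epsilon>/4\<close> the last claim
  concerns the square of \<open>K * d ^ K\<close>, which tends to 0.\<close>

lemma exists_test_exponent:
  fixes \<epsilon> :: real
  assumes "0 < \<epsilon>" "\<epsilon> < 4"
  obtains K :: nat where "real K \<ge> 6 / \<epsilon>" "K \<ge> 1" "20 * (1 - \<epsilon> / 4) ^ K \<le> 1 / (32 * real K ^ 2)"
proof -
  define d where "d = sqrt (1 - \<epsilon> / 4)"
  have d: "0 < d" "d < 1" "d ^ 2 = 1 - \<epsilon> / 4" using assms by (auto simp: d_def real_sqrt_lt_1_iff)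
  have "(\<lambda>n. real n * d ^ n) \<longlonglongrightarrow> 0" using powser_times_n_limit_0[of d] d by simp
  \<comment> \<open>1/30 is small enough because \<open>20 * 32 = 640\<close> is below
    \<open>30\<^sup>2\<close>.\<close>
  then have "\<forall>\<^sub>F n in sequentially. real n * d ^ n < 1 / 30"
    by (rule order_tendstoD) simp
  moreover have "\<forall>\<^sub>F n in sequentially. real n \<ge> 6 / \<epsilon>"
    using filterlim_real_sequentially by (simp add: filterlim_at_top)
  ultimately have "\<forall>\<^sub>F n in sequentially. real n * d ^ n < 1 / 30 \<and> real n \<ge> 6 / \<epsilon> \<and> n \<ge> 1"
    using eventually_ge_at_top[of 1] by eventually_elim auto
  then obtain K where K: "real K * d ^ K < 1 / 30" "real K \<ge> 6 / \<epsilon>" "K \<ge> 1"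
    by (auto simp: eventually_at_top_linorder)
  have "(real K * d ^ K) ^ 2 \<le> (1 / 30) ^ 2" using K d by (intro power_mono) auto
  moreover have "(real K * d ^ K) ^ 2 = real K ^ 2 * (1 - \<epsilon> / 4) ^ K"
    by (simp add: power_mult_distrib flip: d(3) power_mult) (simp add: mult.commute)
  ultimately have "640 * (real K ^ 2 * (1 - \<epsilon> / 4) ^ K) \<le> 640 * (1 / 30) ^ 2" by (simp only:)
  also have "\<dots> \<le> 1" by (simp add: power2_eq_square)
  finally have "20 * (1 - \<epsilon> / 4) ^ K * (32 * real K ^ 2) \<le> 1" by (simp add: mult_ac)
  then have "20 * (1 - \<epsilon> / 4) ^ K \<le> 1 / (32 * real K ^ 2)"
    using K(3) by (subst pos_le_divide_eq) auto
  with K show ?thesis using that by blast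
qed

text \<open>For \<open>j \<ge> 1\<close> the denominator grows at least like
  \<open>R\<^sup>2\<close>, while the numerator is linear in \<open>R\<close>.\<close>

lemma exists_large_radius:
  fixes \<tau> c :: real
  assumes "\<tau> > 0"
  obtains R where "R \<ge> 2" "\<And>j. 1 \<le> j \<Longrightarrow> j \<le> Suc K \<Longrightarrow> fact (Suc j) * (2 * (4 * R + c)) / (R / 2) ^ Suc j \<le> \<tau>"
    "4 * R + c \<ge> 0"
proof -
  define M :: real where "M = fact (Suc (Suc K))"
  have "((\<lambda>R::real. M * ((4 * R + c) / R ^ 2)) \<longlongrightarrow> M * 0) at_top"
    by (rule tendsto_mult_left) real_asymp
  then have "\<forall>\<^sub>F R in at_top. M * ((4 * R + c) / R ^ 2) < \<tau> / 8"
    by (rule order_tendstoD) (use assms in simp)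
  moreover have "\<forall>\<^sub>F R::real in at_top. 4 * R + c \<ge> 0" by real_asymp
  ultimately have "\<forall>\<^sub>F R in at_top. M * ((4 * R + c) / R ^ 2) < \<tau> / 8 \<and> 4 * R + c \<ge> 0 \<and> R \<ge> 2"
    using eventually_ge_at_top[of 2] by eventually_elim auto
  then obtain R where R: "M * ((4 * R + c) / R ^ 2) < \<tau> / 8" "4 * R + c \<ge> 0" "R \<ge> 2"
    by (auto simp: eventually_at_top_linorder)
  show ?thesis
  proof (rule that[of R])
    fix j :: nat assume j: "1 \<le> j" "j \<le> Suc K"
    have "fact (Suc j) * (2 * (4 * R + c)) / (R / 2) ^ Suc j \<le> M * (2 * (4 * R + c)) / (R / 2) ^ 2"
    proof (intro frac_le mult_right_mono)
      show "fact (Suc j) \<le> M" unfolding M_def using j by (intro fact_mono) auto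
      show "(R / 2) ^ 2 \<le> (R / 2) ^ Suc j" using j R by (intro power_increasing) auto
    qed (use R in \<open>auto simp: M_def\<close>)
    also have "\<dots> = 8 * (M * ((4 * R + c) / R ^ 2))" using R by (simp add: power_divide field_simps)
    also have "\<dots> \<le> \<tau>" using R(1) by linarith
    finally show "fact (Suc j) * (2 * (4 * R + c)) / (R / 2) ^ Suc j \<le> \<tau>" .
  qed (use R in auto)
qed

text \<open>The order of choice closes the argument: \<epsilon> fixes \<open>\<kappa>\<close>,
  \<open>a\<close> and \<open>K\<close>; these fix \<open>\<tau>\<close> and \<open>R\<close>; only
  then are \<open>\<eta>\<close> and \<open>p\<close> chosen to beat \<open>W\<close>, which is huge
  in terms of \<open>R\<close>.\<close>

theorem least_char_nonresidue:
  assumes EH: elliott_halberstam and \<epsilon>: "0 < \<epsilon>" "\<epsilon> \<le> 1/2"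
  obtains p0 :: nat where
    "\<And>p \<xi>. p \<ge> p0 \<Longrightarrow> nonprincipal_char p \<xi> \<Longrightarrow> \<exists>n. 1 \<le> n \<and> real n \<le> real p powr \<epsilon> \<and> \<xi> n \<noteq> 1"
proof -
  define \<kappa> where "\<kappa> = 3 / \<epsilon>"
  define a where "a = \<epsilon> / 6"
  have \<kappa>: "\<kappa> > 0" and a: "a > 0" using \<epsilon> by (auto simp: \<kappa>_def a_def)
  obtain K :: nat where K: "real K \<ge> 6 / \<epsilon>" "K \<ge> 1" "20 * (1 - \<epsilon> / 4) ^ K \<le> 1 / (32 * real K ^ 2)"
    using exists_test_exponent[of \<epsilon>] \<epsilon> by auto
  \<comment> \<open>After the loss \<open>2 ^ K\<close> the moments give
    \<open>1 / (64 * K\<^sup>2)\<close>, half of the lower bound \<open>1 / (32 * K\<^sup>2)\<close>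
    for the test sum.\<close>
  define \<tau> where "\<tau> = 1 / (64 * real K ^ 2 * 2 ^ K)"
  have \<tau>: "\<tau> > 0" using K by (simp add: \<tau>_def)
  obtain R where R: "R \<ge> 2" "\<And>j. 1 \<le> j \<Longrightarrow> j \<le> Suc K \<Longrightarrow>
      fact (Suc j) * (2 * (4 * R + (ln (10 / a) + 1))) / (R / 2) ^ Suc j \<le> \<tau>"
    using exists_large_radius[OF \<tau>, of K "ln (10 / a) + 1"] by metis
  define W where "W = (twist_lip \<kappa> R)\<^sup>2 * exp (5 * (R * exp (4 * R))) * R"
  have W: "W > 0"
  proof -
    have "exp (4 * R) \<le> twist_lip \<kappa> R" using \<kappa> R by (intro twist_lip_ge) auto
    then have "twist_lip \<kappa> R > 0" by (rule less_le_trans[OF exp_gt_zero])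
    then show ?thesis unfolding W_def using R by simp
  qed
  \<comment> \<open>Half of the permitted error \<open>a / 2\<close> goes to \<open>\<eta>\<close>,
    as \<open>W * (60 * \<eta>) = a / 4\<close>; the other half goes to \<open>20 / p\<close>, by
    \<open>p \<ge> 80 * W / a\<close>.\<close>
  define \<eta> where "\<eta> = a / (240 * W)"
  have \<eta>: "\<eta> > 0" using a W by (simp add: \<eta>_def)
  obtain p0 :: nat where p0: "\<And>p \<xi> N. p \<ge> p0 \<Longrightarrow> nonprincipal_char p \<xi> \<Longrightarrow>
       (\<And>n. 1 \<le> n \<Longrightarrow> real n \<le> real p powr \<epsilon> \<Longrightarrow> \<xi> n = 1) \<Longrightarrow>
       p ^ 2 \<le> N \<Longrightarrow> N \<le> p ^ 4 \<Longrightarrow> norm (\<Sum>n=1..N. mangoldt n * \<xi> n) \<le> \<eta> * real N"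
    using char_mangoldt_sum_small[OF EH \<epsilon> \<eta>] by metis
  obtain C :: real where C: "C \<ge> 1" "\<And>N. N > 0 \<Longrightarrow> \<bar>(\<Sum>n=1..N. mangoldt n / real n) - ln (real N)\<bar> \<le> C"
    using mertens_bound[OF EH] by blast
  define L0 where "L0 = 1 + \<kappa> + 2 * real K * (2 * C + 1) + C"
  define p1 where "p1 = max p0 (nat \<lceil>max (exp L0) (80 * W / a)\<rceil>)"
  show ?thesis
  proof (rule that[of p1], rule ccontr)
    fix p :: nat and \<xi> assume p: "p \<ge> p1" and \<xi>: "nonprincipal_char p \<xi>"
      and neg: "\<not> (\<exists>n. 1 \<le> n \<and> real n \<le> real p powr \<epsilon> \<and> \<xi> n \<noteq> 1)"
    have one: "\<xi> n = 1" if "1 \<le> n" "real n \<le> real p powr \<epsilon>" for n using neg that by blast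
    have pr: "p \<ge> p0" "real p \<ge> exp L0" "real p \<ge> 80 * W / a" using p unfolding p1_def by linarith+
    have p_pos: "real p > 0" using pr(2) exp_gt_zero[of L0] by linarith
    have "ln (exp L0) \<le> ln (real p)" using pr(2) by (intro ln_mono) auto
    then have lnp: "L0 \<le> ln (real p)" by simp
    have parts: "\<kappa> \<ge> 0" "2 * real K * (2 * C + 1) \<ge> 0" "C \<ge> 0" using \<kappa> C by auto
    then have lnp_ge: "ln (real p) \<ge> 1" "\<kappa> \<le> ln (real p)" "2 * real K * (2 * C + 1) \<le> ln (real p)" "C \<le> ln (real p)"
      using lnp unfolding L0_def by linarith+
    have p4: "p ^ 4 > 0" "ln (real (p ^ 4)) = 4 * ln (real p)" using p_pos by (auto simp: ln_realpow)
    interpret twisted_char_sums p \<xi> \<kappa> \<eta>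
    proof
      show "(\<Sum>n=1..p^4. mangoldt n / real n) \<le> 5 * ln (real p)"
        using C(2)[OF p4(1)] p4(2) lnp_ge by linarith
      show "(\<Sum>n=1..p^4. 1 / real n) \<le> 5 * ln (real p)"
        using sum_inverse_le[OF p4(1)] p4(2) lnp_ge by linarith
    qed (use \<xi> lnp_ge \<kappa> \<eta> p0[OF pr(1) \<xi> one] in auto)
    have A0: "a \<le> norm (A 0)"
      unfolding a_def by (rule norm_A_0_ge) (use \<epsilon> \<kappa>_def lnp_ge one in \<open>auto simp: L_def\<close>)
    have "W * (20 / real p + 60 * \<eta>) \<le> a / 2"
    proof -
      have "80 * W \<le> real p * a" using pr(3) a by (simp add: pos_divide_le_eq)
      then have "W * (20 / real p) \<le> a / 4" using p_pos by (simp add: field_simps)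
      moreover have "W * (60 * \<eta>) = a / 4" using W by (simp add: \<eta>_def)
      ultimately show ?thesis by (simp add: distrib_left)
    qed
    then have small: "(twist_lip \<kappa> R)\<^sup>2 * (20 / real p + 60 * \<eta>) * exp (5 * (R * exp (4 * R))) * R \<le> a / 2"
      by (simp add: W_def mult_ac)
    have moment: "norm ((\<Sum>n=1..p^4. mangoldt n * g 0 n * of_real (v n ^ j)) / of_real L) \<le> \<tau>"
      if "1 \<le> j" "j \<le> Suc K" for j
      using norm_moment_le[OF _ a A0 small, of j] R(1) R(2)[OF that]
      by (simp only: add.assoc) linarith
    have "1 / (16 * real K ^ 2) - 20 * (1 - \<epsilon> / 4) ^ K \<le> 2 ^ K * \<tau>"
    proof (rule order_trans[OF norm_test_sum_ge norm_test_sum_le])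
      show "2 * real K * (2 * C + 1) \<le> L" using lnp_ge by (simp add: L_def)
    qed (use \<epsilon> \<kappa>_def K one C moment in auto)
    moreover have "2 ^ K * \<tau> = 1 / (64 * real K ^ 2)" by (simp add: \<tau>_def)
    moreover have "1 / (16 * real K ^ 2) - 1 / (32 * real K ^ 2) = 1 / (32 * real K ^ 2)"
      by (simp add: field_simps)
    moreover have "1 / (64 * real K ^ 2) < 1 / (32 * real K ^ 2)"
      using K by (intro divide_strict_left_mono) auto
    ultimately show False using K(3) by linarith
  qed
qed

section \<open>Discrete logarithms and characters of prime order\<close>

text \<open>\<open>ind\<close> is the discrete logarithm to the base \<open>g0\<close>. It is
  determined only modulo \<open>p - 1\<close>, so its rules are congruences.\<close>

lemma prime_index_exists:
  assumes p: "prime p"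
  obtains g0 and ind :: "nat \<Rightarrow> nat" where "residue_primroot p g0"
    "\<And>n. \<not> p dvd n \<Longrightarrow> [g0 ^ ind n = n] (mod p)"
    "\<And>m n. \<not> p dvd m \<Longrightarrow> \<not> p dvd n \<Longrightarrow> [ind (m * n) = ind m + ind n] (mod (p - 1))"
    "\<And>m n. \<not> p dvd m \<Longrightarrow> [m = n] (mod p) \<Longrightarrow> [ind m = ind n] (mod (p - 1))"
proof -
  have p1: "p > 1" using p prime_gt_1_nat by auto
  obtain g0 where g0: "residue_primroot p g0"
    using Carmichael_eq_totient_imp_primroot[of p] Carmichael_prime[OF p] totient_prime[OF p] p1 by auto
  have cop: "coprime p g0" and ord: "ord p g0 = p - 1"
    using g0 totient_prime[OF p] by (auto simp: residue_primroot_def)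
  have "\<exists>i. [g0 ^ i = n] (mod p)" if "\<not> p dvd n" for n
  proof -
    have "n mod p \<noteq> 0" using that by (simp add: mod_eq_0_iff_dvd)
    then have "n mod p > 0" by simp
    moreover have "coprime n p" using p that by (metis coprime_commute prime_imp_coprime)
    then have "coprime (n mod p) p" using p1 by simp
    moreover have "n mod p \<le> p" using p1 by (simp add: less_imp_le)
    ultimately have "n mod p \<in> totatives p" unfolding in_totatives_iff by blast
    then have "n mod p \<in> (\<lambda>i. g0 ^ i mod p) ` {..<totient p}"
      using bij_betw_imp_surj_on[OF residue_primroot_is_generator[OF p1 g0]] by simp
    then obtain i where "n mod p = g0 ^ i mod p" by blast
    then show ?thesis unfolding unique_euclidean_semiring_class.cong_def by metis
  qed
  then obtain ind where ind: "\<And>n. \<not> p dvd n \<Longrightarrow> [g0 ^ ind n = n] (mod p)" by metis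
  have eq: "[i = j] (mod (p - 1))" if "[g0 ^ i = g0 ^ j] (mod p)" for i j
    using that order_divides_expdiff[OF cop] by (simp add: ord)
  show ?thesis
  proof (rule that[OF g0 ind])
    fix m n assume mn: "\<not> p dvd m" "\<not> p dvd n"
    then have "\<not> p dvd m * n" using p by (simp add: prime_dvd_mult_iff)
    then have "[g0 ^ ind (m * n) = m * n] (mod p)" by (rule ind)
    moreover have "[g0 ^ ind m * g0 ^ ind n = m * n] (mod p)" using mn by (intro cong_mult ind)
    ultimately have "[g0 ^ ind (m * n) = g0 ^ (ind m + ind n)] (mod p)"
      unfolding power_add by (metis cong_sym cong_trans)
    then show "[ind (m * n) = ind m + ind n] (mod (p - 1))" by (rule eq)
  next
    fix m n assume mn: "\<not> p dvd m" "[m = n] (mod p)"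
    then have "\<not> p dvd n" by (metis cong_dvd_iff)
    then show "[ind m = ind n] (mod (p - 1))"
      using ind[of n] ind[OF mn(1)] mn(2) by (intro eq) (metis cong_sym cong_trans)
  qed
qed

lemma cis_index_cong:
  assumes "l > 0" "[i = j] (mod l)"
  shows "cis (2 * pi * real i / real l) = cis (2 * pi * real j / real l)"
proof -
  have *: "cis (2 * pi * real i / real l) = cis (2 * pi * real (i mod l) / real l)" for i
  proof -
    have "real i = real (i mod l) + real l * real (i div l)"
      by (metis mod_mult_div_eq of_nat_add of_nat_mult)
    then have "2 * pi * real i / real l = 2 * pi * real (i mod l) / real l + 2 * pi * real (i div l)"
      using assms(1) by (simp add: field_simps)
    moreover have "cis (2 * pi * real (i div l)) = 1" by (rule cis_multiple_2pi) simp
    ultimately show ?thesis by (simp only: cis_mult[symmetric] mult_1_right)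
  qed
  show ?thesis using *[of i] *[of j] assms(2) by (simp add: unique_euclidean_semiring_class.cong_def)
qed

lemma cis_index_eq_1_iff:
  assumes "l > 0"
  shows "cis (2 * pi * real i / real l) = 1 \<longleftrightarrow> l dvd i"
proof
  assume "l dvd i"
  then have "[i = 0] (mod l)" by (simp add: cong_0_iff)
  from cis_index_cong[OF assms this] show "cis (2 * pi * real i / real l) = 1" by simp
next
  assume "cis (2 * pi * real i / real l) = 1"
  then have "cos (2 * pi * real i / real l) = 1" by (metis cis.simps(1) one_complex.simps(1))
  then obtain k :: int where "2 * pi * real i / real l = of_int k * 2 * pi"
    by (auto simp: cos_one_2pi_int)
  then have "real i = of_int k * real l" using assms by (simp add: field_simps)
  then have "int i = k * int l" by (metis of_int_eq_iff of_int_mult of_int_of_nat_eq)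
  then show "l dvd i" by (metis dvd_triv_right int_dvd_int_iff)
qed

text \<open>On the residues prime to \<open>p\<close> the kernel of this character is the
  \<open>l\<close>-th powers. It is nontrivial because \<open>g0\<close> has index 1 modulo
  \<open>p - 1\<close>, hence an index that \<open>l\<close> does not divide.\<close>

lemma index_char_nonprincipal:
  assumes p: "prime p" and l: "prime l" "l dvd p - 1" and g0: "residue_primroot p g0"
    and ind: "\<And>n. \<not> p dvd n \<Longrightarrow> [g0 ^ ind n = n] (mod p)"
      "\<And>m n. \<not> p dvd m \<Longrightarrow> \<not> p dvd n \<Longrightarrow> [ind (m * n) = ind m + ind n] (mod (p - 1))"
      "\<And>m n. \<not> p dvd m \<Longrightarrow> [m = n] (mod p) \<Longrightarrow> [ind m = ind n] (mod (p - 1))"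
  shows "nonprincipal_char p (\<lambda>n. if p dvd n then 0 else cis (2 * pi * real (ind n) / real l))"
proof -
  have l0: "l > 0" using l prime_gt_0_nat by auto
  have down: "[i = j] (mod l)" if "[i = j] (mod (p - 1))" for i j
    using that l(2) by (rule cong_dvd_modulus_nat)
  have "\<not> p dvd g0"
  proof
    assume "p dvd g0"
    then have "p dvd 1" using g0 p by (metis coprime_absorb_left residue_primroot_def is_unit_gcd)
    then show False using p by simp
  qed
  moreover have "\<not> l dvd ind g0"
  proof
    assume "l dvd ind g0"
    have "[g0 ^ ind g0 = g0 ^ 1] (mod p)" using ind(1)[OF \<open>\<not> p dvd g0\<close>] by simp
    then have "[ind g0 = 1] (mod (p - 1))"
      using order_divides_expdiff[of p g0 "ind g0" 1] g0 totient_prime[OF p]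
      by (simp only: residue_primroot_def)
    then have "l dvd 1" using down \<open>l dvd ind g0\<close> by (metis cong_dvd_iff cong_sym cong_dvd_modulus_nat cong_0_iff cong_trans)
    then show False using l(1) by simp
  qed
  ultimately have "\<exists>n. \<not> p dvd n \<and> (if p dvd n then 0 else cis (2 * pi * real (ind n) / real l)) \<noteq> 1"
    using cis_index_eq_1_iff[OF l0] by (intro exI[of _ g0]) auto
  moreover have "cis (2 * pi * real (ind (m * n)) / real l) =
      cis (2 * pi * real (ind m) / real l) * cis (2 * pi * real (ind n) / real l)"
    if "\<not> p dvd m" "\<not> p dvd n" for m n
    using cis_index_cong[OF l0 down[OF ind(2)[OF that]]] by (simp add: cis_mult add_divide_distrib distrib_left)
  moreover have "cis (2 * pi * real (ind (n + p)) / real l) = cis (2 * pi * real (ind n) / real l)"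
    if "\<not> p dvd n" for n
    by (rule cis_index_cong[OF l0 down[OF ind(3)]]) (use that in \<open>auto simp: unique_euclidean_semiring_class.cong_def\<close>)
  ultimately show ?thesis unfolding nonprincipal_char_def using p
    by (auto simp: prime_dvd_mult_iff)
qed

section \<open>From power nonresidues to a primitive root\<close>

text \<open>At the primes up to \<open>d\<close> the Chinese remainder theorem finds an allowed residue; among \<open>d + 1\<close>
  consecutive lifts of it, each prime beyond \<open>d\<close> excludes at most one.\<close>

lemma exists_avoiding_residues:
  fixes P :: "nat set" and a :: "nat \<Rightarrow> nat"
  assumes P: "finite P" "\<And>l. l \<in> P \<Longrightarrow> prime l" "card P \<le> d" and d: "d \<ge> 1"
  obtains t where "t \<le> Suc d * d ^ d" "\<And>l. l \<in> P \<Longrightarrow> \<not> [t = a l] (mod l)"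
proof -
  define S where "S = {l\<in>P. l \<le> d}"
  define M where "M = \<Prod>S"
  have S: "finite S" "\<And>l. l \<in> S \<Longrightarrow> prime l" "card S \<le> d"
    using P card_mono[of P S] by (auto simp: S_def)
  have M0: "M > 0" unfolding M_def using S(2) prime_gt_0_nat by (intro prod_pos) auto
  have Md: "M \<le> d ^ d"
  proof -
    have "M \<le> (\<Prod>l\<in>S. d)" unfolding M_def by (intro prod_mono) (auto simp: S_def)
    also have "\<dots> \<le> d ^ d" using S(3) d by (auto intro!: power_increasing)
    finally show ?thesis .
  qed
  have "\<forall>i\<in>S. \<forall>j\<in>S. i \<noteq> j \<longrightarrow> coprime i j" using S(2) primes_coprime by blast
  \<comment> \<open>\<open>a l + 1\<close> is a residue different from \<open>a l\<close> modulo
    every prime \<open>l\<close>.\<close>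
  from chinese_remainder_nat[of S "\<lambda>l. l", OF S(1) this, of "\<lambda>l. Suc (a l)"]
  obtain x where x: "\<forall>l\<in>S. [x = Suc (a l)] (mod l)" by blast
  define t where "t s = x mod M + s * M" for s
  have small: "\<not> [t s = a l] (mod l)" if "l \<in> S" for l s
  proof
    assume t: "[t s = a l] (mod l)"
    have "l dvd M" unfolding M_def using S(1) that by (rule dvd_prodI)
    moreover have "[t s = x] (mod M)" by (simp add: t_def unique_euclidean_semiring_class.cong_def)
    ultimately have "[t s = x] (mod l)" by (rule cong_dvd_modulus_nat[rotated])
    then have "[a l = Suc (a l)] (mod l)" using t x that by (meson cong_sym cong_trans)
    then have "[a l + 0 = a l + 1] (mod l)" by simp
    then have "[0 = 1] (mod l)" by (simp only: cong_add_lcancel_nat)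
    then have "l dvd 1" by (metis cong_0_iff cong_sym)
    then show False using S(2)[OF that] by simp
  qed
  define Bad where "Bad l = {s\<in>{..d}. [t s = a l] (mod l)}" for l
  have bad: "card (Bad l) \<le> 1" if "l \<in> P - S" for l
  proof -
    have l: "prime l" "l > d" using that P(2) by (auto simp: S_def)
    have "\<not> l dvd M"
    proof
      assume "l dvd M"
      then obtain q where "q \<in> S" "l dvd q"
        unfolding M_def using S(1) l(1) by (auto simp: prime_dvd_prod_iff)
      then have "l \<in> S" using S(2) l(1) primes_dvd_imp_eq by blast
      then show False using l(2) by (simp add: S_def)
    qed
    then have cop: "coprime M l" using l(1) by (metis coprime_commute prime_imp_coprime)
    have "s = s'" if "s \<in> Bad l" "s' \<in> Bad l" for s s'
    proof -
      have "[t s = t s'] (mod l)" using that unfolding Bad_def by (metis (mono_tags, lifting) cong_sym cong_trans mem_Collect_eq)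
      then have "[s * M = s' * M] (mod l)" unfolding t_def by (simp only: cong_add_lcancel_nat)
      then have "[s = s'] (mod l)" using cop by (simp only: cong_mult_rcancel_nat)
      then show ?thesis using that l(2)
        by (simp add: Bad_def unique_euclidean_semiring_class.cong_def)
    qed
    then show ?thesis by (simp add: card_le_Suc0_iff_eq Bad_def)
  qed
  have "card (\<Union>l\<in>P-S. Bad l) \<le> (\<Sum>l\<in>P-S. card (Bad l))" using P by (intro card_UN_le) auto
  also have "\<dots> \<le> (\<Sum>l\<in>P-S. 1)" by (intro sum_mono bad)
  also have "\<dots> \<le> d" using P card_mono[of P "P - S"] by simp
  finally have "card (\<Union>l\<in>P-S. Bad l) < card {..d}" by simp
  then have "\<not> {..d} \<subseteq> (\<Union>l\<in>P-S. Bad l)"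
    using P card_mono[of "\<Union>l\<in>P-S. Bad l" "{..d}"] by (auto simp: Bad_def not_le)
  then obtain s where s: "s \<le> d" "\<And>l. l \<in> P - S \<Longrightarrow> s \<notin> Bad l" by auto
  show ?thesis
  proof (rule that[of "t s"])
    have "t s \<le> M + d * M" unfolding t_def using M0 s(1) by (intro add_mono mult_right_mono) auto
    also have "\<dots> = Suc d * M" by simp
    also have "\<dots> \<le> Suc d * d ^ d" using Md by (intro mult_left_mono) auto
    finally show "t s \<le> Suc d * d ^ d" .
    fix l assume "l \<in> P"
    then show "\<not> [t s = a l] (mod l)" using small s unfolding Bad_def by (cases "l \<in> S") auto
  qed
qed

lemma linear_congruence_single_class:
  fixes b e l :: nat
  assumes "prime l" "\<not> l dvd b"
  obtains a where "\<And>t. l dvd e + t * b \<Longrightarrow> [t = a] (mod l)"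
proof (cases "\<exists>a. l dvd e + a * b")
  case True
  then obtain a where a: "l dvd e + a * b" by blast
  have cop: "coprime b l" using assms by (metis coprime_commute prime_imp_coprime)
  show ?thesis
  proof (rule that[of a])
    fix t assume "l dvd e + t * b"
    then have "[e + t * b = e + a * b] (mod l)" using a by (metis cong_0_iff cong_sym cong_trans)
    then show "[t = a] (mod l)" using cop by (simp only: cong_add_lcancel_nat cong_mult_rcancel_nat)
  qed
qed (use that in blast)

text \<open>Primes are added one at a time. Passing from \<open>g\<close> to
  \<open>g * n ^ t\<close> changes the index to \<open>ind g + t * ind n\<close>. A prime
  \<open>j\<close> not dividing \<open>ind n\<close> excludes at most one class of \<open>t\<close>;
  one dividing \<open>ind n\<close> excludes none, since then \<open>j \<noteq> l\<close> and
  \<open>g\<close> is already good for \<open>j\<close>. Some \<open>t\<close> bounded in terms of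
  \<open>d\<close> avoids all excluded classes.\<close>

lemma combine_nonresidues:
  fixes ind nl :: "nat \<Rightarrow> nat" and X :: real
  assumes P: "finite P" "\<And>l. l \<in> P \<Longrightarrow> prime l" "\<And>l. l \<in> P \<Longrightarrow> l dvd p - 1" "card P \<le> d"
    and p: "prime p" and d: "d \<ge> 1" and X: "X \<ge> 1"
    and ind: "\<And>m n. \<not> p dvd m \<Longrightarrow> \<not> p dvd n \<Longrightarrow> [ind (m * n) = ind m + ind n] (mod (p - 1))"
    and nl: "\<And>l. l \<in> P \<Longrightarrow> \<not> p dvd nl l \<and> \<not> l dvd ind (nl l) \<and> real (nl l) \<le> X"
  shows "\<exists>g. \<not> p dvd g \<and> (\<forall>l\<in>P. \<not> l dvd ind g) \<and> real g \<le> X ^ (Suc d * d ^ d * card P)"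
  using P nl
proof (induction P rule: finite_induct)
  case empty
  show ?case using p X by (intro exI[of _ 1]) auto
next
  case (insert l P)
  have "card P \<le> d" using insert.hyps insert.prems(3) by simp
  then obtain g where g: "\<not> p dvd g" "\<And>j. j \<in> P \<Longrightarrow> \<not> j dvd ind g" "real g \<le> X ^ (Suc d * d ^ d * card P)"
    using insert.IH insert.prems by auto
  define n where "n = nl l"
  have n: "\<not> p dvd n" "\<not> l dvd ind n" "real n \<le> X" using insert.prems(4)[of l] by (auto simp: n_def)
  have pr: "prime j" "j dvd p - 1" if "j \<in> insert l P" for j using insert.prems that by auto
  have pow: "\<not> p dvd g * n ^ t \<and> [ind (g * n ^ t) = ind g + t * ind n] (mod (p - 1))" for t
  proof (induction t)
    case (Suc t)
    have "\<not> p dvd g * n ^ Suc t" using g(1) n(1) p by (auto simp: prime_dvd_mult_iff dest: prime_dvd_power)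
    moreover have "[ind ((g * n ^ t) * n) = ind (g * n ^ t) + ind n] (mod (p - 1))"
      using Suc n(1) by (intro ind) auto
    moreover have "[ind (g * n ^ t) + ind n = (ind g + t * ind n) + ind n] (mod (p - 1))"
      using Suc by (intro cong_add) auto
    ultimately show ?case by (auto simp: algebra_simps intro: cong_trans)
  qed (use g in auto)
  \<comment> \<open>The second alternative handles the \<open>j\<close> that divide
    \<open>ind n\<close>; for them the choice of \<open>a\<close> is immaterial.\<close>
  have "\<exists>a. \<forall>t. j dvd ind g + t * ind n \<longrightarrow> [t = a] (mod j) \<or> (j dvd ind n \<and> j dvd ind g)"
    if "j \<in> insert l P" for j
  proof (cases "j dvd ind n")
    case True
    then show ?thesis by (metis dvd_add_times_triv_left_iff dvd_add_left_iff dvd_mult)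
  next
    case False
    then show ?thesis using linear_congruence_single_class[OF pr(1)[OF that]] by metis
  qed
  then obtain a where a: "\<And>j t. j \<in> insert l P \<Longrightarrow> j dvd ind g + t * ind n \<Longrightarrow>
      [t = a j] (mod j) \<or> (j dvd ind n \<and> j dvd ind g)" by metis
  obtain t where t: "t \<le> Suc d * d ^ d" "\<And>j. j \<in> insert l P \<Longrightarrow> \<not> [t = a j] (mod j)"
    using exists_avoiding_residues[of "insert l P" d a] insert.hyps insert.prems pr d by auto
  show ?case
  proof (intro exI[of _ "g * n ^ t"] conjI ballI)
    show "\<not> p dvd g * n ^ t" using pow by blast
    show "\<not> j dvd ind (g * n ^ t)" if j: "j \<in> insert l P" for j
    proof
      assume "j dvd ind (g * n ^ t)"
      moreover have "[ind (g * n ^ t) = ind g + t * ind n] (mod j)"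
        using pow pr(2)[OF j] by (metis cong_dvd_modulus_nat)
      ultimately have "j dvd ind g + t * ind n" by (metis cong_dvd_iff)
      then have "j dvd ind n \<and> j dvd ind g" using a[OF j] t(2)[OF j] by blast
      then show False using j n(2) g(2) by auto
    qed
    have "real (g * n ^ t) \<le> X ^ (Suc d * d ^ d * card P) * X ^ t"
      using g(3) n(3) X by (auto intro!: mult_mono power_mono)
    also have "\<dots> \<le> X ^ (Suc d * d ^ d * card P) * X ^ (Suc d * d ^ d)"
      using X t(1) by (intro mult_left_mono power_increasing) auto
    also have "\<dots> = X ^ (Suc d * d ^ d * card (insert l P))"
      using insert.hyps by (simp add: power_add[symmetric] algebra_simps)
    finally show "real (g * n ^ t) \<le> X ^ (Suc d * d ^ d * card (insert l P))" .
  qed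
qed

lemma residue_primroot_of_index:
  assumes p: "prime p" and g0: "residue_primroot p g0" and g: "[g0 ^ i = g] (mod p)"
    and cop: "\<And>l. prime l \<Longrightarrow> l dvd p - 1 \<Longrightarrow> \<not> l dvd i"
  shows "residue_primroot p g"
proof -
  have "coprime i (p - 1)"
  proof (rule ccontr)
    assume "\<not> coprime i (p - 1)"
    then have "gcd i (p - 1) \<noteq> 1" by (metis coprime_iff_gcd_eq_1)
    then obtain l where "prime l" "l dvd gcd i (p - 1)" using prime_factor_nat by blast
    then show False using cop[of l] by auto
  qed
  then have "ord p (g0 ^ i) = p - 1"
    using g0 totient_prime[OF p] by (simp add: residue_primroot_def ord_power)
  then have "residue_primroot p (g0 ^ i)"
    using g0 totient_prime[OF p] by (simp add: residue_primroot_def)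
  then show ?thesis using residue_primroot_cong[OF g] by simp
qed

theorem theorem1p4:
  assumes "elliott_halberstam"
  shows "\<forall>d :: nat. d \<ge> 1 \<longrightarrow> (\<forall>\<epsilon> :: real. \<epsilon> > 0 \<longrightarrow>
           (\<exists>C :: real. \<forall>p :: nat. prime p \<and> size (prime_factorization (p - 1)) \<le> d \<longrightarrow>
              real (least_primroot p) \<le> C * real p powr \<epsilon>))"
proof (intro allI impI)
  fix d :: nat and \<epsilon> :: real
  assume d: "d \<ge> 1" and \<epsilon>: "\<epsilon> > 0"
  \<comment> \<open>At most \<open>d\<close> primes divide \<open>p - 1\<close>, and each costs a
    factor \<open>X\<close> to the power \<open>Suc d * d ^ d\<close>.\<close>
  define k where "k = Suc d * d ^ d * d"
  have k: "k > 0" using d by (simp add: k_def)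
  \<comment> \<open>The cap 1/2 is the range of \<open>least_char_nonresidue\<close>, and it also
    gives \<open>X < p\<close>.\<close>
  define \<epsilon>' where "\<epsilon>' = min (1/2) (\<epsilon> / k)"
  have \<epsilon>': "0 < \<epsilon>'" "\<epsilon>' \<le> 1/2" "\<epsilon>' * k \<le> \<epsilon>"
    using \<epsilon> k by (auto simp: \<epsilon>'_def min_def field_simps)
  obtain p0 :: nat where p0: "\<And>p \<xi>. p \<ge> p0 \<Longrightarrow> nonprincipal_char p \<xi> \<Longrightarrow>
      \<exists>n. 1 \<le> n \<and> real n \<le> real p powr \<epsilon>' \<and> \<xi> n \<noteq> 1"
    using least_char_nonresidue[OF assms \<epsilon>'(1,2)] by metis
  have large: "real (least_primroot p) \<le> real p powr \<epsilon>"
    if p: "prime p" "p \<ge> p0" "bigomega (p - 1) \<le> d" for p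
  proof -
    have p1: "p > 1" using p prime_gt_1_nat by auto
    define X where "X = real p powr \<epsilon>'"
    have X: "X \<ge> 1" "X < real p"
      using p1 \<epsilon>' powr_less_mono[of \<epsilon>' 1 "real p"] by (auto simp: X_def ge_one_powr_ge_zero)
    obtain g0 and ind :: "nat \<Rightarrow> nat" where g0: "residue_primroot p g0"
      and ind: "\<And>n. \<not> p dvd n \<Longrightarrow> [g0 ^ ind n = n] (mod p)"
        "\<And>m n. \<not> p dvd m \<Longrightarrow> \<not> p dvd n \<Longrightarrow> [ind (m * n) = ind m + ind n] (mod (p - 1))"
        "\<And>m n. \<not> p dvd m \<Longrightarrow> [m = n] (mod p) \<Longrightarrow> [ind m = ind n] (mod (p - 1))"
      using prime_index_exists[OF p(1)] by metis
    have "\<exists>n. \<not> p dvd n \<and> \<not> l dvd ind n \<and> real n \<le> X" if l: "l \<in> prime_factors (p - 1)" for l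
    proof -
      have l': "prime l" "l dvd p - 1" using l by auto
      obtain n where n: "1 \<le> n" "real n \<le> X" "(if p dvd n then 0 else cis (2 * pi * real (ind n) / real l)) \<noteq> 1"
        using p0[OF p(2) index_char_nonprincipal[OF p(1) l' g0 ind]] unfolding X_def by blast
      \<comment> \<open>This rules out the value 0 that the character takes at multiples of
        \<open>p\<close>, so the value differs from 1 on account of the index.\<close>
      have "real n < real p" using n(2) X by linarith
      then have "\<not> p dvd n" using n(1) by (auto dest: dvd_imp_le)
      moreover then have "\<not> l dvd ind n"
        using n(3) cis_index_eq_1_iff[of l "ind n"] l'(1) prime_gt_0_nat by auto
      ultimately show ?thesis using n(2) by blast
    qed
    then obtain nl where nl: "\<And>l. l \<in> prime_factors (p - 1) \<Longrightarrow> \<not> p dvd nl l \<and> \<not> l dvd ind (nl l) \<and> real (nl l) \<le> X"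
      by metis
    have cd: "card (prime_factors (p - 1)) \<le> d" using card_prime_factors_le[of "p - 1"] p(3) by linarith
    have "\<exists>g. \<not> p dvd g \<and> (\<forall>l\<in>prime_factors (p - 1). \<not> l dvd ind g) \<and>
        real g \<le> X ^ (Suc d * d ^ d * card (prime_factors (p - 1)))"
      by (rule combine_nonresidues[where nl = nl]) (use cd p(1) d X(1) ind(2) nl in blast)+
    then obtain g where g: "\<not> p dvd g" "\<And>l. l \<in> prime_factors (p - 1) \<Longrightarrow> \<not> l dvd ind g"
      "real g \<le> X ^ (Suc d * d ^ d * card (prime_factors (p - 1)))" by blast
    have "residue_primroot p g"
      by (rule residue_primroot_of_index[OF p(1) g0 ind(1)[OF g(1)]])
        (use g(2) p1 in \<open>auto simp: prime_factors_dvd\<close>)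
    then have "real (least_primroot p) \<le> real g"
      unfolding least_primroot_def by (simp add: Least_le)
    also have "\<dots> \<le> X ^ k"
      using g(3) power_increasing[OF _ X(1), of "Suc d * d ^ d * card (prime_factors (p - 1))" k] cd
      unfolding k_def by (meson mult_le_mono2 order_trans)
    also have "\<dots> = real p powr (\<epsilon>' * k)"
      using p1 by (simp add: X_def powr_powr flip: powr_realpow)
    also have "\<dots> \<le> real p powr \<epsilon>" using p1 \<epsilon>' by (intro powr_mono) auto
    finally show ?thesis .
  qed
  \<comment> \<open>The primes below \<open>p0\<close> are finitely many and are absorbed into the
    constant.\<close>
  define C where "C = 1 + (\<Sum>q<p0. real (least_primroot q))"
  have C: "C \<ge> 1" unfolding C_def by (simp add: sum_nonneg)
  show "\<exists>C :: real. \<forall>p :: nat. prime p \<and> size (prime_factorization (p - 1)) \<le> d \<longrightarrow>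
              real (least_primroot p) \<le> C * real p powr \<epsilon>"
  proof (intro exI[of _ C] allI impI)
    fix p :: nat assume p: "prime p \<and> size (prime_factorization (p - 1)) \<le> d"
    then have "real p \<ge> 1" using prime_ge_1_nat by auto
    then have pe: "real p powr \<epsilon> \<ge> 1" using \<epsilon> by (simp add: ge_one_powr_ge_zero)
    show "real (least_primroot p) \<le> C * real p powr \<epsilon>"
    proof (cases "p \<ge> p0")
      case True
      then have "real (least_primroot p) \<le> 1 * real p powr \<epsilon>" using large[of p] p by simp
      also have "\<dots> \<le> C * real p powr \<epsilon>" using C by (intro mult_right_mono) auto
      finally show ?thesis .
    next
      case False
      then have "real (least_primroot p) \<le> (\<Sum>q<p0. real (least_primroot q))"
        by (intro member_le_sum) auto
      also have "\<dots> \<le> C * 1" by (simp add: C_def)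
      also have "\<dots> \<le> C * real p powr \<epsilon>" using pe C by (intro mult_left_mono) auto
      finally show ?thesis .
    qed
  qed
qed

end
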